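(* Let $L$ be a pseudo-Finsler metric defined on $A\subseteq\mathrm{T}M$. Suppose that (i) $Z\in\mathfrak{X}(M_A)$ is an anisotropic vector field, (ii) $V\in\mathfrak{X}^A(U)$ is an $A$-admissible vector field on an open set $U\subseteq M$, and (iii) $\overline{D}\subseteq U$ is a domain with $\partial D$ smooth up to a subset of $0$ $(n-1)$-dimensional measure on $M$ (a regularity under which Stokes' theorem can be applied on $\overline D$), and $\mathrm{Supp}(Z_V)\cap\overline{D}$ is compact. Then $$\int_D\mathrm{div}(Z)_V\,d\mathrm{Vol}_V+\int_D\left\{C^{\mathfrak m}(\mathrm{D}_ZV)+\mathrm{trace}(\dot\partial_{\mathrm{D}V}Z)\right\}d\mathrm{Vol}_V=\int_{\partial D}\imath_{Z_V}(d\mathrm{Vol}_V),$$ where $C^{\mathfrak m}$ is the mean Cartan tensor of $L$ (evaluated at $V$), $\mathrm{D}V$ is computed with the metric nonlinear connection of $L$, $\mathrm{D}_ZV$ means $\mathrm{D}_{Z_V}V$, and $\mathrm{trace}(\dot\partial_{\mathrm{D}V}Z)$ is the trace of the endomorphism field $Y\mapsto(\dot\partial_{\mathrm{D}_YV}Z)_V$ of $\mathrm{T}U$.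
   Context: $M$ is a connected oriented smooth manifold of dimension $n\ge2$, $\pi\colon\mathrm{T}M\to M$ is the projection, and $A\subseteq\mathrm{T}M\setminus\mathbf{0}$ is open with $\pi(A)=M$ and conic ($\lambda v\in A$ for $v\in A$, $\lambda>0$). Coordinates $x^i$ on $M$ induce coordinates $(x^i,y^i)$ on $\mathrm{T}M$; $\partial_i=\partial/\partial x^i$, $\dot\partial_i=\partial/\partial y^i$. An anisotropic tensor field $T\in\mathcal{T}^r_s(M_A)$ assigns smoothly to each $v\in A$ an $r$-contravariant $s$-covariant tensor $T_v$ on $\mathrm{T}_{\pi(v)}M$; $\mathfrak{X}(M_A)=\mathcal{T}^1_0(M_A)$, and $\Omega_s(M_A)$ denotes the alternating elements of $\mathcal{T}^0_s(M_A)$. For $U\subseteq M$ open, $\mathfrak{X}^A(U)$ is the set of vector fields $V$ on $U$ with $V_p\in A$ for all $p\in U$ ($A$-admissible fields); then $T_V$ is the ordinary tensor field $p\mapsto T_{V_p}$ on $U$. The vertical derivative along a vector $w\in\mathrm{T}_{\pi(v)}M$ is $(\dot\partial_wT)_v=\lim_{t\to0}(T_{v+tw}-T_v)/t$. A pseudo-Finsler metric on $A$ is a smooth positively $2$-homogeneous function $L\colon A\to\mathbb{R}$ whose fundamental tensor $g_{ij}=\frac12\dot\partial_i\dot\partial_jL$ is nondegenerate at each $v\in A$. Its Cartan tensor is $C_{ijk}=\frac12\dot\partial_kg_{ij}$ (indices raised with $g$) and its mean Cartan tensor is $C^{\mathfrak m}(X)=g^{ik}C_{ijk}X^j$. The metric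 nonlinear connection $\mathrm{H}A$ of $L$ is the horizontal subbundle of $\mathrm{T}A$ spanned by $\delta_i=\partial_i-N^j_i\dot\partial_j$ with $N^i_j=\gamma^i_{jk}y^k-C^i_{jk}\gamma^k_{ab}y^ay^b$, $\gamma^i_{jk}=\frac12g^{ic}(\partial_kg_{cj}+\partial_jg_{ck}-\partial_cg_{jk})$; its nonlinear covariant derivative is $\mathrm{D}_XV=X^j\left(\frac{\partial V^i}{\partial x^j}+N^i_j(V)\right)\partial_i$ for $X\in\mathfrak X(U)$, $V\in\mathfrak X^A(U)$. The metric (anisotropic) volume form is $d\mathrm{Vol}=\sqrt{|\det g_{ab}(x,y)|}\,dx^1\wedge\dots\wedge dx^n\in\Omega_n(M_A)$ in positively oriented coordinates. The anisotropic Lie bracket with $Z\in\mathfrak{X}(M_A)$, $\mathfrak{l}^{\mathrm{H}}_Z$, is the unique tensor derivation of anisotropic tensors ($\mathbb{R}$-linear, type-preserving, Leibniz for tensor products, commuting with contractions) with $\mathfrak{l}^{\mathrm{H}}_Zf=Z^k\delta_kf$ for smooth functions $f$ on $A$ and $\mathfrak{l}^{\mathrm{H}}_ZX=(Z^j\delta_jX^i-X^j\delta_jZ^i)\partial_i$ for $X\in\mathfrak{X}(M_A)$. The divergence of $Z$ with respect to $L$ is the function $\mathrm{div}(Z)$ on $A$ with $\mathfrak{l}^{\mathrm{H}}_Z(d\mathrm{Vol})=\mathrm{div}(Z)\,d\mathrm{Vol}$. A domain $\overline{D}$ is a nonempty connected set which coincides with the closure of its interior $D$; its boundary is $\partial\overline{D}=\partial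 D$. A subset of $M$ has $0$ $m$-dimensional measure if its intersection with any embedded $m$-dimensional submanifold $\sigma\subseteq M$ has measure $0$ in $\sigma$. Integrals over $\partial D$ are taken over its smooth part with the orientation induced as boundary of $D$ (outward/salient direction first). That Stokes' theorem can be applied on $\overline D$ means: $\int_Dd\eta=\int_{\partial D}\eta$ for every smooth $(n-1)$-form $\eta$ on $U$ with $\mathrm{Supp}(\eta)\cap\overline D$ compact. The interior product is $\imath_X\omega=\omega(X,-,\dots,-)$.
   Formalization: The formal theorem additionally assumes that div(Z)_V dVol_V is (absolutely) integrable on D; when D̄ is non-compact the two integrals on the left can diverge separately (as −∞ and +∞) although Supp(Z_V)∩D̄ is compact, so the displayed formula is then undefined. *)

theory Defs
  imports "HOL-Analysis.Analysis"
begin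

section \<open>Smooth maps between normed spaces\<close>

text \<open>The definition is meant for open \<open>S\<close>.\<close>

primrec Ck_on :: "nat \<Rightarrow> 'a::real_normed_vector set \<Rightarrow> ('a \<Rightarrow> 'b::real_normed_vector) \<Rightarrow> bool" where
  "Ck_on 0 S f = continuous_on S f"
| "Ck_on (Suc k) S f = ((\<forall>x\<in>S. f differentiable (at x)) \<and>
     (\<forall>v. Ck_on k S (\<lambda>x. frechet_derivative f (at x) v)))"

definition smooth_on :: "'a::real_normed_vector set \<Rightarrow> ('a \<Rightarrow> 'b::real_normed_vector) \<Rightarrow> bool" where
  "smooth_on S f \<longleftrightarrow> (\<forall>k. Ck_on k S f)"


section \<open>Oriented manifolds\<close>

text \<open>
  The manifold is the whole type \<open>'m\<close>; its dimension is \<open>CARD('n)\<close>. A chart is a pair (domain,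
  coordinate map); the values of the coordinate map off the domain are irrelevant. Coordinates are
  numbered from 0: the coordinate number \<open>k\<close> is the component \<open>coord_ix k\<close>, for a fixed
  enumeration of the index type. Orientations are read off in this order.
\<close>

type_synonym ('m, 'n) chart = "'m set \<times> ('m \<Rightarrow> real^'n)"

definition coord_ix :: "nat \<Rightarrow> 'n::finite" where
  "coord_ix k = from_nat_into UNIV k"

definition coord_num :: "'n::finite \<Rightarrow> nat" where
  "coord_num j = to_nat_on UNIV j"

definition chart_inv :: "('m, 'n::finite) chart \<Rightarrow> real^'n \<Rightarrow> 'm" where
  "chart_inv c = inv_into (fst c) (snd c)"

definition is_chart :: "('m::topological_space, 'n::finite) chart \<Rightarrow> bool" where
  "is_chart c \<longleftrightarrow> open (fst c) \<and> open (snd c ` fst c) \<and>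
     homeomorphism (fst c) (snd c ` fst c) (snd c) (chart_inv c)"

definition oriented_transition ::
    "('m, 'n::finite) chart \<Rightarrow> ('m, 'n) chart \<Rightarrow> bool" where
  "oriented_transition c c' \<longleftrightarrow>
     smooth_on (snd c ` (fst c \<inter> fst c')) (snd c' \<circ> chart_inv c) \<and>
     (\<forall>x \<in> snd c ` (fst c \<inter> fst c').
        det (matrix (frechet_derivative (snd c' \<circ> chart_inv c) (at x))) > 0)"

text \<open>A smooth oriented structure: a maximal atlas of positively oriented charts.\<close>

definition oriented_manifold :: "('m::topological_space, 'n::finite) chart set \<Rightarrow> bool" where
  "oriented_manifold M \<longleftrightarrow>
     (\<forall>c\<in>M. is_chart c) \<and> (\<Union>c\<in>M. fst c) = UNIV \<and>
     (\<forall>c\<in>M. \<forall>c'\<in>M. oriented_transition c c') \<and>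
     (\<forall>c. is_chart c \<and> (\<forall>c'\<in>M. oriented_transition c c' \<and> oriented_transition c' c)
        \<longrightarrow> c \<in> M)"


section \<open>Local formulas on \<open>\<real>\<^sup>n \<times> \<real>\<^sup>n\<close>\<close>

text \<open>Here \<open>F\<close> is the coordinate expression of the pseudo-Finsler metric, a function of
  \<open>z = (x, y)\<close>.\<close>

definition pdx :: "'n \<Rightarrow> ((real^'n) \<times> (real^'n::finite) \<Rightarrow> real) \<Rightarrow> (real^'n) \<times> (real^'n) \<Rightarrow> real" where
  "pdx i F z = frechet_derivative F (at z) (axis i 1, 0)"

definition pdy :: "'n \<Rightarrow> ((real^'n) \<times> (real^'n::finite) \<Rightarrow> real) \<Rightarrow> (real^'n) \<times> (real^'n) \<Rightarrow> real" where
  "pdy i F z = frechet_derivative F (at z) (0, axis i 1)"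

context
  fixes F :: "(real^'n) \<times> (real^'n::finite) \<Rightarrow> real"
begin

definition fund_tensor :: "(real^'n) \<times> (real^'n) \<Rightarrow> real^'n^'n" where
  "fund_tensor z = (\<chi> i j. (1/2) * pdy i (pdy j F) z)"

definition fund_inv :: "(real^'n) \<times> (real^'n) \<Rightarrow> real^'n^'n" where
  "fund_inv z = matrix_inv (fund_tensor z)"

definition cartan :: "'n \<Rightarrow> 'n \<Rightarrow> 'n \<Rightarrow> (real^'n) \<times> (real^'n) \<Rightarrow> real" where
  "cartan i j k z = (1/2) * pdy k (\<lambda>z. fund_tensor z $ i $ j) z"

definition cartan_up :: "'n \<Rightarrow> 'n \<Rightarrow> 'n \<Rightarrow> (real^'n) \<times> (real^'n) \<Rightarrow> real" where
  "cartan_up i j k z = (\<Sum>c\<in>UNIV. fund_inv z $ i $ c * cartan c j k z)"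

definition mean_cartan :: "(real^'n) \<times> (real^'n) \<Rightarrow> real^'n \<Rightarrow> real" where
  "mean_cartan z X =
     (\<Sum>i\<in>UNIV. \<Sum>j\<in>UNIV. \<Sum>k\<in>UNIV. fund_inv z $ i $ k * cartan i j k z * X $ j)"

definition christoffel :: "'n \<Rightarrow> 'n \<Rightarrow> 'n \<Rightarrow> (real^'n) \<times> (real^'n) \<Rightarrow> real" where
  "christoffel i j k z =
     (1/2) * (\<Sum>c\<in>UNIV. fund_inv z $ i $ c *
        (pdx k (\<lambda>z. fund_tensor z $ c $ j) z + pdx j (\<lambda>z. fund_tensor z $ c $ k) z
         - pdx c (\<lambda>z. fund_tensor z $ j $ k) z))"

text \<open>\<open>nonlin i j\<close> is \<open>N\<^sup>i\<^sub>j\<close>.\<close>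

definition nonlin :: "'n \<Rightarrow> 'n \<Rightarrow> (real^'n) \<times> (real^'n) \<Rightarrow> real" where
  "nonlin i j z =
     (\<Sum>k\<in>UNIV. christoffel i j k z * snd z $ k)
     - (\<Sum>k\<in>UNIV. \<Sum>a\<in>UNIV. \<Sum>b\<in>UNIV.
          cartan_up i j k z * christoffel k a b z * snd z $ a * snd z $ b)"

text \<open>\<open>hor i G\<close> is \<open>\<delta>\<^sub>i G\<close>.\<close>

definition hor :: "'n \<Rightarrow> ((real^'n) \<times> (real^'n) \<Rightarrow> real) \<Rightarrow> (real^'n) \<times> (real^'n) \<Rightarrow> real" where
  "hor i G z = pdx i G z - (\<Sum>j\<in>UNIV. nonlin j i z * pdy j G z)"

end


section \<open>The tangent bundle\<close>

text \<open>
  Each tangent space is modelled on \<open>real^'n\<close>: the pair \<open>(p, v)\<close> denotes the tangent vector at \<open>p\<close>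
  whose coordinates in a fixed preferred chart \<open>chart_at M p\<close> around \<open>p\<close> are \<open>v\<close>. The preferred
  chart is chosen pointwise, so \<open>'m \<times> real^'n\<close> does not carry the product topology; topology and
  smoothness are always expressed through charts. \<open>to_coords M c p\<close> sends a tangent
  vector at \<open>p\<close> to its components in the chart \<open>c\<close>, and \<open>of_coords M c p\<close> is its inverse.
\<close>

type_synonym ('m, 'n) tvec = "'m \<times> (real^'n)"

context
  fixes M :: "('m::topological_space, 'n::finite) chart set"
begin

definition chart_at :: "'m \<Rightarrow> ('m, 'n) chart" where
  "chart_at p = (SOME c. c \<in> M \<and> p \<in> fst c)"

definition to_coords :: "('m, 'n) chart \<Rightarrow> 'm \<Rightarrow> real^'n \<Rightarrow> real^'n" where
  "to_coords c p =
     frechet_derivative (snd c \<circ> chart_inv (chart_at p)) (at (snd (chart_at p) p))"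

definition of_coords :: "('m, 'n) chart \<Rightarrow> 'm \<Rightarrow> real^'n \<Rightarrow> real^'n" where
  "of_coords c p =
     frechet_derivative (snd (chart_at p) \<circ> chart_inv c) (at (snd c p))"

definition coord_vec :: "('m, 'n) chart \<Rightarrow> 'm \<Rightarrow> 'n \<Rightarrow> real^'n" where
  "coord_vec c p i = of_coords c p (axis i 1)"

definition coord_covec :: "('m, 'n) chart \<Rightarrow> 'm \<Rightarrow> 'n \<Rightarrow> (real^'n) \<Rightarrow>\<^sub>L real" where
  "coord_covec c p i = Blinfun (\<lambda>v. to_coords c p v $ i)"

definition tchart :: "('m, 'n) chart \<Rightarrow> ('m, 'n) tvec \<Rightarrow> (real^'n) \<times> (real^'n)" where
  "tchart c v = (snd c (fst v), to_coords c (fst v) (snd v))"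

definition tchart_inv :: "('m, 'n) chart \<Rightarrow> (real^'n) \<times> (real^'n) \<Rightarrow> ('m, 'n) tvec" where
  "tchart_inv c z = (chart_inv c (fst z), of_coords c (chart_inv c (fst z)) (snd z))"

definition timage :: "('m, 'n) chart \<Rightarrow> ('m, 'n) tvec set \<Rightarrow> ((real^'n) \<times> (real^'n)) set" where
  "timage c A = tchart c ` {v\<in>A. fst v \<in> fst c}"

text \<open>Open conic subsets of the slit tangent bundle projecting onto the manifold.\<close>

definition admissible_cone :: "('m, 'n) tvec set \<Rightarrow> bool" where
  "admissible_cone A \<longleftrightarrow>
     (\<forall>c\<in>M. open (timage c A)) \<and> (\<forall>(p, v)\<in>A. v \<noteq> 0) \<and> fst ` A = UNIV \<and>
     (\<forall>p v. \<forall>a>0. (p, v) \<in> A \<longrightarrow> (p, a *\<^sub>R v) \<in> A)"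

end


section \<open>Anisotropic tensor fields\<close>

text \<open>
  An \<open>r\<close>-contravariant \<open>s\<close>-covariant tensor takes a list of \<open>r\<close> covectors and a list of \<open>s\<close> vectors.
  Tensors vanish on lists of other lengths and tensor fields vanish off \<open>A\<close>, so that equality of
  tensor fields is equality of functions.
\<close>

type_synonym 'n tensor = "((real^'n) \<Rightarrow>\<^sub>L real) list \<Rightarrow> (real^'n) list \<Rightarrow> real"
type_synonym ('m, 'n) tensor_field = "('m, 'n) tvec \<Rightarrow> 'n tensor"

definition is_tensor :: "nat \<Rightarrow> nat \<Rightarrow> 'n::finite tensor \<Rightarrow> bool" where
  "is_tensor r s T \<longleftrightarrow>
     (\<forall>\<alpha>s vs. length \<alpha>s \<noteq> r \<or> length vs \<noteq> s \<longrightarrow> T \<alpha>s vs = 0) \<and>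
     (\<forall>\<alpha>s \<beta>s vs. linear (\<lambda>\<alpha>. T (\<alpha>s @ \<alpha> # \<beta>s) vs)) \<and>
     (\<forall>\<alpha>s vs ws. linear (\<lambda>v. T \<alpha>s (vs @ v # ws)))"

definition tensor_fields ::
    "('m::topological_space, 'n::finite) chart set \<Rightarrow> ('m, 'n) tvec set \<Rightarrow> nat \<Rightarrow> nat
      \<Rightarrow> ('m, 'n) tensor_field set" where
  "tensor_fields M A r s =
     {T. (\<forall>v\<in>A. is_tensor r s (T v)) \<and> (\<forall>v. v \<notin> A \<longrightarrow> T v = (\<lambda>_ _. 0)) \<and>
         (\<forall>c\<in>M. \<forall>ks js. length ks = r \<and> length js = s \<longrightarrow>
            smooth_on (timage M c A)
              (\<lambda>z. T (tchart_inv M c z)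
                     (map (coord_covec M c (chart_inv c (fst z))) ks)
                     (map (coord_vec M c (chart_inv c (fst z))) js)))}"

definition fun_tensor ::
    "('m, 'n::finite) tvec set \<Rightarrow> (('m, 'n) tvec \<Rightarrow> real) \<Rightarrow> ('m, 'n) tensor_field" where
  "fun_tensor A f = (\<lambda>v \<alpha>s vs. if v \<in> A \<and> \<alpha>s = [] \<and> vs = [] then f v else 0)"

definition vec_tensor ::
    "('m, 'n::finite) tvec set \<Rightarrow> (('m, 'n) tvec \<Rightarrow> real^'n) \<Rightarrow> ('m, 'n) tensor_field" where
  "vec_tensor A X = (\<lambda>v \<alpha>s vs. if v \<in> A \<and> length \<alpha>s = 1 \<and> vs = []
      then blinfun_apply (hd \<alpha>s) (X v) else 0)"

abbreviation smooth_fun ::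
    "('m::topological_space, 'n::finite) chart set \<Rightarrow> ('m, 'n) tvec set
      \<Rightarrow> (('m, 'n) tvec \<Rightarrow> real) \<Rightarrow> bool" where
  "smooth_fun M A f \<equiv> fun_tensor A f \<in> tensor_fields M A 0 0"

abbreviation vector_field ::
    "('m::topological_space, 'n::finite) chart set \<Rightarrow> ('m, 'n) tvec set
      \<Rightarrow> (('m, 'n) tvec \<Rightarrow> real^'n) \<Rightarrow> bool" where
  "vector_field M A X \<equiv> vec_tensor A X \<in> tensor_fields M A 1 0"

text \<open>The tensor product of a tensor field of type \<open>(r, s)\<close> with another one.\<close>

definition tensor_prod ::
    "nat \<Rightarrow> nat \<Rightarrow> ('m, 'n::finite) tensor_field \<Rightarrow> ('m, 'n) tensor_field
      \<Rightarrow> ('m, 'n) tensor_field" where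
  "tensor_prod r s S T =
     (\<lambda>v \<alpha>s vs. S v (take r \<alpha>s) (take s vs) * T v (drop r \<alpha>s) (drop s vs))"

definition insert_nth :: "nat \<Rightarrow> 'a \<Rightarrow> 'a list \<Rightarrow> 'a list" where
  "insert_nth i x xs = take i xs @ x # drop i xs"

definition contract ::
    "nat \<Rightarrow> nat \<Rightarrow> ('m, 'n::finite) tensor_field \<Rightarrow> ('m, 'n) tensor_field" where
  "contract i j T =
     (\<lambda>v \<alpha>s vs. \<Sum>k\<in>UNIV. T v (insert_nth i (blinfun_inner_right (axis k 1)) \<alpha>s)
                             (insert_nth j (axis k 1) vs))"

definition tensor_derivation ::
    "('m::topological_space, 'n::finite) chart set \<Rightarrow> ('m, 'n) tvec set
      \<Rightarrow> (('m, 'n) tensor_field \<Rightarrow> ('m, 'n) tensor_field) \<Rightarrow> bool" where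
  "tensor_derivation M A l \<longleftrightarrow>
     (\<forall>r s. \<forall>T\<in>tensor_fields M A r s. l T \<in> tensor_fields M A r s) \<and>
     (\<forall>r s. \<forall>S\<in>tensor_fields M A r s. \<forall>T\<in>tensor_fields M A r s. \<forall>a b.
        l (\<lambda>v \<alpha>s vs. a * S v \<alpha>s vs + b * T v \<alpha>s vs)
        = (\<lambda>v \<alpha>s vs. a * l S v \<alpha>s vs + b * l T v \<alpha>s vs)) \<and>
     (\<forall>r s r' s'. \<forall>S\<in>tensor_fields M A r s. \<forall>T\<in>tensor_fields M A r' s'.
        l (tensor_prod r s S T)
        = (\<lambda>v \<alpha>s vs. tensor_prod r s (l S) T v \<alpha>s vs + tensor_prod r s S (l T) v \<alpha>s vs)) \<and>
     (\<forall>r s. \<forall>T\<in>tensor_fields M A r s. \<forall>i<r. \<forall>j<s. l (contract i j T) = contract i j (l T))"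


section \<open>Pseudo-Finsler metrics\<close>

definition pseudo_finsler ::
    "('m::topological_space, 'n::finite) chart set \<Rightarrow> ('m, 'n) tvec set
      \<Rightarrow> (('m, 'n) tvec \<Rightarrow> real) \<Rightarrow> bool" where
  "pseudo_finsler M A L \<longleftrightarrow>
     smooth_fun M A L \<and>
     (\<forall>p v. \<forall>a>0. (p, v) \<in> A \<longrightarrow> L (p, a *\<^sub>R v) = a\<^sup>2 * L (p, v)) \<and>
     (\<forall>c\<in>M. \<forall>z\<in>timage M c A. invertible (fund_tensor (L \<circ> tchart_inv M c) z))"

text \<open>
  The objects below are invariantly defined; their value at a point \<open>p\<close> is computed from the
  coordinate formulas in the preferred chart at \<open>p\<close>.
\<close>

context
  fixes M :: "('m::topological_space, 'n::finite) chart set"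
    and A :: "('m, 'n) tvec set"
    and L :: "('m, 'n) tvec \<Rightarrow> real"
begin

definition coord_comp ::
    "('m, 'n) chart \<Rightarrow> (('m, 'n) tvec \<Rightarrow> real^'n) \<Rightarrow> 'n \<Rightarrow> (real^'n) \<times> (real^'n) \<Rightarrow> real" where
  "coord_comp c X i z = to_coords M c (chart_inv c (fst z)) (X (tchart_inv M c z)) $ i"

text \<open>\<open>Z\<^sup>k \<delta>\<^sub>k f\<close>\<close>

definition hor_deriv ::
    "(('m, 'n) tvec \<Rightarrow> real^'n) \<Rightarrow> (('m, 'n) tvec \<Rightarrow> real) \<Rightarrow> ('m, 'n) tvec \<Rightarrow> real" where
  "hor_deriv Z f v =
     (let c = chart_at M (fst v); F = L \<circ> tchart_inv M c; z = tchart M c v in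
      \<Sum>k\<in>UNIV. coord_comp c Z k z * hor F k (f \<circ> tchart_inv M c) z)"

text \<open>\<open>(Z\<^sup>j \<delta>\<^sub>j X\<^sup>i - X\<^sup>j \<delta>\<^sub>j Z\<^sup>i) \<partial>\<^sub>i\<close>\<close>

definition hor_bracket ::
    "(('m, 'n) tvec \<Rightarrow> real^'n) \<Rightarrow> (('m, 'n) tvec \<Rightarrow> real^'n) \<Rightarrow> ('m, 'n) tvec \<Rightarrow> real^'n" where
  "hor_bracket Z X v =
     (let c = chart_at M (fst v); F = L \<circ> tchart_inv M c; z = tchart M c v in
      of_coords M c (fst v)
        (\<chi> i. \<Sum>j\<in>UNIV. coord_comp c Z j z * hor F j (coord_comp c X i) z
                    - coord_comp c X j z * hor F j (coord_comp c Z i) z))"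

definition is_aniso_lie_bracket ::
    "(('m, 'n) tvec \<Rightarrow> real^'n) \<Rightarrow> (('m, 'n) tensor_field \<Rightarrow> ('m, 'n) tensor_field) \<Rightarrow> bool" where
  "is_aniso_lie_bracket Z l \<longleftrightarrow>
     tensor_derivation M A l \<and>
     (\<forall>f. smooth_fun M A f \<longrightarrow> l (fun_tensor A f) = fun_tensor A (hor_deriv Z f)) \<and>
     (\<forall>X. vector_field M A X \<longrightarrow> l (vec_tensor A X) = vec_tensor A (hor_bracket Z X))"

text \<open>
  The factor \<open>det (\<dots>)\<close> is \<open>dx\<^sup>1 \<and> \<dots> \<and> dx\<^sup>n\<close> evaluated on the list \<open>vs\<close>.
\<close>

definition vol_form :: "('m, 'n) tensor_field" where
  "vol_form v \<alpha>s vs =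
     (if v \<in> A \<and> \<alpha>s = [] \<and> length vs = CARD('n)
      then (let c = chart_at M (fst v) in
            sqrt \<bar>det (fund_tensor (L \<circ> tchart_inv M c) (tchart M c v))\<bar>
            * det (\<chi> i j. to_coords M c (fst v) (vs ! coord_num j) $ i))
      else 0)"

text \<open>\<open>is_divergence Z d\<close>: \<open>d\<close> is the divergence of \<open>Z\<close> with respect to \<open>L\<close>, i.e.
  \<open>l\<^sub>Z dVol = d dVol\<close> for the anisotropic Lie bracket \<open>l\<^sub>Z\<close>, which exists and is unique on
  tensor fields.\<close>

definition is_divergence ::
    "(('m, 'n) tvec \<Rightarrow> real^'n) \<Rightarrow> (('m, 'n) tvec \<Rightarrow> real) \<Rightarrow> bool" where
  "is_divergence Z d \<longleftrightarrow>
     (\<exists>l. is_aniso_lie_bracket Z l \<and> l vol_form = (\<lambda>v \<alpha>s vs. d v * vol_form v \<alpha>s vs))"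

text \<open>Smooth vector fields \<open>V\<close> on \<open>U\<close> with values in \<open>A\<close>.\<close>

definition admissible_field :: "'m set \<Rightarrow> ('m \<Rightarrow> real^'n) \<Rightarrow> bool" where
  "admissible_field U V \<longleftrightarrow>
     (\<forall>p\<in>U. (p, V p) \<in> A) \<and>
     (\<forall>c\<in>M. smooth_on (snd c ` (fst c \<inter> U))
        (\<lambda>x. to_coords M c (chart_inv c x) (V (chart_inv c x))))"

text \<open>\<open>cov_deriv Y V p\<close> is \<open>D\<^sub>Y V\<close> for \<open>Y\<close> in the tangent space at \<open>p\<close>.\<close>

definition cov_deriv :: "real^'n \<Rightarrow> ('m \<Rightarrow> real^'n) \<Rightarrow> 'm \<Rightarrow> real^'n" where
  "cov_deriv Y V p =
     (let c = chart_at M p; F = L \<circ> tchart_inv M c in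
      of_coords M c p
        (\<chi> i. \<Sum>j\<in>UNIV. to_coords M c p Y $ j *
           (frechet_derivative (\<lambda>x. to_coords M c (chart_inv c x) (V (chart_inv c x)) $ i)
              (at (snd c p)) (axis j 1)
            + nonlin F i j (tchart M c (p, V p)))))"

definition mean_cartan_at :: "('m, 'n) tvec \<Rightarrow> real^'n \<Rightarrow> real" where
  "mean_cartan_at v X =
     (let c = chart_at M (fst v) in
      mean_cartan (L \<circ> tchart_inv M c) (tchart M c v) (to_coords M c (fst v) X))"

end

definition vert_deriv ::
    "real^'n \<Rightarrow> (('m, 'n::finite) tvec \<Rightarrow> real^'n) \<Rightarrow> ('m, 'n) tvec \<Rightarrow> real^'n" where
  "vert_deriv w Z v =
     Lim (at 0) (\<lambda>t::real. (1 / t) *\<^sub>R (Z (fst v, snd v + t *\<^sub>R w) - Z v))"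


section \<open>Differential forms\<close>

type_synonym ('m, 'n) form = "'m \<Rightarrow> (real^'n) list \<Rightarrow> real"

definition alt_form :: "nat \<Rightarrow> ((real^'n::finite) list \<Rightarrow> real) \<Rightarrow> bool" where
  "alt_form k \<omega> \<longleftrightarrow>
     (\<forall>vs. length vs \<noteq> k \<longrightarrow> \<omega> vs = 0) \<and>
     (\<forall>vs ws. linear (\<lambda>v. \<omega> (vs @ v # ws))) \<and>
     (\<forall>vs. \<not> distinct vs \<longrightarrow> \<omega> vs = 0)"

definition interior_product ::
    "('m \<Rightarrow> real^'n) \<Rightarrow> ('m, 'n::finite) form \<Rightarrow> ('m, 'n) form" where
  "interior_product X \<omega> = (\<lambda>p vs. \<omega> p (X p # vs))"

context
  fixes M :: "('m::topological_space, 'n::finite) chart set"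
begin

definition smooth_form :: "nat \<Rightarrow> 'm set \<Rightarrow> ('m, 'n) form \<Rightarrow> bool" where
  "smooth_form k U \<omega> \<longleftrightarrow>
     (\<forall>p\<in>U. alt_form k (\<omega> p)) \<and>
     (\<forall>c\<in>M. \<forall>js. length js = k \<longrightarrow>
        smooth_on (snd c ` (fst c \<inter> U))
          (\<lambda>x. \<omega> (chart_inv c x) (map (coord_vec M c (chart_inv c x)) js)))"

text \<open>The usual formula for \<open>d\<omega>\<close> on vector fields with constant components in the preferred
  chart at \<open>p\<close>.\<close>

definition ext_deriv :: "('m, 'n) form \<Rightarrow> ('m, 'n) form" where
  "ext_deriv \<omega> p vs =
     (let c = chart_at M p; us = map (to_coords M c p) vs in
      \<Sum>i<length us. (- 1) ^ i *
        frechet_derivative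
          (\<lambda>x. \<omega> (chart_inv c x)
                 (map (of_coords M c (chart_inv c x)) (take i us @ drop (Suc i) us)))
          (at (snd c p)) (us ! i))"

end


section \<open>Integration of forms and sets of measure zero\<close>

text \<open>
  An \<open>m\<close>-dimensional submanifold is described by charts in which it is the slice where the first
  \<open>n - m\<close> coordinates vanish; the last \<open>m\<close> coordinates, in their order, are then its coordinates.
  Points of the slice are represented by functions on \<open>{n - m..<n}\<close>, with the product Lebesgue
  measure. For \<open>m = n\<close> the slice is the whole chart.
\<close>

definition slice_measure :: "'n::finite itself \<Rightarrow> nat \<Rightarrow> (nat \<Rightarrow> real) measure" where
  "slice_measure _ m = Pi\<^sub>M {CARD('n) - m..<CARD('n)} (\<lambda>_. lborel)"

definition slice_point :: "nat \<Rightarrow> (nat \<Rightarrow> real) \<Rightarrow> real^'n::finite" where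
  "slice_point m f = (\<chi> j. if coord_num j < CARD('n) - m then 0 else f (coord_num j))"

definition is_slice_chart :: "nat \<Rightarrow> 'm set \<Rightarrow> ('m, 'n::finite) chart \<Rightarrow> bool" where
  "is_slice_chart m \<sigma> c \<longleftrightarrow>
     (\<forall>q\<in>fst c. q \<in> \<sigma> \<longleftrightarrow> (\<forall>i<CARD('n) - m. snd c q $ coord_ix i = 0))"

definition embedded_submanifold ::
    "('m::topological_space, 'n::finite) chart set \<Rightarrow> nat \<Rightarrow> 'm set \<Rightarrow> bool" where
  "embedded_submanifold M m \<sigma> \<longleftrightarrow> (\<forall>p\<in>\<sigma>. \<exists>c\<in>M. p \<in> fst c \<and> is_slice_chart m \<sigma> c)"

definition zero_measure ::
    "('m::topological_space, 'n::finite) chart set \<Rightarrow> nat \<Rightarrow> 'm set \<Rightarrow> bool" where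
  "zero_measure M m S \<longleftrightarrow>
     (\<forall>\<sigma>. embedded_submanifold M m \<sigma> \<longrightarrow>
        (\<forall>c\<in>M. is_slice_chart m \<sigma> c \<longrightarrow>
           {f \<in> space (slice_measure TYPE('n) m). slice_point m f \<in> snd c ` (fst c \<inter> \<sigma> \<inter> S)}
             \<in> null_sets (completion (slice_measure TYPE('n) m))))"

text \<open>
  The integral of the \<open>m\<close>-form \<open>\<omega>\<close> over a set \<open>S\<close> which is covered by charts from \<open>C\<close> and is
  contained in their \<open>m\<close>-dimensional slices. \<open>S\<close> is decomposed into countably many disjoint Borel
  pieces, each one in a single chart; by the change of variables formula neither integrability nor
  the value depends on the choice of the countable cover \<open>cover_seq C S\<close> (provided that transitions
  between charts in \<open>C\<close> preserve the orientation of the slices).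
\<close>

definition cover_seq ::
    "('m, 'n::finite) chart set \<Rightarrow> 'm set \<Rightarrow> nat \<Rightarrow> ('m, 'n) chart" where
  "cover_seq C S = (SOME c. range c \<subseteq> C \<and> S \<subseteq> (\<Union>k. fst (c k)))"

context
  fixes M :: "('m::topological_space, 'n::finite) chart set"
begin

definition local_integrand ::
    "nat \<Rightarrow> ('m, 'n) chart set \<Rightarrow> 'm set \<Rightarrow> ('m, 'n) form \<Rightarrow> nat \<Rightarrow> (nat \<Rightarrow> real) \<Rightarrow> real" where
  "local_integrand m C S \<omega> k f =
     (let c = cover_seq C S k; x = slice_point m f; p = chart_inv c x in
      indicator (snd c ` (S \<inter> disjointed (\<lambda>i. fst (cover_seq C S i)) k)) x
      * \<omega> p (map (\<lambda>i. coord_vec M c p (coord_ix i)) [CARD('n) - m..<CARD('n)]))"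

definition form_integrable ::
    "nat \<Rightarrow> ('m, 'n) chart set \<Rightarrow> 'm set \<Rightarrow> ('m, 'n) form \<Rightarrow> bool" where
  "form_integrable m C S \<omega> \<longleftrightarrow>
     (\<forall>k. integrable (slice_measure TYPE('n) m) (local_integrand m C S \<omega> k)) \<and>
     summable (\<lambda>k. \<integral>f. \<bar>local_integrand m C S \<omega> k f\<bar> \<partial>slice_measure TYPE('n) m)"

definition form_integral ::
    "nat \<Rightarrow> ('m, 'n) chart set \<Rightarrow> 'm set \<Rightarrow> ('m, 'n) form \<Rightarrow> real" where
  "form_integral m C S \<omega> =
     (\<Sum>k. \<integral>f. local_integrand m C S \<omega> k f \<partial>slice_measure TYPE('n) m)"

end


section \<open>Domains and Stokes' theorem\<close>

text \<open>Throughout, \<open>K\<close> is the closed domain, \<open>interior K\<close> the corresponding open domain and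
  \<open>frontier K\<close> the boundary of both.\<close>

definition is_domain :: "'m::topological_space set \<Rightarrow> bool" where
  "is_domain K \<longleftrightarrow> K \<noteq> {} \<and> connected K \<and> K = closure (interior K)"

context
  fixes M :: "('m::topological_space, 'n::finite) chart set"
begin

text \<open>
  Charts in which the domain is \<open>x\<^sup>1 < 0\<close>. The vector \<open>\<partial>\<^sub>1\<close> then points outwards along the boundary,
  so \<open>(x\<^sup>2, \<dots>, x\<^sup>n)\<close> are positively oriented coordinates of the boundary.
\<close>

definition boundary_charts :: "'m set \<Rightarrow> ('m, 'n) chart set" where
  "boundary_charts K =
     {c\<in>M. \<forall>q\<in>fst c. (q \<in> interior K \<longleftrightarrow> snd c q $ coord_ix 0 < 0) \<and>
                      (q \<in> frontier K \<longleftrightarrow> snd c q $ coord_ix 0 = 0)}"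

definition smooth_boundary :: "'m set \<Rightarrow> 'm set" where
  "smooth_boundary K = {p \<in> frontier K. \<exists>c\<in>boundary_charts K. p \<in> fst c}"

definition almost_smooth_boundary :: "'m set \<Rightarrow> bool" where
  "almost_smooth_boundary K \<longleftrightarrow> zero_measure M (CARD('n) - 1) (frontier K - smooth_boundary K)"

abbreviation domain_integrable :: "'m set \<Rightarrow> ('m, 'n) form \<Rightarrow> bool" where
  "domain_integrable K \<omega> \<equiv> form_integrable M CARD('n) M (interior K) \<omega>"

abbreviation domain_integral :: "'m set \<Rightarrow> ('m, 'n) form \<Rightarrow> real" where
  "domain_integral K \<omega> \<equiv> form_integral M CARD('n) M (interior K) \<omega>"

abbreviation boundary_integrable :: "'m set \<Rightarrow> ('m, 'n) form \<Rightarrow> bool" where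
  "boundary_integrable K \<eta> \<equiv>
     form_integrable M (CARD('n) - 1) (boundary_charts K) (smooth_boundary K) \<eta>"

abbreviation boundary_integral :: "'m set \<Rightarrow> ('m, 'n) form \<Rightarrow> real" where
  "boundary_integral K \<eta> \<equiv>
     form_integral M (CARD('n) - 1) (boundary_charts K) (smooth_boundary K) \<eta>"

text \<open>Since \<open>K \<subseteq> U\<close>, the closure of the non-vanishing set may be taken in the whole manifold.\<close>

definition stokes_applicable :: "'m set \<Rightarrow> 'm set \<Rightarrow> bool" where
  "stokes_applicable U K \<longleftrightarrow>
     (\<forall>\<eta>. smooth_form M (CARD('n) - 1) U \<eta> \<and>
          compact (closure {p\<in>U. \<exists>vs. \<eta> p vs \<noteq> 0} \<inter> K) \<longrightarrow>
        domain_integrable K (ext_deriv M \<eta>) \<and> boundary_integrable K \<eta> \<and>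
        domain_integral K (ext_deriv M \<eta>) = boundary_integral K \<eta>)"

end

end

theory Submission
  imports Defs
begin

text \<open>
  Put \<open>\<eta> = \<iota>(Z\<^sub>V) dVol\<^sub>V\<close>; by Stokes it suffices to show that \<open>d\<eta>\<close> is the sum of the two integrands.
  In coordinates \<open>\<eta>\<close> is the contraction of the constant volume form with \<open>s(x, V) Z(x, V)\<close>, where
  \<open>s = \<surd>|det g|\<close>, so \<open>d\<eta>\<close> is the trace of the differential of this vector. By the chain rule
  the derivative of \<open>G(x, V(x))\<close> along \<open>\<partial>\<^sub>j\<close> is \<open>\<delta>\<^sub>j G\<close> plus the vertical derivative of \<open>G\<close> along
  \<open>D\<^sub>j V\<close>. The horizontal parts add up to \<open>s div Z\<close>, which follows by applying the
  tensor derivation to \<open>dVol(X\<^sub>1, \<dots>, X\<^sub>n)\<close> for globally defined fields that agree to first order with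
  the coordinate fields at a given point; the vertical derivative of \<open>Z\<close> gives the trace term, and
  that of \<open>s\<close> gives the mean Cartan tensor by Jacobi's formula.
\<close>

section \<open>Calculus of smooth maps\<close>

text \<open>The pointwise identity is computed in the preferred chart at the point, where
  \<open>to_coords\<close> is the identity. The other charts matter for smoothness: Stokes' theorem
  and the tensor derivation only accept objects that are smooth in every chart. This forces the
  transformation law of the density, hence of the fundamental tensor; it is read off from curves
  \<open>w + t u\<close> inside one tangent space, along which the derivatives of \<open>L\<close>
  do not depend on a chart. Jacobi's formula contracts the first two indices of the Cartan tensor,
  the mean Cartan tensor the first and the third, so the symmetry of third vertical derivatives is
  needed; this is the purpose of the section on second derivatives. The formula for the exterior
  derivative is proved on linearly independent lists of vectors. Coordinate frames are such lists,
  and the integral evaluates forms on nothing else. The left-hand side is split by subtraction: the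
  exterior derivative is integrable by Stokes, the divergence term by assumption, and the remaining
  integrand is their difference.\<close>

lemma Ck_on_continuous: "Ck_on k S f \<Longrightarrow> continuous_on S f"
  by (cases k) (auto simp: continuous_at_imp_continuous_on differentiable_imp_continuous_within)

lemma Ck_on_SucD: "Ck_on (Suc k) S f \<Longrightarrow> Ck_on k S f"
  by (induction k arbitrary: f)
    (auto simp: continuous_at_imp_continuous_on differentiable_imp_continuous_within)

text \<open>Differentiability is not at issue: \<open>f\<close> and \<open>g\<close> have the same
  set of derivatives at \<open>x\<close>, so the choice operator picks the same one.\<close>

lemma frechet_derivative_cong_open:
  assumes "open S" "x \<in> S" "\<And>x. x \<in> S \<Longrightarrow> f x = g x"
  shows "frechet_derivative f (at x) = frechet_derivative g (at x)"
proof -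
  have "(f has_derivative D) (at x) \<longleftrightarrow> (g has_derivative D) (at x)" for D
    using has_derivative_transform_within_open[of f D x UNIV S g]
      has_derivative_transform_within_open[of g D x UNIV S f] assms by auto
  then show ?thesis by (simp add: frechet_derivative_def)
qed

lemma differentiable_cong_open:
  assumes "open S" "x \<in> S" "\<And>x. x \<in> S \<Longrightarrow> f x = g x"
  shows "f differentiable (at x) \<longleftrightarrow> g differentiable (at x)"
  unfolding differentiable_def
    using has_derivative_transform_within_open[of f _ x UNIV S g]
      has_derivative_transform_within_open[of g _ x UNIV S f] assms by auto

lemma Ck_on_cong:
  assumes "open S" "\<And>x. x \<in> S \<Longrightarrow> f x = g x" "Ck_on k S f"
  shows "Ck_on k S g"
  using assms(2,3)
proof (induction k arbitrary: f g)
  case 0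
  then show ?case by simp
next
  case (Suc k)
  have "Ck_on k S (\<lambda>x. frechet_derivative g (at x) v)" for v
    by (rule Suc.IH[of "\<lambda>x. frechet_derivative f (at x) v"])
      (use Suc.prems frechet_derivative_cong_open[OF assms(1), of _ f g] in auto)
  moreover have "g differentiable (at x)" if "x \<in> S" for x
    using differentiable_cong_open[OF assms(1) that, of f g] Suc.prems that by auto
  ultimately show ?case by auto
qed

lemma Ck_on_subset: "T \<subseteq> S \<Longrightarrow> Ck_on k S f \<Longrightarrow> Ck_on k T f"
  by (induction k arbitrary: f) (auto intro: continuous_on_subset)

text \<open>Serves to glue fields defined by cases, such as the cut-off coordinate fields, which are
  smooth near each point for different reasons.\<close>

lemma Ck_on_local:
  assumes "\<And>x. x \<in> S \<Longrightarrow> \<exists>T. open T \<and> x \<in> T \<and> Ck_on k (S \<inter> T) f"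
  shows "Ck_on k S f"
  using assms
proof (induction k arbitrary: f)
  case 0
  show ?case
  proof -
    have "continuous (at x within S) f" if x: "x \<in> S" for x
    proof -
      obtain T where T: "open T" "x \<in> T" "continuous_on (S \<inter> T) f"
        using 0 x by auto
      have "at x within (S \<inter> T) = at x within S"
        by (rule at_within_nhd[OF T(2,1)]) auto
      moreover have "continuous (at x within (S \<inter> T)) f"
        using T x by (simp add: continuous_on_eq_continuous_within)
      ultimately show ?thesis by (simp only:)
    qed
    then show ?thesis
      by (simp add: continuous_on_eq_continuous_within)
  qed
next
  case (Suc k)
  have "Ck_on k S (\<lambda>x. frechet_derivative f (at x) v)" for v
    by (rule Suc.IH) (use Suc.prems in fastforce)
  moreover have "f differentiable (at x)" if "x \<in> S" for x
    using Suc.prems[OF that] that by auto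
  ultimately show ?case by auto
qed

lemma Ck_on_const: "Ck_on k S (\<lambda>x. c)"
  by (induction k arbitrary: c) auto

text \<open>Lets the inductions below work with an explicit derivative \<open>D\<close> in place of
  the chosen one; openness makes the two agree near each point.\<close>

lemma Ck_on_SucI:
  assumes "open S" "\<And>x. x \<in> S \<Longrightarrow> (f has_derivative D x) (at x)"
    and "\<And>v. Ck_on k S (\<lambda>x. D x v)"
  shows "Ck_on (Suc k) S f"
proof -
  have "frechet_derivative f (at x) = D x" if "x \<in> S" for x
    using frechet_derivative_at[OF assms(2)[OF that]] by simp
  then have "Ck_on k S (\<lambda>x. frechet_derivative f (at x) v)" for v
    by (intro Ck_on_cong[OF assms(1) _ assms(3)]) auto
  then show ?thesis using assms(2) by (auto simp: differentiable_def)
qed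

lemma Ck_on_has_derivative:
  "Ck_on (Suc k) S f \<Longrightarrow> x \<in> S \<Longrightarrow> (f has_derivative frechet_derivative f (at x)) (at x)"
  by (rule frechet_derivative_works[THEN iffD1]) simp

lemma Ck_on_bounded_linear:
  assumes "open S" "bounded_linear h" "Ck_on k S f"
  shows "Ck_on k S (\<lambda>x. h (f x))"
  using assms(3)
proof (induction k arbitrary: f)
  case 0
  then show ?case
    using bounded_linear.continuous_on[OF assms(2)] by simp
next
  case (Suc k)
  show ?case
    by (rule Ck_on_SucI[OF assms(1) bounded_linear.has_derivative[OF assms(2)
            Ck_on_has_derivative[OF Suc.prems]]])
      (use Suc in auto)
qed

lemma Ck_on_add:
  assumes "open S" "Ck_on k S f" "Ck_on k S g"
  shows "Ck_on k S (\<lambda>x. f x + g x)"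
  using assms(2,3)
proof (induction k arbitrary: f g)
  case 0
  then show ?case by (auto intro!: continuous_intros)
next
  case (Suc k)
  show ?case
    by (rule Ck_on_SucI[OF assms(1) has_derivative_add[OF Ck_on_has_derivative[OF Suc.prems(1)]
            Ck_on_has_derivative[OF Suc.prems(2)]]])
      (use Suc in auto)
qed

lemma Ck_on_bilinear:
  assumes "open S" "bounded_bilinear h" "Ck_on k S f" "Ck_on k S g"
  shows "Ck_on k S (\<lambda>x. h (f x) (g x))"
  using assms(3,4)
proof (induction k arbitrary: f g)
  case 0
  then show ?case by (auto intro!: bounded_bilinear.continuous_on[OF assms(2)])
next
  case (Suc k)
  show ?case
  proof (rule Ck_on_SucI[OF assms(1) bounded_bilinear.FDERIV[OF assms(2)
          Ck_on_has_derivative[OF Suc.prems(1)] Ck_on_has_derivative[OF Suc.prems(2)]]])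
    fix v
    \<comment> \<open>In the product rule one factor stays undifferentiated; it has one order of
      smoothness to spare, which \<open>Ck_on_SucD\<close> gives away.\<close>
    show "Ck_on k S (\<lambda>x. h (f x) (frechet_derivative g (at x) v)
        + h (frechet_derivative f (at x) v) (g x))"
      using Suc.prems Ck_on_SucD[OF Suc.prems(1)] Ck_on_SucD[OF Suc.prems(2)]
      by (intro Ck_on_add assms(1) Suc.IH) auto
  qed
qed

lemma Ck_on_sum:
  assumes "open S" "\<And>i. i \<in> I \<Longrightarrow> Ck_on k S (f i)"
  shows "Ck_on k S (\<lambda>x. \<Sum>i\<in>I. f i x)"
  using assms(2) by (induction I rule: infinite_finite_induct)
    (auto intro!: Ck_on_add Ck_on_const assms(1))

text \<open>\<open>Ck_on\<close> tests derivatives only in fixed directions, but the chain rule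
  produces the derivative of \<open>g\<close> in the varying direction \<open>f'(x) v\<close>.
  Expanding this direction in a basis leaves fixed directions with smooth coefficients, whence the
  Euclidean middle space.\<close>

lemma Ck_on_compose:
  fixes f :: "'a::real_normed_vector \<Rightarrow> 'b::euclidean_space"
  assumes "open S" "open T" "f ` S \<subseteq> T" "Ck_on k S f" "Ck_on k T g"
  shows "Ck_on k S (\<lambda>x. g (f x))"
  using assms(4,5)
proof (induction k arbitrary: g)
  case 0
  then show ?case using assms(3) by (auto intro: continuous_on_compose2)
next
  case (Suc k)
  have lin: "frechet_derivative g (at (f x)) w
      = (\<Sum>b\<in>Basis. (w \<bullet> b) *\<^sub>R frechet_derivative g (at (f x)) b)" if "x \<in> S" for x w
  proof -
    have l: "linear (frechet_derivative g (at (f x)))"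
      by (rule linear_frechet_derivative) (use Suc.prems that assms(3) in auto)
    show ?thesis
      using linear_sum[OF l, of "\<lambda>b. (w \<bullet> b) *\<^sub>R b" Basis]
      by (simp add: linear_cmul[OF l] euclidean_representation)
  qed
  have d: "((\<lambda>x. g (f x)) has_derivative
      (\<lambda>v. \<Sum>b\<in>Basis. (frechet_derivative f (at x) v \<bullet> b) *\<^sub>R frechet_derivative g (at (f x)) b)) (at x)"
      if "x \<in> S" for x
  proof -
    have "f x \<in> T" using that assms(3) by auto
    from has_derivative_compose[OF Ck_on_has_derivative[OF Suc.prems(1) that]
        Ck_on_has_derivative[OF Suc.prems(2) this]]
    show ?thesis unfolding lin[OF that, symmetric] .
  qed
  have "Ck_on k S (\<lambda>x. frechet_derivative g (at (f x)) b)" for b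
    using Suc.prems(2) by (intro Suc.IH[of "\<lambda>y. frechet_derivative g (at y) b"]
        Ck_on_SucD[OF Suc.prems(1)]) simp
  moreover have "Ck_on k S (\<lambda>x. frechet_derivative f (at x) v \<bullet> b)" for v b
    using Suc.prems(1) by (intro Ck_on_bounded_linear[OF _ bounded_linear_inner_left] assms(1)) simp
  ultimately show ?case
    by (intro Ck_on_SucI[OF assms(1) d] Ck_on_sum Ck_on_bilinear[OF _ bounded_bilinear_scaleR]
        assms(1))
qed

text \<open>The induction closes because the derivative is a polynomial in \<open>inverse\<close>
  itself.\<close>

lemma Ck_on_inverse: "Ck_on k (- {0::real}) inverse"
proof (induction k)
  case 0
  then show ?case by (auto intro!: continuous_intros)
next
  case (Suc k)
  have d: "(inverse has_derivative (\<lambda>v. (- v) * (inverse x * inverse x))) (at x)"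
    if "x \<in> - {0}" for x :: real
    using that by (auto intro!: derivative_eq_intros)
  have "Ck_on k (- {0}) (\<lambda>x. (- v) * (inverse x * inverse x))" for v :: real
    by (intro Ck_on_bilinear[OF _ bounded_bilinear_mult] Ck_on_const Suc) auto
  from Ck_on_SucI[OF _ d this] show ?case by auto
qed

lemma Ck_on_sqrt: "Ck_on k {0<..} sqrt"
proof (induction k)
  case 0
  then show ?case by (auto intro!: continuous_intros)
next
  case (Suc k)
  have d: "(sqrt has_derivative (\<lambda>v. (v/2) * inverse (sqrt x))) (at x)"
    if "x \<in> {0<..}" for x :: real
    using that by (auto intro!: derivative_eq_intros simp: field_simps)
  have i: "Ck_on k {0<..} (\<lambda>x. inverse (sqrt x))"
    by (rule Ck_on_compose[OF _ _ _ Suc.IH Ck_on_inverse]) auto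
  have "Ck_on k {0<..} (\<lambda>x. (v/2) * inverse (sqrt x))" for v :: real
    by (intro Ck_on_bilinear[OF _ bounded_bilinear_mult] Ck_on_const i) auto
  from Ck_on_SucI[OF _ d this] show ?case by auto
qed

section \<open>Closure properties of smooth maps\<close>

named_theorems smooth_intros

lemma smooth_on_continuous: "smooth_on S f \<Longrightarrow> continuous_on S f"
  unfolding smooth_on_def by (auto intro: Ck_on_continuous)

lemma smooth_on_cong:
  "open S \<Longrightarrow> smooth_on S f \<Longrightarrow> (\<And>x. x \<in> S \<Longrightarrow> f x = g x) \<Longrightarrow> smooth_on S g"
  unfolding smooth_on_def using Ck_on_cong[of S f g] by auto

lemma smooth_on_subset: "smooth_on S f \<Longrightarrow> T \<subseteq> S \<Longrightarrow> smooth_on T f"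
  unfolding smooth_on_def using Ck_on_subset[of T S _ f] by blast

lemma smooth_on_local:
  assumes "\<And>x. x \<in> S \<Longrightarrow> \<exists>T. open T \<and> x \<in> T \<and> smooth_on (S \<inter> T) f"
  shows "smooth_on S f"
  using assms unfolding smooth_on_def by (meson Ck_on_local)

lemma smooth_on_differentiable: "smooth_on S f \<Longrightarrow> x \<in> S \<Longrightarrow> f differentiable (at x)"
  unfolding smooth_on_def using Ck_on.simps(2) by blast

lemma smooth_on_has_derivative:
  "smooth_on S f \<Longrightarrow> x \<in> S \<Longrightarrow> (f has_derivative frechet_derivative f (at x)) (at x)"
  using smooth_on_differentiable frechet_derivative_works by blast

lemma smooth_on_frechet_derivative:
  "smooth_on S f \<Longrightarrow> smooth_on S (\<lambda>x. frechet_derivative f (at x) v)"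
  unfolding smooth_on_def using Ck_on.simps(2) by blast

lemma smooth_on_const [smooth_intros]: "smooth_on S (\<lambda>x. c)"
  by (simp add: smooth_on_def Ck_on_const)

lemma smooth_on_bounded_linear:
  "bounded_linear h \<Longrightarrow> open S \<Longrightarrow> smooth_on S f \<Longrightarrow> smooth_on S (\<lambda>x. h (f x))"
  by (simp add: smooth_on_def Ck_on_bounded_linear)

lemma smooth_on_ident [smooth_intros]: "smooth_on S (\<lambda>x. x)"
proof -
  have "Ck_on k S (\<lambda>x. x)" for k
    by (cases k) (auto simp: Ck_on_const)
  then show ?thesis by (simp add: smooth_on_def)
qed

lemmas smooth_on_fst [smooth_intros] = smooth_on_bounded_linear[OF bounded_linear_fst]
lemmas smooth_on_nth [smooth_intros] = smooth_on_bounded_linear[OF bounded_linear_vec_nth]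

lemma smooth_on_add [smooth_intros]:
  "open S \<Longrightarrow> smooth_on S f \<Longrightarrow> smooth_on S g \<Longrightarrow> smooth_on S (\<lambda>x. f x + g x)"
  by (simp add: smooth_on_def Ck_on_add)

lemma smooth_on_sum [smooth_intros]:
  "open S \<Longrightarrow> (\<And>i. i \<in> I \<Longrightarrow> smooth_on S (f i)) \<Longrightarrow> smooth_on S (\<lambda>x. \<Sum>i\<in>I. f i x)"
  by (simp add: smooth_on_def Ck_on_sum)

lemma smooth_on_bilinear:
  "bounded_bilinear h \<Longrightarrow> open S \<Longrightarrow> smooth_on S f \<Longrightarrow> smooth_on S g \<Longrightarrow> smooth_on S (\<lambda>x. h (f x) (g x))"
  by (simp add: smooth_on_def Ck_on_bilinear)

lemmas smooth_on_scaleR [smooth_intros] = smooth_on_bilinear[OF bounded_bilinear_scaleR]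
lemmas smooth_on_inner [smooth_intros] = smooth_on_bilinear[OF bounded_bilinear_inner]

lemma smooth_on_mult [smooth_intros]:
  fixes f g :: "_ \<Rightarrow> real"
  shows "open S \<Longrightarrow> smooth_on S f \<Longrightarrow> smooth_on S g \<Longrightarrow> smooth_on S (\<lambda>x. f x * g x)"
  by (rule smooth_on_bilinear[OF bounded_bilinear_mult])

lemma smooth_on_diff [smooth_intros]:
  "open S \<Longrightarrow> smooth_on S f \<Longrightarrow> smooth_on S g \<Longrightarrow> smooth_on S (\<lambda>x. f x - g x)"
  using smooth_on_add[of S f "\<lambda>x. - g x"] smooth_on_bounded_linear[of uminus S g]
  by (simp add: bounded_linear_minus bounded_linear_ident)

lemma smooth_on_prod [smooth_intros]:
  fixes f :: "_ \<Rightarrow> _ \<Rightarrow> real"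
  assumes "open S" "\<And>i. i \<in> I \<Longrightarrow> smooth_on S (f i)"
  shows "smooth_on S (\<lambda>x. \<Prod>i\<in>I. f i x)"
  using assms(2) by (induction I rule: infinite_finite_induct)
    (auto intro!: smooth_on_mult smooth_on_const assms(1))

lemma smooth_on_compose:
  fixes f :: "'a::real_normed_vector \<Rightarrow> 'b::euclidean_space"
  shows "smooth_on T g \<Longrightarrow> open S \<Longrightarrow> open T \<Longrightarrow> f ` S \<subseteq> T \<Longrightarrow> smooth_on S f \<Longrightarrow>
    smooth_on S (\<lambda>x. g (f x))"
  by (simp add: smooth_on_def Ck_on_compose)

lemma smooth_on_Pair [smooth_intros]:
  assumes "open S" "smooth_on S f" "smooth_on S g"
  shows "smooth_on S (\<lambda>x. (f x, g x))"
proof -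
  have "smooth_on S (\<lambda>x. (f x, 0) + (0, g x))"
    by (intro smooth_on_add assms smooth_on_bounded_linear[where h = "\<lambda>x. (x, 0)"]
        smooth_on_bounded_linear[where h = "\<lambda>x. (0, x)"] bounded_linear_Pair
        bounded_linear_ident bounded_linear_zero)
  then show ?thesis by simp
qed

lemma smooth_on_vec_lambda [smooth_intros]:
  fixes f :: "_ \<Rightarrow> 'n::finite \<Rightarrow> real"
  assumes "open S" "\<And>i. smooth_on S (\<lambda>x. f x i)"
  shows "smooth_on S (\<lambda>x. \<chi> i. f x i)"
proof -
  have "smooth_on S (\<lambda>x. \<Sum>i\<in>UNIV. f x i *\<^sub>R axis i (1::real))"
    by (intro smooth_intros assms)
  moreover have "(\<lambda>x. \<Sum>i\<in>UNIV. f x i *\<^sub>R axis i (1::real)) = (\<lambda>x. \<chi> i. f x i)"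
    by (auto simp: vec_eq_iff axis_def if_distrib[of "(*) _"] cong: if_cong)
  ultimately show ?thesis by (simp only:)
qed

lemma smooth_on_det [smooth_intros]:
  fixes f :: "_ \<Rightarrow> real^'n^'n"
  assumes "open S" "\<And>i j. smooth_on S (\<lambda>x. f x $ i $ j)"
  shows "smooth_on S (\<lambda>x. det (f x))"
  unfolding det_def by (intro smooth_intros assms)

lemma smooth_on_sqrt_abs [smooth_intros]:
  fixes f :: "_ \<Rightarrow> real"
  assumes "open S" "smooth_on S f" "\<And>x. x \<in> S \<Longrightarrow> f x \<noteq> 0"
  shows "smooth_on S (\<lambda>x. sqrt \<bar>f x\<bar>)"
proof -
  have *: "smooth_on S (\<lambda>x. sqrt (h x))" if "smooth_on S h" "\<And>x. x \<in> S \<Longrightarrow> h x > 0" for h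
    by (rule smooth_on_compose[where T = "{0<..}"])
      (use that assms in \<open>auto simp: smooth_on_def Ck_on_sqrt\<close>)
  \<comment> \<open>The absolute value is written as \<open>sqrt (f x * f x)\<close>, which is
    smooth where \<open>f\<close> does not vanish and needs no case distinction on the sign.\<close>
  have "smooth_on S (\<lambda>x. sqrt (sqrt (f x * f x)))"
    by (intro * smooth_intros assms) (use assms in \<open>auto simp flip: power2_eq_square\<close>)
  then show ?thesis by (simp flip: power2_eq_square)
qed

section \<open>Bump functions\<close>

text \<open>The powers of \<open>1/t\<close> are included because they make the family closed under
  differentiation up to linear combinations, so smoothness is one induction over all
  \<open>m\<close>.\<close>

definition flat_exp :: "nat \<Rightarrow> real \<Rightarrow> real" where
  "flat_exp m t = (if t > 0 then inverse t ^ m * exp (- inverse t) else 0)"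

text \<open>This is the difference quotient at 0. From the right, \<open>x = 1/t\<close> turns it
  into a power of \<open>x\<close> over \<open>exp x\<close> at infinity; from the left it is
  zero.\<close>

lemma flat_exp_quotient: "((\<lambda>t. flat_exp m t / t) \<longlongrightarrow> 0) (at 0)"
proof -
  have "((\<lambda>x::real. x ^ Suc m / exp x) \<longlongrightarrow> 0) at_top"
    by (rule tendsto_power_div_exp_0)
  then have "((\<lambda>t. inverse t ^ Suc m / exp (inverse t)) \<longlongrightarrow> 0) (at_right (0::real))"
    by (rule filterlim_compose[OF _ filterlim_inverse_at_top_right])
  moreover have "\<forall>\<^sub>F t in at_right 0. inverse t ^ Suc m / exp (inverse t) = flat_exp m t / t"
    by (auto simp: eventually_at_filter flat_exp_def exp_minus field_simps)
  ultimately have "((\<lambda>t. flat_exp m t / t) \<longlongrightarrow> 0) (at_right 0)"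
    by (rule Lim_transform_eventually)
  moreover have "((\<lambda>t. flat_exp m t / t) \<longlongrightarrow> 0) (at_left 0)"
    by (rule Lim_transform_eventually[OF tendsto_const])
      (auto simp: eventually_at_filter flat_exp_def)
  ultimately show ?thesis by (simp add: filterlim_split_at)
qed

lemma flat_exp_has_derivative:
  "(flat_exp m has_derivative (\<lambda>v. (flat_exp (m + 2) t - m * flat_exp (m + 1) t) * v)) (at t)"
proof -
  consider "t > 0" | "t = 0" | "t < 0" by linarith
  then show ?thesis
  proof cases
    case 1
    have p: "((\<lambda>t. inverse t ^ m) has_field_derivative (- real m * inverse t ^ (m + 1))) (at t)"
      using DERIV_power[OF DERIV_inverse[of t UNIV], of m] 1
      by (cases m) (auto simp: power2_eq_square algebra_simps numeral_2_eq_2)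
    have e: "((\<lambda>t. exp (- inverse t)) has_field_derivative
        (inverse t ^ 2 * exp (- inverse t))) (at t)"
      using 1 by (auto intro!: derivative_eq_intros simp: field_simps power2_eq_square)
    have "((\<lambda>t. inverse t ^ m * exp (- inverse t)) has_field_derivative
        (inverse t ^ (m + 2) * exp (- inverse t) - m * (inverse t ^ (m + 1) * exp (- inverse t)))) (at t)"
      using DERIV_mult[OF p e] by (simp add: algebra_simps power_add power2_eq_square)
    then have "((\<lambda>t. inverse t ^ m * exp (- inverse t)) has_derivative
        (\<lambda>v. (flat_exp (m + 2) t - m * flat_exp (m + 1) t) * v)) (at t)"
      using 1 by (simp add: has_field_derivative_def flat_exp_def)
    then show ?thesis
      by (rule has_derivative_transform_within_open[where s = "{0<..}"])
        (use 1 in \<open>auto simp: flat_exp_def\<close>)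
  next
    case 2
    have "(flat_exp m has_field_derivative 0) (at 0)"
      using flat_exp_quotient[of m] by (simp add: has_field_derivative_iff flat_exp_def)
    then show ?thesis using 2
      by (simp add: has_field_derivative_def flat_exp_def lambda_zero)
  next
    case 3
    have "((\<lambda>t. 0) has_derivative (\<lambda>v. 0)) (at t)" by simp
    then have "(flat_exp m has_derivative (\<lambda>v. 0)) (at t)"
      by (rule has_derivative_transform_within_open[where s = "{..<0}"])
        (use 3 in \<open>auto simp: flat_exp_def\<close>)
    then show ?thesis using 3 by (simp add: flat_exp_def)
  qed
qed

lemma smooth_on_flat_exp: "smooth_on UNIV (flat_exp m)"
proof -
  have "Ck_on k UNIV (flat_exp m)" for k
  proof (induction k arbitrary: m)
    case 0
    then show ?case
      using flat_exp_has_derivative has_derivative_continuous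
      by (metis Ck_on.simps(1) continuous_at_imp_continuous_on)
  next
    case (Suc k)
    have "Ck_on k UNIV (\<lambda>t. (flat_exp (m + 2) t + (- real m) * flat_exp (m + 1) t) * v)" for v
      by (intro Ck_on_bilinear[OF _ bounded_bilinear_mult] Ck_on_add Suc Ck_on_const) auto
    then have "Ck_on k UNIV (\<lambda>t. (flat_exp (m + 2) t - real m * flat_exp (m + 1) t) * v)" for v
      by simp
    from Ck_on_SucI[OF open_UNIV flat_exp_has_derivative this] show ?case .
  qed
  then show ?thesis by (simp add: smooth_on_def)
qed

text \<open>The bump is a flat exponential of \<open>r\<^sup>2 - |x - x0|\<^sup>2\<close>, divided
  by its value at the centre. The derivative vanishes at \<open>x0\<close> because this is a maximum
  of the argument; it is what makes cut-off fields agree to first order with the original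
  ones.\<close>

lemma bump_exists:
  fixes x0 :: "'a::euclidean_space"
  assumes "r > 0"
  obtains b :: "'a \<Rightarrow> real" where "smooth_on UNIV b" "b x0 = 1"
    "(b has_derivative (\<lambda>_. 0)) (at x0)" "\<And>x. x \<notin> ball x0 r \<Longrightarrow> b x = 0"
proof -
  define q where "q x = r\<^sup>2 - (x - x0) \<bullet> (x - x0)" for x
  define b where "b x = (1 / flat_exp 0 (r\<^sup>2)) * flat_exp 0 (q x)" for x
  have q: "smooth_on UNIV q" unfolding q_def by (intro smooth_intros) auto
  have sm: "smooth_on UNIV b" unfolding b_def
    by (intro smooth_on_mult smooth_on_const smooth_on_compose[OF smooth_on_flat_exp _ _ _ q]) auto
  have one: "b x0 = 1" using assms by (simp add: b_def q_def flat_exp_def)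
  have "b x = 0" if "x \<notin> ball x0 r" for x
  proof -
    have "r \<le> norm (x - x0)" using that by (simp add: dist_norm norm_minus_commute)
    then have "r\<^sup>2 \<le> (norm (x - x0))\<^sup>2" using assms by (intro power_mono) auto
    then show ?thesis by (simp add: b_def q_def flat_exp_def flip: power2_norm_eq_inner)
  qed
  moreover have "(b has_derivative (\<lambda>_. 0)) (at x0)"
  proof -
    have "(q has_derivative (\<lambda>_. 0)) (at x0)" unfolding q_def
      by (auto intro!: derivative_eq_intros)
    from has_derivative_compose[OF this flat_exp_has_derivative[of 0]]
    have "((\<lambda>x. flat_exp 0 (q x)) has_derivative (\<lambda>_. 0)) (at x0)" by simp
    from has_derivative_mult_right[OF this, of "1 / flat_exp 0 (r\<^sup>2)"]
    show ?thesis unfolding b_def by simp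
  qed
  ultimately show ?thesis using sm one that by blast
qed

section \<open>Symmetry of second derivatives\<close>

lemma line_DERIV:
  fixes f :: "'a::real_normed_vector \<Rightarrow> real"
  assumes "f differentiable (at (x + s *\<^sub>R v))"
  shows "((\<lambda>s. f (x + s *\<^sub>R v)) has_real_derivative frechet_derivative f (at (x + s *\<^sub>R v)) v) (at s)"
proof -
  have "((\<lambda>s. x + s *\<^sub>R v) has_derivative (\<lambda>h. h *\<^sub>R v)) (at s)"
    by (auto intro!: derivative_eq_intros)
  from has_derivative_compose[OF this, of f] assms
  have "((\<lambda>s. f (x + s *\<^sub>R v)) has_derivative (\<lambda>h. frechet_derivative f (at (x + s *\<^sub>R v)) (h *\<^sub>R v))) (at s)"
    by (simp add: frechet_derivative_works)
  moreover have "frechet_derivative f (at (x + s *\<^sub>R v)) (h *\<^sub>R v)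
      = frechet_derivative f (at (x + s *\<^sub>R v)) v * h" for h
    using linear_cmul[OF linear_frechet_derivative[OF assms], of h v] by simp
  ultimately show ?thesis
    by (simp add: has_field_derivative_def)
qed

text \<open>Mean value theorem twice: along \<open>v\<close> for the difference \<phi> of
  \<open>f\<close> on two opposite sides of the parallelogram, then along \<open>w\<close> for the
  derivative that results.\<close>

lemma second_difference:
  fixes f :: "'a::real_normed_vector \<Rightarrow> real"
  assumes "smooth_on S f" "h > 0"
    and S: "\<forall>s\<in>{0..h}. \<forall>t\<in>{0..h}. x + s *\<^sub>R v + t *\<^sub>R w \<in> S"
  shows "\<exists>s t. 0 < s \<and> s < h \<and> 0 < t \<and> t < h \<and>
    f (x + h *\<^sub>R v + h *\<^sub>R w) - f (x + h *\<^sub>R v) - f (x + h *\<^sub>R w) + f x =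
    h * h * frechet_derivative (\<lambda>y. frechet_derivative f (at y) v) (at (x + s *\<^sub>R v + t *\<^sub>R w)) w"
proof -
  let ?D = "\<lambda>y. frechet_derivative f (at y) v"
  define \<phi> where "\<phi> s = f (x + h *\<^sub>R w + s *\<^sub>R v) - f (x + s *\<^sub>R v)" for s
  have "(\<phi> has_real_derivative (?D (x + h *\<^sub>R w + s *\<^sub>R v) - ?D (x + s *\<^sub>R v))) (at s)"
    if "0 \<le> s" "s \<le> h" for s
    unfolding \<phi>_def
    by (intro DERIV_diff line_DERIV smooth_on_differentiable[OF assms(1)])
      (use S[rule_format, of s h] S[rule_format, of s 0] that assms(2) in \<open>auto simp: algebra_simps\<close>)
  from MVT2[OF assms(2) this] obtain s where s: "0 < s" "s < h"
    "\<phi> h - \<phi> 0 = h * (?D (x + h *\<^sub>R w + s *\<^sub>R v) - ?D (x + s *\<^sub>R v))" by auto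
  have "((\<lambda>t. ?D (x + s *\<^sub>R v + t *\<^sub>R w)) has_real_derivative
      frechet_derivative ?D (at (x + s *\<^sub>R v + t *\<^sub>R w)) w) (at t)" if "0 \<le> t" "t \<le> h" for t
    by (intro line_DERIV smooth_on_differentiable[OF smooth_on_frechet_derivative[OF assms(1)]])
      (use S[rule_format, of s t] that s in auto)
  from MVT2[OF assms(2) this] obtain t where t: "0 < t" "t < h"
    "?D (x + s *\<^sub>R v + h *\<^sub>R w) - ?D (x + s *\<^sub>R v)
     = h * frechet_derivative ?D (at (x + s *\<^sub>R v + t *\<^sub>R w)) w" by auto
  show ?thesis
    by (rule exI[of _ s], rule exI[of _ t])
      (use s t in \<open>simp add: \<phi>_def algebra_simps\<close>)
qed

text \<open>The second difference over a small parallelogram is symmetric in \<open>v\<close> and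
  \<open>w\<close>, so the two mixed derivatives agree at some pair of points near \<open>x\<close>.
  By continuity a gap of \<open>2 * e\<close> at \<open>x\<close> is impossible.\<close>

lemma frechet_derivative_symmetric:
  fixes f :: "'a::real_normed_vector \<Rightarrow> real"
  assumes "open S" "smooth_on S f" "x \<in> S"
  shows "frechet_derivative (\<lambda>y. frechet_derivative f (at y) v) (at x) w
    = frechet_derivative (\<lambda>y. frechet_derivative f (at y) w) (at x) v" (is "?P x = ?Q x")
proof (rule ccontr)
  assume ne: "?P x \<noteq> ?Q x"
  define e where "e = \<bar>?P x - ?Q x\<bar> / 2"
  have "e > 0" using ne by (simp add: e_def)
  have "continuous (at x) ?P" "continuous (at x) ?Q"
    using smooth_on_continuous[OF smooth_on_frechet_derivative[OF smooth_on_frechet_derivative[OF assms(2)]]]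
      assms continuous_on_eq_continuous_at by blast+
  then have "\<forall>\<^sub>F y in nhds x. dist (?P y) (?P x) < e \<and> dist (?Q y) (?Q x) < e"
    using \<open>e > 0\<close>
    by (intro eventually_conj tendstoD) (auto simp: isCont_def tendsto_nhds_iff)
  then obtain d1 where d: "d1 > 0" "\<And>y. dist y x < d1 \<Longrightarrow> dist (?P y) (?P x) < e"
      "\<And>y. dist y x < d1 \<Longrightarrow> dist (?Q y) (?Q x) < e"
    unfolding eventually_nhds_metric by blast
  obtain d3 where d3: "d3 > 0" "ball x d3 \<subseteq> S" using assms openE by blast
  define d where "d = min d1 d3"
  have "d > 0" using d d3 by (simp add: d_def)
  \<comment> \<open>Keeps the parallelogram within \<open>d / 2\<close> of \<open>x\<close>; the
    summand 1 covers the case that both vectors vanish.\<close>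
  define h where "h = d / (2 * (norm v + norm w + 1))"
  have pos: "norm v + norm w + 1 > 0" by (smt (verit) norm_ge_zero)
  have h: "h > 0" using \<open>d > 0\<close> pos by (simp add: h_def)
  have near: "dist (x + s *\<^sub>R v + t *\<^sub>R w) x < d" if "0 \<le> s" "s \<le> h" "0 \<le> t" "t \<le> h" for s t
  proof -
    have "norm (s *\<^sub>R v + t *\<^sub>R w) \<le> s * norm v + t * norm w"
      using norm_triangle_ineq[of "s *\<^sub>R v" "t *\<^sub>R w"] that by simp
    also have "\<dots> \<le> h * norm v + h * norm w"
      using that by (intro add_mono mult_right_mono) auto
    also have "\<dots> < h * (2 * (norm v + norm w + 1))"
      using h by (simp add: algebra_simps)
        (smt (verit) mult_nonneg_nonneg norm_ge_zero)
    also have "\<dots> = d" using pos by (simp add: h_def)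
    finally show ?thesis by (simp add: dist_norm add.assoc)
  qed
  have in_S: "\<forall>s\<in>{0..h}. \<forall>t\<in>{0..h}. x + s *\<^sub>R v + t *\<^sub>R w \<in> S"
    using near d3 by (auto simp: d_def dist_commute subset_iff)
  then have in_S': "\<forall>s\<in>{0..h}. \<forall>t\<in>{0..h}. x + s *\<^sub>R w + t *\<^sub>R v \<in> S"
    by (metis add.assoc add.commute)
  obtain s t where st: "0 < s" "s < h" "0 < t" "t < h" and P:
    "f (x + h *\<^sub>R v + h *\<^sub>R w) - f (x + h *\<^sub>R v) - f (x + h *\<^sub>R w) + f x
     = h * h * ?P (x + s *\<^sub>R v + t *\<^sub>R w)"
    using second_difference[OF assms(2) h in_S] by blast
  obtain s' t' where st': "0 < s'" "s' < h" "0 < t'" "t' < h" and Q: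
    "f (x + h *\<^sub>R w + h *\<^sub>R v) - f (x + h *\<^sub>R w) - f (x + h *\<^sub>R v) + f x
     = h * h * ?Q (x + s' *\<^sub>R w + t' *\<^sub>R v)"
    using second_difference[OF assms(2) h in_S'] by blast
  have c: "x + h *\<^sub>R w + h *\<^sub>R v = x + h *\<^sub>R v + h *\<^sub>R w" by (simp add: algebra_simps)
  have "h * h * ?P (x + s *\<^sub>R v + t *\<^sub>R w) = h * h * ?Q (x + s' *\<^sub>R w + t' *\<^sub>R v)"
    using P Q[unfolded c] by linarith
  then have eq: "?P (x + s *\<^sub>R v + t *\<^sub>R w) = ?Q (x + t' *\<^sub>R v + s' *\<^sub>R w)"
    using h by (simp add: algebra_simps)
  have "dist (?P (x + s *\<^sub>R v + t *\<^sub>R w)) (?P x) < e"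
    using near[of s t] st by (intro d(2)) (auto simp: d_def)
  moreover have "dist (?Q (x + t' *\<^sub>R v + s' *\<^sub>R w)) (?Q x) < e"
    using near[of t' s'] st' by (intro d(3)) (auto simp: d_def)
  ultimately have "dist (?P x) (?Q x) < 2 * e"
    using dist_triangle_half_r[of "?Q (x + t' *\<^sub>R v + s' *\<^sub>R w)" "?P x" "2 * e"] eq by simp
  then show False by (simp add: e_def dist_real_def)
qed

section \<open>Determinants and alternating forms\<close>

lemma bij_betw_coord_num: "bij_betw (coord_num :: 'n::finite \<Rightarrow> nat) UNIV {..<CARD('n)}"
  unfolding coord_num_def by (rule to_nat_on_finite) simp

lemma coord_num_less [simp]: "coord_num (j :: 'n::finite) < CARD('n)"
  using bij_betw_coord_num[where 'n = 'n] by (auto simp: bij_betw_def)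

lemma coord_ix_coord_num [simp]: "coord_ix (coord_num j) = j"
  by (simp add: coord_ix_def coord_num_def countable_finite)

lemma coord_num_coord_ix [simp]: "k < CARD('n) \<Longrightarrow> coord_num (coord_ix k :: 'n::finite) = k"
  using bij_betw_coord_num[where 'n = 'n]
  by (metis bij_betw_imp_surj_on coord_ix_coord_num f_inv_into_f lessThan_iff)

lemma coord_num_inj [simp]: "coord_num i = coord_num j \<longleftrightarrow> i = j"
  by (metis coord_ix_coord_num)

lemma sum_coord_num: "(\<Sum>j\<in>UNIV. f (coord_num (j :: 'n::finite))) = (\<Sum>i<CARD('n). f i)"
  by (rule sum.reindex_bij_betw[OF bij_betw_coord_num])

text \<open>The Euclidean volume form on lists, with the vectors as columns. The value 0 on other
  lengths makes it an \<open>alt_form\<close> and spares length hypotheses later.\<close>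

definition det_list :: "(real^'n::finite) list \<Rightarrow> real" where
  "det_list vs = (if length vs = CARD('n) then det (\<chi> i j. vs ! coord_num j $ i) else 0)"

lemma det_list_rows:
  fixes vs :: "(real^'n::finite) list"
  assumes "length vs = CARD('n)"
  shows "det_list vs = det (\<chi> j. vs ! coord_num j)"
proof -
  have "(\<chi> i j. vs ! coord_num (j :: 'n) $ i) = transpose (\<chi> j. vs ! coord_num j)"
    by (simp add: transpose_def)
  then show ?thesis using assms by (simp add: det_list_def det_transpose)
qed

lemma linear_det_list_update:
  fixes vs :: "(real^'n::finite) list"
  assumes "length vs = CARD('n)" "k < CARD('n)"
  shows "linear (\<lambda>v. det_list (vs[k := v]))"
proof -
  have *: "det_list (vs[k := v]) = det (\<chi> j. if j = coord_ix k then v else vs ! coord_num j)" for v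
  proof -
    have "(\<chi> j :: 'n. vs[k := v] ! coord_num j) = (\<chi> j. if j = coord_ix k then v else vs ! coord_num j)"
      using assms by (auto simp: vec_eq_iff nth_list_update)
    then show ?thesis using assms by (simp add: det_list_rows)
  qed
  show ?thesis
    unfolding *
    using det_row_add[of "coord_ix k" "\<lambda>_. v" "\<lambda>_. w" "\<lambda>j. vs ! coord_num j" for v w]
      det_row_mul[of "coord_ix k" _ "\<lambda>_. v" "\<lambda>j. vs ! coord_num j" for v,
        unfolded scalar_mult_eq_scaleR]
    by (intro linearI) (simp_all only: real_scaleR_def)
qed

lemma alt_form_det_list: "alt_form CARD('n) (det_list :: (real^'n::finite) list \<Rightarrow> real)"
  unfolding alt_form_def
proof (intro conjI allI impI)
  fix vs :: "(real^'n) list"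
  show "det_list vs = 0" if "length vs \<noteq> CARD('n)" using that by (simp add: det_list_def)
  show "linear (\<lambda>v. det_list (vs @ v # ws))" for ws
  proof (cases "length (vs @ 0 # ws) = CARD('n)")
    case True
    then have "linear (\<lambda>v. det_list ((vs @ 0 # ws)[length vs := v]))"
      by (intro linear_det_list_update) auto
    then show ?thesis by simp
  next
    case False
    then have "(\<lambda>v. det_list (vs @ v # ws)) = (\<lambda>_. 0)" by (auto simp: det_list_def)
    then show ?thesis by (simp add: linear_iff)
  qed
  show "det_list vs = 0" if "\<not> distinct vs"
  proof (cases "length vs = CARD('n)")
    case True
    from that obtain i j where ij: "i < length vs" "j < length vs" "i \<noteq> j" "vs ! i = vs ! j"
      by (auto simp: distinct_conv_nth)
    have "det (\<chi> j. vs ! coord_num j) = 0"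
      by (rule det_identical_rows[of "coord_ix i" "coord_ix j"])
        (use ij True coord_num_coord_ix[where 'n = 'n] in \<open>auto simp: row_def vec_eq_iff, metis+\<close>)
    then show ?thesis using True by (simp add: det_list_rows)
  qed (simp add: det_list_def)
qed

lemma det_list_map_linear:
  fixes us :: "(real^'n) list"
  assumes "linear f"
  shows "det_list (map f us) = det (matrix f) * det_list us"
proof (cases "length us = CARD('n)")
  case True
  have "(\<chi> i j. map f us ! coord_num (j :: 'n) $ i) = matrix f ** (\<chi> i j. us ! coord_num j $ i)"
  proof -
    have "f (us ! coord_num j) $ i = (\<Sum>k\<in>UNIV. matrix f $ i $ k * us ! coord_num j $ k)" for i j :: 'n
      using arg_cong[OF matrix_works[OF assms[unfolded linear_matrix_vector_mul_eq[symmetric]], of "us ! coord_num j"], of "\<lambda>v. v $ i"]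
      by (simp add: matrix_vector_mult_def)
    then show ?thesis using True by (simp add: vec_eq_iff matrix_matrix_mult_def)
  qed
  then show ?thesis using True by (simp add: det_list_def det_mul)
qed (simp add: det_list_def)

lemma alt_form_linear: "alt_form k \<omega> \<Longrightarrow> linear (\<lambda>v. \<omega> (vs @ v # ws))"
  by (simp add: alt_form_def)

text \<open>Polarization: expand the form with \<open>a + b\<close> in both adjacent slots; the
  repeated arguments drop out.\<close>

lemma alt_form_swap:
  assumes "alt_form k \<omega>"
  shows "\<omega> (xs @ a # b # ys) = - \<omega> (xs @ b # a # ys)"
proof -
  have l1: "linear (\<lambda>v. \<omega> (xs @ v # c # ys))" for c
    using alt_form_linear[OF assms, of xs "c # ys"] by simp
  have l2: "linear (\<lambda>v. \<omega> (xs @ c # v # ys))" for c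
    using alt_form_linear[OF assms, of "xs @ [c]" ys] by simp
  have z: "\<omega> (xs @ c # c # ys) = 0" for c
    using assms by (auto simp: alt_form_def)
  have "\<omega> (xs @ (a + b) # (a + b) # ys) = \<omega> (xs @ a # a # ys) + \<omega> (xs @ a # b # ys)
      + (\<omega> (xs @ b # a # ys) + \<omega> (xs @ b # b # ys))"
    by (simp add: linear_add[OF l1] linear_add[OF l2])
  then show ?thesis by (simp add: z)
qed

lemma alt_form_move:
  assumes "alt_form k \<omega>"
  shows "\<omega> (ps @ a # xs @ ys) = (- 1) ^ length xs * \<omega> (ps @ xs @ a # ys)"
proof (induction xs arbitrary: ps)
  case (Cons x xs)
  have "\<omega> (ps @ a # (x # xs) @ ys) = - \<omega> ((ps @ [x]) @ a # xs @ ys)"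
    using alt_form_swap[OF assms, of ps a x "xs @ ys"] by simp
  then show ?case by (subst (asm) Cons) simp
qed simp

lemma trace_matrix_eq_sum: "trace (matrix f) = (\<Sum>i\<in>UNIV. f (axis i 1) $ i)"
  by (simp add: trace_def matrix_def)

lemma invertible_matrix_inv:
  fixes G :: "real^'n^'n"
  assumes "invertible G"
  shows "G ** matrix_inv G = mat 1" "matrix_inv G ** G = mat 1"
  using assms unfolding invertible_def matrix_inv_def by (metis (mono_tags, lifting) someI_ex)+

text \<open>Since \<open>us\<close> is a basis, \<open>f\<close> has a matrix \<open>B\<close> with
  respect to it. By Cramer's rule, replacing the vector number \<open>k\<close> by its image
  multiplies the determinant by the diagonal entry \<open>B $ k $ k\<close>, and \<open>B\<close> is
  conjugate to the standard matrix of \<open>f\<close>.\<close>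

lemma sum_det_list_update_linear:
  fixes us :: "(real^'n::finite) list"
  assumes len: "length us = CARD('n)" and f: "linear f" and nz: "det_list us \<noteq> 0"
  shows "(\<Sum>i<CARD('n). det_list (us[i := f (us ! i)])) = trace (matrix f) * det_list us"
proof -
  define P :: "real^'n^'n" where "P = (\<chi> i j. us ! coord_num j $ i)"
  have dP: "det P = det_list us" by (simp add: P_def det_list_def len)
  then have inv: "invertible P" using nz by (simp add: invertible_det_nz)
  define B where "B = matrix_inv P ** (matrix f ** P)"
  have PB: "P ** B = matrix f ** P"
    unfolding B_def by (simp add: matrix_mul_assoc invertible_matrix_inv[OF inv])
  have col: "P *v axis k 1 = us ! coord_num k" for k
    by (simp add: matrix_vector_mul_component column_def P_def vec_eq_iff matrix_vector_mult_basis)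
  have "det_list (us[coord_num k := f (us ! coord_num k)]) = B $ k $ k * det_list us" for k
  proof -
    have "P *v (B *v axis k 1) = f (us ! coord_num k)"
      by (simp add: matrix_vector_mul_assoc PB)
        (simp add: col f flip: matrix_vector_mul_assoc)
    then have "det_list (us[coord_num k := f (us ! coord_num k)])
        = det (\<chi> i j. if j = k then (P *v (B *v axis k 1)) $ i else P $ i $ j)"
      by (auto simp: det_list_def len P_def nth_list_update intro!: arg_cong[of _ _ det] simp: vec_eq_iff)
    also have "\<dots> = (B *v axis k 1) $ k * det P" by (rule cramer_lemma)
    also have "(B *v axis k 1) $ k = B $ k $ k"
      by (simp add: matrix_vector_mult_basis column_def)
    finally show ?thesis by (simp add: dP)
  qed
  then have "(\<Sum>i<CARD('n). det_list (us[i := f (us ! i)])) = trace B * det_list us"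
    by (simp add: trace_def sum_distrib_right flip: sum_coord_num)
  also have "trace B = trace (matrix f)"
    unfolding B_def
    by (subst trace_mul_sym) (simp add: invertible_matrix_inv[OF inv] flip: matrix_mul_assoc)
  finally show ?thesis .
qed

text \<open>The exterior derivative of the contraction of a constant volume form with a vector field
  whose differential is \<open>f\<close>.\<close>

lemma alternating_sum_det_list:
  fixes us :: "(real^'n::finite) list"
  assumes len: "length us = CARD('n)" and f: "linear f" and nz: "det_list us \<noteq> 0"
  shows "(\<Sum>i<CARD('n). (- 1) ^ i * det_list (f (us ! i) # take i us @ drop (Suc i) us))
    = trace (matrix f) * det_list us"
proof -
  have "(- 1) ^ i * det_list (f (us ! i) # take i us @ drop (Suc i) us)
      = det_list (us[i := f (us ! i)])" if "i < CARD('n)" for i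
  proof -
    have "det_list (f (us ! i) # take i us @ drop (Suc i) us)
        = (- 1) ^ i * det_list (us[i := f (us ! i)])"
      using alt_form_move[OF alt_form_det_list, of "[]" "f (us ! i)" "take i us" "drop (Suc i) us"]
        that len by (simp add: upd_conv_take_nth_drop)
    then show ?thesis by (simp flip: power_add mult.assoc mult_2)
  qed
  then show ?thesis using sum_det_list_update_linear[OF assms] by simp
qed

text \<open>Jacobi's formula. Differentiating the Leibniz sum gives the determinants in which row
  \<open>k\<close> is replaced by its derivative. That row is a combination of the rows of
  \<open>f x\<close> with coefficients \<open>y k\<close>, so Cramer's rule for rows gives
  \<open>y k $ k * det (f x)\<close>.\<close>

lemma has_derivative_det:
  fixes f :: "'a::real_normed_vector \<Rightarrow> real^'n^'n"
  assumes d: "\<And>i j. ((\<lambda>x. f x $ i $ j) has_derivative f' i j) (at x)" and inv: "invertible (f x)"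
  shows "((\<lambda>x. det (f x)) has_derivative
    (\<lambda>v. det (f x) * (\<Sum>i\<in>UNIV. \<Sum>j\<in>UNIV. matrix_inv (f x) $ j $ i * f' i j v))) (at x)"
proof -
  have "((\<lambda>x. \<Sum>p | p permutes UNIV. of_int (sign p) * (\<Prod>i\<in>UNIV. f x $ i $ p i)) has_derivative
     (\<lambda>v. \<Sum>p | p permutes UNIV. of_int (sign p) *
        (\<Sum>k\<in>UNIV. f' k (p k) v * (\<Prod>i\<in>UNIV - {k}. f x $ i $ p i)))) (at x)"
    by (intro has_derivative_sum has_derivative_mult_right has_derivative_prod d)
  moreover have "(\<Sum>p | p permutes UNIV. of_int (sign p) *
        (\<Sum>k\<in>UNIV. f' k (p k) v * (\<Prod>i\<in>UNIV - {k}. f x $ i $ p i)))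
    = det (f x) * (\<Sum>i\<in>UNIV. \<Sum>j\<in>UNIV. matrix_inv (f x) $ j $ i * f' i j v)" for v
  proof -
    define B :: "real^'n^'n" where "B = (\<chi> i j. f' i j v)"
    define y where "y k = transpose (matrix_inv (f x)) *v (B $ k)" for k
    have row: "(\<Sum>i\<in>UNIV. y k $ i *s row i (f x)) = B $ k" for k
    proof -
      have "(\<Sum>i\<in>UNIV. y k $ i *s row i (f x)) = transpose (f x) *v y k"
        by (simp only: matrix_mult_sum column_transpose)
      also have "\<dots> = (transpose (matrix_inv (f x) ** f x)) *v (B $ k)"
        by (simp only: y_def matrix_vector_mul_assoc matrix_transpose_mul)
      also have "\<dots> = B $ k" by (simp add: invertible_matrix_inv[OF inv] transpose_mat)
      finally show ?thesis .
    qed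
    have det_k: "det (\<chi> i. if i = k then B $ k else row i (f x)) = y k $ k * det (f x)" for k
      using cramer_lemma_transpose[of k "y k" "f x"] by (simp only: row)
    have prd: "(\<Prod>i\<in>UNIV. (\<chi> i. if i = k then B $ k else row i (f x)) $ i $ p i)
        = f' k (p k) v * (\<Prod>i\<in>UNIV - {k}. f x $ i $ p i)" for k p
      by (subst prod.remove[of UNIV k]) (auto simp: B_def row_def intro!: prod.cong)
    have "(\<Sum>p | p permutes UNIV. of_int (sign p) *
        (\<Sum>k\<in>UNIV. f' k (p k) v * (\<Prod>i\<in>UNIV - {k}. f x $ i $ p i)))
      = (\<Sum>k\<in>UNIV. det (\<chi> i. if i = k then B $ k else row i (f x)))"
      unfolding det_def prd by (simp add: sum_distrib_left) (rule sum.swap)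
    also have "\<dots> = (\<Sum>k\<in>UNIV. y k $ k) * det (f x)"
      by (simp add: det_k sum_distrib_right)
    also have "(\<Sum>k\<in>UNIV. y k $ k) = (\<Sum>i\<in>UNIV. \<Sum>j\<in>UNIV. matrix_inv (f x) $ j $ i * f' i j v)"
      by (simp add: y_def B_def matrix_vector_mult_def transpose_def)
    finally show ?thesis by (simp add: mult.commute)
  qed
  ultimately show ?thesis by (simp add: det_def)
qed

lemma has_derivative_sqrt_abs_det:
  fixes f :: "'a::real_normed_vector \<Rightarrow> real^'n^'n"
  assumes d: "\<And>i j. ((\<lambda>x. f x $ i $ j) has_derivative f' i j) (at x)" and inv: "invertible (f x)"
  shows "((\<lambda>x. sqrt \<bar>det (f x)\<bar>) has_derivative
    (\<lambda>v. sqrt \<bar>det (f x)\<bar> * (1/2) * (\<Sum>i\<in>UNIV. \<Sum>j\<in>UNIV. matrix_inv (f x) $ j $ i * f' i j v))) (at x)"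
proof -
  have nz: "det (f x) \<noteq> 0" using inv by (simp add: invertible_det_nz)
  \<comment> \<open>This form of the derivative holds for both signs of \<open>t\<close>, and its
    denominator cancels the factor \<open>det (f x)\<close> of Jacobi's formula.\<close>
  have "((\<lambda>t. sqrt \<bar>t\<bar>) has_field_derivative (sqrt \<bar>t\<bar> * (1/2) / t)) (at t)" if "t \<noteq> 0" for t :: real
  proof -
    have "((\<lambda>t. sqrt \<bar>t\<bar>) has_field_derivative (inverse (sqrt \<bar>t\<bar>) / 2 * sgn t)) (at t)"
    proof (cases "t > 0")
      case True
      have "(sqrt has_field_derivative (inverse (sqrt \<bar>t\<bar>) / 2 * sgn t)) (at t)"
        using True by (auto intro!: derivative_eq_intros)
      then show ?thesis
        by (rule DERIV_cong_ev[THEN iffD1, rotated -1])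
          (use True eventually_nhds_in_open[of "{0<..}" t] in \<open>auto elim!: eventually_mono\<close>)
    next
      case False
      then have "((\<lambda>t. sqrt (- t)) has_field_derivative (inverse (sqrt \<bar>t\<bar>) / 2 * sgn t)) (at t)"
        using that by (auto intro!: derivative_eq_intros)
      then show ?thesis
        by (rule DERIV_cong_ev[THEN iffD1, rotated -1])
          (use False that eventually_nhds_in_open[of "{..<0}" t] in \<open>auto elim!: eventually_mono\<close>)
    qed
    moreover have "inverse (sqrt \<bar>t\<bar>) / 2 * sgn t = sqrt \<bar>t\<bar> * (1/2) / t"
      using that real_sqrt_mult_self[of "\<bar>t\<bar>"] by (auto simp: sgn_if field_simps abs_if split: if_splits)
    ultimately show ?thesis by (simp only:)
  qed
  from this[OF nz, unfolded has_field_derivative_def]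
  have s: "((\<lambda>t. sqrt \<bar>t\<bar>) has_derivative (*) (sqrt \<bar>det (f x)\<bar> * (1/2) / det (f x))) (at (det (f x)))" .
  from has_derivative_compose[OF has_derivative_det[OF d inv] s] nz
  show ?thesis by (simp add: mult.assoc)
qed

section \<open>Charts\<close>

text \<open>The Hausdorff property is used to know that the compact supports of cut-off fields are
  closed.\<close>

locale atlas =
  fixes M :: "('m::t2_space, 'n::finite) chart set"
  assumes manifold: "oriented_manifold M"
begin

lemma chart_homeomorphism:
  "c \<in> M \<Longrightarrow> homeomorphism (fst c) (snd c ` fst c) (snd c) (chart_inv c)"
  using manifold by (auto simp: oriented_manifold_def is_chart_def)

lemma open_chart_domain: "c \<in> M \<Longrightarrow> open (fst c)"
  using manifold by (auto simp: oriented_manifold_def is_chart_def)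

lemma open_chart_range: "c \<in> M \<Longrightarrow> open (snd c ` fst c)"
  using manifold by (auto simp: oriented_manifold_def is_chart_def)

lemma chart_inv_chart [simp]: "c \<in> M \<Longrightarrow> p \<in> fst c \<Longrightarrow> chart_inv c (snd c p) = p"
  using chart_homeomorphism homeomorphism_apply1 by blast

lemma open_chart_image: "c \<in> M \<Longrightarrow> open S \<Longrightarrow> open (snd c ` (fst c \<inter> S))"
  using homeomorphism_imp_open_map[OF chart_homeomorphism, of c "fst c \<inter> S"] open_chart_range[of c]
  by (auto simp: openin_open_Int openin_open_eq)

lemma chart_preimage_iff: "c \<in> M \<Longrightarrow> x \<in> snd c ` fst c \<Longrightarrow>
    x \<in> snd c ` (fst c \<inter> S) \<longleftrightarrow> chart_inv c x \<in> S"
  by (auto simp: image_iff)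

text \<open>The differential at \<open>p\<close> of a coordinate change. Both
  \<open>to_coords\<close> and \<open>of_coords\<close> are instances of it, so that their algebra
  is that of \<open>transition_trans\<close>.\<close>

definition transition :: "('m, 'n) chart \<Rightarrow> ('m, 'n) chart \<Rightarrow> 'm \<Rightarrow> real^'n \<Rightarrow> real^'n" where
  "transition c c' p = frechet_derivative (snd c' \<circ> chart_inv c) (at (snd c p))"

lemma smooth_on_transition:
  "c \<in> M \<Longrightarrow> c' \<in> M \<Longrightarrow> smooth_on (snd c ` (fst c \<inter> fst c')) (snd c' \<circ> chart_inv c)"
  using manifold by (auto simp: oriented_manifold_def oriented_transition_def)

lemma has_derivative_transition:
  assumes "c \<in> M" "c' \<in> M" "p \<in> fst c" "p \<in> fst c'"
  shows "((snd c' \<circ> chart_inv c) has_derivative transition c c' p) (at (snd c p))"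
  unfolding transition_def
  by (rule smooth_on_has_derivative[OF smooth_on_transition]) (use assms in auto)

lemma linear_transition:
  "c \<in> M \<Longrightarrow> c' \<in> M \<Longrightarrow> p \<in> fst c \<Longrightarrow> p \<in> fst c' \<Longrightarrow> linear (transition c c' p)"
  using has_derivative_transition has_derivative_linear by blast

lemma det_transition_pos:
  assumes "c \<in> M" "c' \<in> M" "p \<in> fst c" "p \<in> fst c'"
  shows "det (matrix (transition c c' p)) > 0"
  using manifold assms
  by (auto simp: oriented_manifold_def oriented_transition_def transition_def)

lemma transition_self [simp]:
  assumes "c \<in> M" "p \<in> fst c"
  shows "transition c c p = id"
proof -
  have "frechet_derivative (snd c \<circ> chart_inv c) (at (snd c p)) = frechet_derivative id (at (snd c p))"
    by (rule frechet_derivative_cong_open[OF open_chart_range[OF assms(1)]]) (use assms in auto)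
  then show ?thesis by (simp add: transition_def)
qed

lemma transition_trans:
  assumes "c \<in> M" "c' \<in> M" "c'' \<in> M" "p \<in> fst c" "p \<in> fst c'" "p \<in> fst c''"
  shows "transition c' c'' p (transition c c' p v) = transition c c'' p v"
proof -
  have "((snd c'' \<circ> chart_inv c') has_derivative transition c' c'' p)
      (at ((snd c' \<circ> chart_inv c) (snd c p)))"
    using has_derivative_transition[OF assms(2,3,5,6)] assms by simp
  from diff_chain_at[OF has_derivative_transition[OF assms(1,2,4,5)] this]
  have "(((snd c'' \<circ> chart_inv c') \<circ> (snd c' \<circ> chart_inv c)) has_derivative
      (transition c' c'' p \<circ> transition c c' p)) (at (snd c p))" .
  then have "((snd c'' \<circ> chart_inv c) has_derivative (transition c' c'' p \<circ> transition c c' p)) (at (snd c p))"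
    \<comment> \<open>The middle chart cancels only on its overlap with \<open>c\<close>, an open
      neighbourhood of \<open>snd c p\<close> in coordinates.\<close>
    by (rule has_derivative_transform_within_open[where s = "snd c ` (fst c \<inter> fst c')"])
      (use assms open_chart_image[OF assms(1) open_chart_domain[OF assms(2)]] in auto)
  then show ?thesis
    using has_derivative_unique[OF _ has_derivative_transition[OF assms(1,3,4,6)]]
    by (metis comp_apply)
qed

lemma chart_at_props: "chart_at M p \<in> M" "p \<in> fst (chart_at M p)"
proof -
  have "(\<Union>c\<in>M. fst c) = UNIV"
    using manifold by (simp only: oriented_manifold_def)
  then have "\<exists>c. c \<in> M \<and> p \<in> fst c" by blast
  from someI_ex[OF this] show "chart_at M p \<in> M" "p \<in> fst (chart_at M p)"
    by (auto simp: chart_at_def)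
qed

lemma to_coords_transition: "to_coords M c p = transition (chart_at M p) c p"
  by (simp add: to_coords_def transition_def)

lemma of_coords_transition: "of_coords M c p = transition c (chart_at M p) p"
  by (simp add: of_coords_def transition_def)

lemma to_coords_chart_at [simp]: "to_coords M (chart_at M p) p = id"
  by (simp add: to_coords_transition chart_at_props)

lemma of_coords_chart_at [simp]: "of_coords M (chart_at M p) p = id"
  by (simp add: of_coords_transition chart_at_props)

lemma linear_to_coords: "c \<in> M \<Longrightarrow> p \<in> fst c \<Longrightarrow> linear (to_coords M c p)"
  by (simp add: to_coords_transition linear_transition chart_at_props)

lemma linear_of_coords: "c \<in> M \<Longrightarrow> p \<in> fst c \<Longrightarrow> linear (of_coords M c p)"
  by (simp add: of_coords_transition linear_transition chart_at_props)

lemma to_coords_of_coords [simp]: "c \<in> M \<Longrightarrow> p \<in> fst c \<Longrightarrow> to_coords M c p (of_coords M c p v) = v"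
  by (simp add: to_coords_transition of_coords_transition transition_trans chart_at_props)

lemma of_coords_to_coords [simp]: "c \<in> M \<Longrightarrow> p \<in> fst c \<Longrightarrow> of_coords M c p (to_coords M c p v) = v"
  by (simp add: to_coords_transition of_coords_transition transition_trans chart_at_props)

lemma transition_to_coords:
  "c \<in> M \<Longrightarrow> p \<in> fst c \<Longrightarrow> c' \<in> M \<Longrightarrow> p \<in> fst c' \<Longrightarrow>
    transition c c' p (to_coords M c p v) = to_coords M c' p v"
  by (simp add: to_coords_transition transition_trans chart_at_props)

lemma to_coords_of_coords_other:
  "c \<in> M \<Longrightarrow> p \<in> fst c \<Longrightarrow> c' \<in> M \<Longrightarrow> p \<in> fst c' \<Longrightarrow>
    to_coords M c' p (of_coords M c p v) = transition c c' p v"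
  by (simp add: to_coords_transition of_coords_transition transition_trans chart_at_props)

lemma of_coords_transition_apply:
  "c \<in> M \<Longrightarrow> p \<in> fst c \<Longrightarrow> c' \<in> M \<Longrightarrow> p \<in> fst c' \<Longrightarrow>
    of_coords M c' p (transition c c' p v) = of_coords M c p v"
  by (simp add: of_coords_transition transition_trans chart_at_props)

lemma to_coords_coord_vec: "c \<in> M \<Longrightarrow> p \<in> fst c \<Longrightarrow> to_coords M c p (coord_vec M c p i) = axis i 1"
  by (simp add: coord_vec_def)

lemma coord_covec_apply:
  assumes "c \<in> M" "p \<in> fst c"
  shows "blinfun_apply (coord_covec M c p i) v = to_coords M c p v $ i"
proof -
  have "bounded_linear (\<lambda>v. to_coords M c p v $ i)"
    using linear_to_coords[OF assms] linear_conv_bounded_linear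
    by (blast intro: bounded_linear_compose[OF bounded_linear_vec_nth])
  then show ?thesis by (simp add: coord_covec_def bounded_linear_Blinfun_apply)
qed

lemma smooth_on_transition_vec:
  "c \<in> M \<Longrightarrow> c' \<in> M \<Longrightarrow>
    smooth_on (snd c ` (fst c \<inter> fst c')) (\<lambda>x. transition c c' (chart_inv c x) v)"
  by (rule smooth_on_cong[OF _ smooth_on_frechet_derivative[OF smooth_on_transition]])
    (auto simp: transition_def open_chart_image open_chart_domain)

section \<open>Induced charts of the tangent bundle\<close>

lemma tchart_inv_tchart [simp]: "c \<in> M \<Longrightarrow> fst v \<in> fst c \<Longrightarrow> tchart_inv M c (tchart M c v) = v"
  by (simp add: tchart_def tchart_inv_def)

lemma tchart_tchart_inv [simp]:
  "c \<in> M \<Longrightarrow> fst z \<in> snd c ` fst c \<Longrightarrow> tchart M c (tchart_inv M c z) = z"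
  by (auto simp: tchart_def tchart_inv_def prod_eq_iff)

lemma fst_tchart [simp]: "fst (tchart M c v) = snd c (fst v)"
  by (simp add: tchart_def)

lemma fst_tchart_inv [simp]: "fst (tchart_inv M c z) = chart_inv c (fst z)"
  by (simp add: tchart_inv_def)

lemma mem_timage_iff:
  assumes "c \<in> M"
  shows "z \<in> timage M c A \<longleftrightarrow> fst z \<in> snd c ` fst c \<and> tchart_inv M c z \<in> A"
proof
  assume "z \<in> timage M c A"
  then show "fst z \<in> snd c ` fst c \<and> tchart_inv M c z \<in> A"
    using assms by (auto simp: timage_def tchart_def tchart_inv_def)
next
  assume z: "fst z \<in> snd c ` fst c \<and> tchart_inv M c z \<in> A"
  then have "z = tchart M c (tchart_inv M c z)" "chart_inv c (fst z) \<in> fst c"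
    using assms by auto
  then show "z \<in> timage M c A" using z unfolding timage_def by force
qed

lemma tchart_mem_timage: "c \<in> M \<Longrightarrow> v \<in> A \<Longrightarrow> fst v \<in> fst c \<Longrightarrow> tchart M c v \<in> timage M c A"
  by (auto simp: timage_def)

text \<open>Lines in a tangent space stay lines in every chart, since \<open>to_coords\<close> is
  linear; this is why vertical derivatives have a meaning independent of charts.\<close>

lemma tchart_add_vertical:
  assumes "c \<in> M" "q \<in> fst c"
  shows "tchart M c (q, w + t *\<^sub>R of_coords M c q u) = tchart M c (q, w) + t *\<^sub>R (0, u)"
  using assms linear_to_coords[OF assms]
  by (simp add: tchart_def linear_add linear_cmul)

end

section \<open>Pseudo-Finsler metrics in coordinates\<close>

lemma linear_axis_sum:
  fixes v :: "real^'n"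
  assumes "linear f"
  shows "f v = (\<Sum>i\<in>UNIV. v $ i *\<^sub>R f (axis i 1))"
proof -
  have "v = (\<Sum>i\<in>UNIV. v $ i *\<^sub>R axis i 1)"
    by (simp add: vec_eq_iff axis_def if_distrib[of "(*) _"] cong: if_cong)
  then have "f v = f (\<Sum>i\<in>UNIV. v $ i *\<^sub>R axis i 1)" by simp
  then show ?thesis by (simp add: linear_sum[OF assms] linear_cmul[OF assms])
qed

lemma linear_on_Pair_axis_sum:
  fixes v :: "real^'n"
  assumes "linear f"
  shows "f (x, v) = f (x, 0) + (\<Sum>i\<in>UNIV. v $ i *\<^sub>R f (0, axis i 1))"
    and "f (v, y) = f (0, y) + (\<Sum>i\<in>UNIV. v $ i *\<^sub>R f (axis i 1, 0))"
proof -
  have "linear (\<lambda>v. f (0, v))" "linear (\<lambda>v. f (v, 0))"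
    using assms by (auto simp: linear_iff) (metis add.right_neutral add_Pair scale_zero_right scaleR_Pair)+
  from linear_axis_sum[OF this(1), of v] linear_axis_sum[OF this(2), of v]
  show "f (x, v) = f (x, 0) + (\<Sum>i\<in>UNIV. v $ i *\<^sub>R f (0, axis i 1))"
    "f (v, y) = f (0, y) + (\<Sum>i\<in>UNIV. v $ i *\<^sub>R f (axis i 1, 0))"
    using linear_add[OF assms, of "(x, 0)" "(0, v)"] linear_add[OF assms, of "(0, y)" "(v, 0)"]
    by simp_all
qed

lemma smooth_on_pdy [smooth_intros]: "smooth_on S G \<Longrightarrow> smooth_on S (pdy i G)"
  unfolding pdy_def[abs_def] by (rule smooth_on_frechet_derivative)

lemma smooth_on_fund_tensor [smooth_intros]:
  "open S \<Longrightarrow> smooth_on S F \<Longrightarrow> smooth_on S (\<lambda>z. fund_tensor F z $ i $ j)"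
  unfolding fund_tensor_def vec_lambda_beta by (intro smooth_intros)

locale finsler_manifold = atlas M
  for M :: "('m::t2_space, 'n::finite) chart set" +
  fixes A :: "('m, 'n) tvec set" and L :: "('m, 'n) tvec \<Rightarrow> real"
  assumes cone: "admissible_cone M A" and finsler: "pseudo_finsler M A L"
begin

lemma open_timage: "c \<in> M \<Longrightarrow> open (timage M c A)"
  using cone by (auto simp: admissible_cone_def)

abbreviation lag :: "('m, 'n) chart \<Rightarrow> (real^'n) \<times> (real^'n) \<Rightarrow> real" where
  "lag c \<equiv> L \<circ> tchart_inv M c"

lemma smooth_on_lag: 
  assumes "c \<in> M"
  shows "smooth_on (timage M c A) (lag c)"
proof -
  have "smooth_on (timage M c A) (\<lambda>z. fun_tensor A L (tchart_inv M c z) [] [])"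
    using finsler assms by (auto simp: pseudo_finsler_def tensor_fields_def)
  then show ?thesis
    by (rule smooth_on_cong[OF open_timage[OF assms]])
      (use assms in \<open>auto simp: mem_timage_iff fun_tensor_def\<close>)
qed

lemma invertible_fund_tensor: "c \<in> M \<Longrightarrow> z \<in> timage M c A \<Longrightarrow> invertible (fund_tensor (lag c) z)"
  using finsler by (auto simp: pseudo_finsler_def)

text \<open>Turns a vertical partial derivative in a chart into the derivative along a curve in one
  tangent space, so that different charts can be compared.\<close>

lemma fibre_DERIV:
  fixes G :: "(real^'n) \<times> (real^'n) \<Rightarrow> real"
  assumes "c \<in> M" "q \<in> fst c" "(q, w) \<in> A" "smooth_on (timage M c A) G"
  shows "((\<lambda>t. G (tchart M c (q, w + t *\<^sub>R of_coords M c q u))) has_real_derivative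
    frechet_derivative G (at (tchart M c (q, w))) (0, u)) (at 0)"
  using line_DERIV[of G "tchart M c (q, w)" 0 "(0, u)"]
    smooth_on_differentiable[OF assms(4) tchart_mem_timage[OF assms(1,3)]] assms
  by (simp only: tchart_add_vertical scaleR_zero_left add_0_right fst_conv)

text \<open>Identities of first derivatives hold only on \<open>A\<close>; to differentiate them
  once more along a fibre they must hold for all small \<open>t\<close>.\<close>

lemma eventually_fibre_in_cone:
  assumes "c \<in> M" "q \<in> fst c" "(q, w) \<in> A"
  shows "\<forall>\<^sub>F t in nhds 0. (q, w + t *\<^sub>R of_coords M c q u) \<in> A"
proof -
  have "((\<lambda>t. tchart M c (q, w) + t *\<^sub>R (0, u)) \<longlongrightarrow> tchart M c (q, w) + 0 *\<^sub>R (0, u)) (nhds 0)"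
    by (intro tendsto_intros filterlim_ident)
  then have "((\<lambda>t. tchart M c (q, w) + t *\<^sub>R (0, u)) \<longlongrightarrow> tchart M c (q, w)) (nhds 0)"
    by (simp only: scaleR_zero_left add_0_right)
  then have "\<forall>\<^sub>F t in nhds 0. tchart M c (q, w) + t *\<^sub>R (0, u) \<in> timage M c A"
    using tchart_mem_timage[OF assms(1,3)] assms(2)
    by (intro topological_tendstoD[OF _ open_timage[OF assms(1)]]) simp_all
  then show ?thesis
  proof eventually_elim
    case (elim t)
    then have "tchart_inv M c (tchart M c (q, w + t *\<^sub>R of_coords M c q u)) \<in> A"
      using assms by (simp only: mem_timage_iff tchart_add_vertical)
    then show ?case using assms by simp
  qed
qed

text \<open>Both sides are the derivative of \<open>L\<close> along the same curve in the tangent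
  space at \<open>q\<close>.\<close>

lemma fibre_derivative_lag:
  assumes c: "c \<in> M" "q \<in> fst c" and c': "c' \<in> M" "q \<in> fst c'" and v: "(q, w) \<in> A"
  shows "frechet_derivative (lag c) (at (tchart M c (q, w))) (0, u)
    = frechet_derivative (lag c') (at (tchart M c' (q, w))) (0, transition c c' q u)"
  using fibre_DERIV[OF c v smooth_on_lag[OF c(1)], of u]
    fibre_DERIV[OF c' v smooth_on_lag[OF c'(1)], of "transition c c' q u"] c c'
  by (auto simp: of_coords_transition_apply dest: DERIV_unique)

lemma fibre_second_derivative_lag:
  assumes c: "c \<in> M" "q \<in> fst c" and c': "c' \<in> M" "q \<in> fst c'" and v: "(q, w) \<in> A"
  shows "frechet_derivative (\<lambda>z. frechet_derivative (lag c) (at z) (0, u))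
      (at (tchart M c (q, w))) (0, u')
    = frechet_derivative (\<lambda>z. frechet_derivative (lag c') (at z) (0, transition c c' q u))
      (at (tchart M c' (q, w))) (0, transition c c' q u')" (is "?l = ?r")
proof -
  have l: "((\<lambda>t. frechet_derivative (lag c) (at (tchart M c (q, w + t *\<^sub>R of_coords M c q u'))) (0, u))
      has_real_derivative ?l) (at 0)"
    by (rule fibre_DERIV[OF c v]) (intro smooth_on_frechet_derivative smooth_on_lag c)
  have "((\<lambda>t. frechet_derivative (lag c') (at (tchart M c' (q, w + t *\<^sub>R of_coords M c' q (transition c c' q u'))))
      (0, transition c c' q u)) has_real_derivative ?r) (at 0)"
    by (rule fibre_DERIV[OF c' v]) (intro smooth_on_frechet_derivative smooth_on_lag c')
  moreover have "\<forall>\<^sub>F t in nhds 0.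
      frechet_derivative (lag c') (at (tchart M c' (q, w + t *\<^sub>R of_coords M c' q (transition c c' q u'))))
        (0, transition c c' q u)
      = frechet_derivative (lag c) (at (tchart M c (q, w + t *\<^sub>R of_coords M c q u'))) (0, u)"
    using eventually_fibre_in_cone[OF c v, of u']
    by eventually_elim (use c c' in \<open>simp add: of_coords_transition_apply fibre_derivative_lag[OF c c']\<close>)
  ultimately have "((\<lambda>t. frechet_derivative (lag c) (at (tchart M c (q, w + t *\<^sub>R of_coords M c q u'))) (0, u))
      has_real_derivative ?r) (at 0)"
    using DERIV_cong_ev by fast
  with l show ?thesis by (rule DERIV_unique)
qed

lemma fund_tensor_inner:
  assumes c: "c \<in> M" and z: "z \<in> timage M c A"
  shows "frechet_derivative (\<lambda>z. frechet_derivative (lag c) (at z) (0, u)) (at z) (0, u')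
    = 2 * (u' \<bullet> (fund_tensor (lag c) z *v u))"
proof -
  have sm: "smooth_on (timage M c A) (\<lambda>z. frechet_derivative (lag c) (at z) w)" for w
    by (intro smooth_on_frechet_derivative smooth_on_lag c)
  have "frechet_derivative (\<lambda>z. frechet_derivative (lag c) (at z) (0, u)) (at z)
    = frechet_derivative (\<lambda>z. \<Sum>j\<in>UNIV. u $ j *\<^sub>R pdy j (lag c) z) (at z)"
  proof (rule frechet_derivative_cong_open[OF open_timage[OF c] z])
    fix z assume z: "z \<in> timage M c A"
    have l: "linear (frechet_derivative (lag c) (at z))"
      by (rule linear_frechet_derivative[OF smooth_on_differentiable[OF smooth_on_lag[OF c] z]])
    show "frechet_derivative (lag c) (at z) (0, u) = (\<Sum>j\<in>UNIV. u $ j *\<^sub>R pdy j (lag c) z)"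
      using linear_on_Pair_axis_sum(1)[OF l, of 0 u] linear_0[OF l]
      by (simp add: pdy_def zero_prod_def)
  qed
  moreover have "((\<lambda>z. \<Sum>j\<in>UNIV. u $ j *\<^sub>R pdy j (lag c) z) has_derivative
      (\<lambda>v. \<Sum>j\<in>UNIV. u $ j *\<^sub>R frechet_derivative (pdy j (lag c)) (at z) v)) (at z)"
    by (intro has_derivative_sum has_derivative_scaleR_right smooth_on_has_derivative[OF _ z]
        smooth_on_pdy smooth_on_lag c)
  moreover have "frechet_derivative (pdy j (lag c)) (at z) (0, u')
      = (\<Sum>i\<in>UNIV. u' $ i * pdy i (pdy j (lag c)) z)" for j
  proof -
    have l: "linear (frechet_derivative (pdy j (lag c)) (at z))"
      by (rule linear_frechet_derivative[OF smooth_on_differentiable[OF smooth_on_pdy[OF smooth_on_lag[OF c]] z]])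
    show ?thesis
      using linear_on_Pair_axis_sum(1)[OF l, of 0 u'] linear_0[OF l]
      by (simp add: pdy_def[of _ "pdy j (lag c)"] zero_prod_def)
  qed
  ultimately have "frechet_derivative (\<lambda>z. frechet_derivative (lag c) (at z) (0, u)) (at z) (0, u')
    = (\<Sum>j\<in>UNIV. u $ j * (\<Sum>i\<in>UNIV. u' $ i * pdy i (pdy j (lag c)) z))"
    by (simp flip: frechet_derivative_at)
  also have "\<dots> = 2 * (u' \<bullet> (fund_tensor (lag c) z *v u))"
    by (simp add: inner_vec_def matrix_vector_mult_def fund_tensor_def sum_distrib_left mult_ac)
      (rule sum.swap)
  finally show ?thesis .
qed

text \<open>The fibrewise Hessian of \<open>L\<close> is a chart-free bilinear form by
  \<open>fibre_second_derivative_lag\<close>, and its matrix in a chart is twice the fundamental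
  tensor; bilinear forms transform by congruence.\<close>

lemma fund_tensor_transition:
  assumes c: "c \<in> M" "q \<in> fst c" and c': "c' \<in> M" "q \<in> fst c'" and v: "(q, w) \<in> A"
  shows "fund_tensor (lag c) (tchart M c (q, w)) = transpose (matrix (transition c c' q))
    ** fund_tensor (lag c') (tchart M c' (q, w)) ** matrix (transition c c' q)" (is "?g = transpose ?J ** ?g' ** ?J")
proof -
  have J: "transition c c' q u = ?J *v u" for u
    by (simp add: linear_transition[OF c(1) c'(1) c(2) c'(2)])
  have adj: "u' \<bullet> (transpose ?J *v x) = (?J *v u') \<bullet> x" for u' x
    using dot_lmul_matrix[of x ?J u'] by (simp add: transpose_matrix_vector inner_commute)
  have "u' \<bullet> (?g *v u) = (?J *v u') \<bullet> (?g' *v (?J *v u))" for u u'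
    using fibre_second_derivative_lag[OF c c' v, of u u']
      fund_tensor_inner[OF c(1) tchart_mem_timage[OF c(1) v], of u u']
      fund_tensor_inner[OF c'(1) tchart_mem_timage[OF c'(1) v], of "?J *v u" "?J *v u'"]
      c c' by (simp add: J)
  then have "u' \<bullet> (?g *v u) = u' \<bullet> ((transpose ?J ** ?g' ** ?J) *v u)" for u u'
    by (simp only: matrix_vector_mul_assoc[symmetric] adj)
  then have "?g *v u = (transpose ?J ** ?g' ** ?J) *v u" for u
    by (metis vector_eq_ldot)
  then show ?thesis by (simp add: matrix_eq)
qed

definition density :: "('m, 'n) chart \<Rightarrow> (real^'n) \<times> (real^'n) \<Rightarrow> real" where
  "density c z = sqrt \<bar>det (fund_tensor (lag c) z)\<bar>"

lemma smooth_on_density: "c \<in> M \<Longrightarrow> smooth_on (timage M c A) (density c)"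
  unfolding density_def[abs_def]
  by (intro smooth_intros open_timage smooth_on_lag)
    (use invertible_fund_tensor in \<open>auto simp: invertible_det_nz\<close>)

text \<open>Congruence multiplies the determinant by the square of the Jacobian determinant;
  orientation lets its root lose the absolute value.\<close>

lemma density_transition:
  assumes c: "c \<in> M" "q \<in> fst c" and c': "c' \<in> M" "q \<in> fst c'" and v: "(q, w) \<in> A"
  shows "density c (tchart M c (q, w)) = det (matrix (transition c c' q)) * density c' (tchart M c' (q, w))"
proof -
  have "det (matrix (transition c c' q)) > 0" using det_transition_pos c c' by blast
  then show ?thesis
    by (simp add: density_def fund_tensor_transition[OF assms] det_mul abs_mult real_sqrt_mult)
qed

text \<open>Independence of the chart: the Jacobian determinant gained by the density is the one by
  which \<open>det_list\<close> changes.\<close>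

lemma vol_form_eq:
  assumes c: "c \<in> M" "q \<in> fst c" and v: "(q, w) \<in> A"
  shows "vol_form M A L (q, w) [] vs = density c (tchart M c (q, w)) * det_list (map (to_coords M c q) vs)"
proof -
  let ?c = "chart_at M q"
  have c0: "?c \<in> M" "q \<in> fst ?c" by (rule chart_at_props)+
  have "vol_form M A L (q, w) [] vs = density ?c (tchart M ?c (q, w)) * det_list (map (to_coords M ?c q) vs)"
    using v by (auto simp: vol_form_def density_def det_list_def Let_def)
  also have "\<dots> = density c (tchart M c (q, w)) * det_list (map (transition ?c c q) (map (to_coords M ?c q) vs))"
    using density_transition[OF c0 c v] det_list_map_linear[OF linear_transition[OF c0(1) c(1) c0(2) c(2)]]
    by simp
  also have "map (transition ?c c q) (map (to_coords M ?c q) vs) = map (to_coords M c q) vs"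
    using transition_to_coords[OF c0 c] by simp
  finally show ?thesis .
qed

end

section \<open>Tensor derivations and insertion of vector fields\<close>

text \<open>An interior product. It is a contraction of a tensor product, so the axioms of a tensor
  derivation apply to it.\<close>

definition tensor_insert ::
    "(('m, 'n::finite) tvec \<Rightarrow> real^'n) \<Rightarrow> ('m, 'n) tensor_field \<Rightarrow> ('m, 'n) tensor_field" where
  "tensor_insert X \<omega> = (\<lambda>v \<alpha>s vs. if \<alpha>s = [] then \<omega> v [] (X v # vs) else 0)"

lemma is_tensor_linear_vec: "is_tensor r s T \<Longrightarrow> linear (\<lambda>v. T \<alpha>s (vs @ v # ws))"
  by (simp add: is_tensor_def)

lemma tensor_fields_is_tensor: "T \<in> tensor_fields M A r s \<Longrightarrow> v \<in> A \<Longrightarrow> is_tensor r s (T v)"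
  by (simp add: tensor_fields_def)

lemma tensor_fields_outside: "T \<in> tensor_fields M A r s \<Longrightarrow> v \<notin> A \<Longrightarrow> T v \<alpha>s vs = 0"
  by (simp add: tensor_fields_def del: split_paired_All)

lemma tensor_fields_smooth:
  "T \<in> tensor_fields M A r s \<Longrightarrow> c \<in> M \<Longrightarrow> length ks = r \<Longrightarrow> length js = s \<Longrightarrow>
    smooth_on (timage M c A) (\<lambda>z. T (tchart_inv M c z) (map (coord_covec M c (chart_inv c (fst z))) ks)
      (map (coord_vec M c (chart_inv c (fst z))) js))"
  by (simp add: tensor_fields_def)

lemma tensor_fields_eq_0:
  assumes "T \<in> tensor_fields M A r s" "length \<alpha>s \<noteq> r \<or> length vs \<noteq> s"
  shows "T v \<alpha>s vs = 0"
  using tensor_fields_is_tensor[OF assms(1)] tensor_fields_outside[OF assms(1)] assms(2)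
  by (cases "v \<in> A") (auto simp: is_tensor_def simp del: split_paired_All)

lemma contract_tensor_prod_vec:
  assumes \<omega>: "\<omega> \<in> tensor_fields M A 0 (Suc s)"
  shows "contract 0 0 (tensor_prod 0 (Suc s) \<omega> (vec_tensor A X)) = tensor_insert X \<omega>"
proof (intro ext)
  fix v \<alpha>s vs
  show "contract 0 0 (tensor_prod 0 (Suc s) \<omega> (vec_tensor A X)) v \<alpha>s vs = tensor_insert X \<omega> v \<alpha>s vs"
  proof (cases "v \<in> A \<and> \<alpha>s = [] \<and> length vs = s")
    case True
    have "linear (\<lambda>u. \<omega> v [] (u # vs))"
      using is_tensor_linear_vec[OF tensor_fields_is_tensor[OF \<omega>], of v "[]" "[]" vs] True by simp
    from linear_axis_sum[OF this, of "X v"] show ?thesis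
      using True by (simp add: contract_def tensor_prod_def insert_nth_def vec_tensor_def
          tensor_insert_def blinfun_inner_right.rep_eq inner_axis' mult.commute)
  next
    case False
    \<comment> \<open>For arguments of the wrong length, or off \<open>A\<close>, one of the two
      factors carries its default value 0.\<close>
    have "\<omega> v [] (take (Suc s) (u # vs)) * vec_tensor A X v (\<beta> # \<alpha>s) (drop (Suc s) (u # vs)) = 0" for u \<beta>
    proof (cases "length vs < s \<or> v \<notin> A")
      case True
      then show ?thesis
        using tensor_fields_eq_0[OF \<omega>, of "[]" "take (Suc s) (u # vs)" v]
          tensor_fields_outside[OF \<omega>, of v] by auto
    qed (use False in \<open>auto simp: vec_tensor_def\<close>)
    then have "contract 0 0 (tensor_prod 0 (Suc s) \<omega> (vec_tensor A X)) v \<alpha>s vs = 0"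
      unfolding contract_def tensor_prod_def insert_nth_def by (intro sum.neutral) simp
    moreover have "tensor_insert X \<omega> v \<alpha>s vs = 0"
      using False tensor_fields_eq_0[OF \<omega>, of "[]" "X v # vs" v] tensor_fields_outside[OF \<omega>, of v]
      by (auto simp: tensor_insert_def)
    ultimately show ?thesis by simp
  qed
qed

text \<open>Commutation with contractions is available only for members of
  \<open>tensor_fields\<close>, so membership of the product has to be shown.\<close>

lemma tensor_prod_vec_mem:
  assumes \<omega>: "\<omega> \<in> tensor_fields M A 0 (Suc s)" and X: "vector_field M A X"
    and op: "\<And>c. c \<in> M \<Longrightarrow> open (timage M c A)"
  shows "tensor_prod 0 (Suc s) \<omega> (vec_tensor A X) \<in> tensor_fields M A 1 (Suc s)"
  unfolding tensor_fields_def mem_Collect_eq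
proof (intro conjI ballI allI impI)
  fix v assume v: "v \<in> A"
  have t: "is_tensor 0 (Suc s) (\<omega> v)" by (rule tensor_fields_is_tensor[OF \<omega> v])
  show "is_tensor 1 (Suc s) (tensor_prod 0 (Suc s) \<omega> (vec_tensor A X) v)"
    unfolding is_tensor_def
  proof (intro conjI allI impI)
    show "tensor_prod 0 (Suc s) \<omega> (vec_tensor A X) v \<alpha>s vs = 0"
      if "length \<alpha>s \<noteq> 1 \<or> length vs \<noteq> Suc s" for \<alpha>s vs
    proof (cases "length vs < Suc s")
      case True
      then show ?thesis using t by (simp add: tensor_prod_def is_tensor_def)
    qed (use that in \<open>auto simp: tensor_prod_def vec_tensor_def\<close>)
    show "linear (\<lambda>\<alpha>. tensor_prod 0 (Suc s) \<omega> (vec_tensor A X) v (\<alpha>s @ \<alpha> # \<beta>s) vs)" for \<alpha>s \<beta>s vs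
      by (cases \<alpha>s; cases \<beta>s)
        (auto simp: tensor_prod_def vec_tensor_def linear_iff algebra_simps blinfun.add_left blinfun.scaleR_left)
    show "linear (\<lambda>u. tensor_prod 0 (Suc s) \<omega> (vec_tensor A X) v \<alpha>s (vs @ u # ws))" for \<alpha>s vs ws
    \<comment> \<open>Either the slot of \<open>u\<close> belongs to the form, or there are too many
      vectors and the factor of \<open>X\<close> vanishes.\<close>
    proof (cases "length vs \<le> s")
      case True
      have "linear (\<lambda>u. \<omega> v [] (vs @ u # take (s - length vs) ws))"
        by (rule is_tensor_linear_vec[OF t])
      moreover have "tensor_prod 0 (Suc s) \<omega> (vec_tensor A X) v \<alpha>s (vs @ u # ws)
          = \<omega> v [] (vs @ u # take (s - length vs) ws) * vec_tensor A X v \<alpha>s (drop (s - length vs) ws)" for u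
        using True by (simp add: tensor_prod_def Suc_diff_le)
      ultimately show ?thesis by (auto simp: linear_iff algebra_simps)
    next
      case False
      then have "tensor_prod 0 (Suc s) \<omega> (vec_tensor A X) v \<alpha>s (vs @ u # ws) = 0" for u
        by (simp add: tensor_prod_def vec_tensor_def)
      then show ?thesis by (simp add: linear_iff)
    qed
  qed
next
  fix v assume "v \<notin> A"
  then show "tensor_prod 0 (Suc s) \<omega> (vec_tensor A X) v = (\<lambda>_ _. 0)"
    using tensor_fields_outside[OF \<omega>, of v] by (simp add: tensor_prod_def)
next
  fix c :: "('a, 'b) chart" and ks js :: "'b list"
  assume c: "c \<in> M" and len: "length ks = 1 \<and> length js = Suc s"
  let ?\<alpha> = "\<lambda>z. map (coord_covec M c (chart_inv c (fst z)))"
  let ?e = "\<lambda>z. map (coord_vec M c (chart_inv c (fst z)))"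
  have "smooth_on (timage M c A) (\<lambda>z. \<omega> (tchart_inv M c z) (?\<alpha> z []) (?e z js)
      * vec_tensor A X (tchart_inv M c z) (?\<alpha> z ks) (?e z []))"
    using len by (intro smooth_on_mult op[OF c] tensor_fields_smooth[OF \<omega> c] tensor_fields_smooth[OF X c]) auto
  then show "smooth_on (timage M c A)
     (\<lambda>z. tensor_prod 0 (Suc s) \<omega> (vec_tensor A X) (tchart_inv M c z) (?\<alpha> z ks) (?e z js))"
    using len by (simp add: tensor_prod_def)
qed

context finsler_manifold
begin

lemma coord_comp_eq: "coord_comp M c X i z = to_coords M c (chart_inv c (fst z)) (X (tchart_inv M c z)) $ i"
  by (simp add: coord_comp_def)

lemma smooth_on_coord_comp:
  assumes X: "vector_field M A X" and c: "c \<in> M"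
  shows "smooth_on (timage M c A) (coord_comp M c X i)"
proof -
  have "smooth_on (timage M c A) (\<lambda>z. vec_tensor A X (tchart_inv M c z)
      (map (coord_covec M c (chart_inv c (fst z))) [i]) (map (coord_vec M c (chart_inv c (fst z))) []))"
    by (rule tensor_fields_smooth[OF X c]) auto
  then show ?thesis
    by (rule smooth_on_cong[OF open_timage[OF c]])
      (use c in \<open>auto simp: vec_tensor_def mem_timage_iff coord_comp_eq coord_covec_apply\<close>)
qed

text \<open>For smoothness, \<open>X\<close> is expanded in coordinate vectors, which leaves sums of
  products of smooth components.\<close>

lemma tensor_insert_mem:
  assumes \<omega>: "\<omega> \<in> tensor_fields M A 0 (Suc s)" and X: "vector_field M A X"
  shows "tensor_insert X \<omega> \<in> tensor_fields M A 0 s"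
  unfolding tensor_fields_def mem_Collect_eq
proof (intro conjI ballI allI impI)
  fix v assume v: "v \<in> A"
  have t: "is_tensor 0 (Suc s) (\<omega> v)" by (rule tensor_fields_is_tensor[OF \<omega> v])
  have "linear (\<lambda>u. \<omega> v [] (X v # vs @ u # ws))" for vs ws
    using is_tensor_linear_vec[OF t, of "[]" "X v # vs" ws] by simp
  then show "is_tensor 0 s (tensor_insert X \<omega> v)"
    using t unfolding is_tensor_def tensor_insert_def
    by (auto simp: linear_iff)
next
  fix v assume "v \<notin> A"
  then show "tensor_insert X \<omega> v = (\<lambda>_ _. 0)"
    using tensor_fields_outside[OF \<omega>, of v] by (simp add: tensor_insert_def fun_eq_iff)
next
  fix c and ks js :: "'n list"
  assume c: "c \<in> M" and len: "length ks = 0 \<and> length js = s"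
  let ?e = "\<lambda>z. coord_vec M c (chart_inv c (fst z))"
  have "smooth_on (timage M c A) (\<lambda>z. \<omega> (tchart_inv M c z)
      (map (coord_covec M c (chart_inv c (fst z))) []) (map (?e z) (k # js)))" for k
    by (rule tensor_fields_smooth[OF \<omega> c]) (use len in auto)
  then have "smooth_on (timage M c A) (\<lambda>z. \<Sum>k\<in>UNIV. coord_comp M c X k z *
      \<omega> (tchart_inv M c z) [] (?e z k # map (?e z) js))"
    by (intro smooth_intros open_timage c smooth_on_coord_comp X) simp
  then show "smooth_on (timage M c A) (\<lambda>z. tensor_insert X \<omega> (tchart_inv M c z)
      (map (coord_covec M c (chart_inv c (fst z))) ks) (map (?e z) js))"
  proof (rule smooth_on_cong[OF open_timage[OF c]])
    fix z assume "z \<in> timage M c A"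
    then have z: "tchart_inv M c z \<in> A" "chart_inv c (fst z) \<in> fst c"
      using c by (auto simp: mem_timage_iff)
    let ?v = "tchart_inv M c z" and ?q = "chart_inv c (fst z)"
    have l1: "linear (\<lambda>u. \<omega> ?v [] (u # map (?e z) js))"
      using is_tensor_linear_vec[OF tensor_fields_is_tensor[OF \<omega> z(1)], of "[]" "[]"] by simp
    have "linear (\<lambda>x. \<omega> ?v [] (of_coords M c ?q x # map (?e z) js))"
      using linear_compose[OF linear_of_coords[OF c z(2)] l1] by (simp add: o_def)
    from linear_axis_sum[OF this, of "to_coords M c ?q (X ?v)"] c z(2)
    show "(\<Sum>k\<in>UNIV. coord_comp M c X k z * \<omega> ?v [] (?e z k # map (?e z) js))
      = tensor_insert X \<omega> ?v (map (coord_covec M c ?q) ks) (map (?e z) js)"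
      using len by (simp add: tensor_insert_def coord_comp_eq coord_vec_def)
  qed
qed

text \<open>Leibniz rule for the tensor product with \<open>X\<close>, followed by commutation with
  the contraction.\<close>

lemma tensor_derivation_insert:
  assumes l: "tensor_derivation M A l" and \<omega>: "\<omega> \<in> tensor_fields M A 0 (Suc s)"
    and X: "vector_field M A X" and Y: "l (vec_tensor A X) = vec_tensor A Y"
  shows "l (tensor_insert X \<omega>) v [] vs = l \<omega> v [] (X v # vs) + \<omega> v [] (Y v # vs)"
proof -
  let ?P = "\<lambda>\<omega> X. tensor_prod 0 (Suc s) \<omega> (vec_tensor A X)"
  have l\<omega>: "l \<omega> \<in> tensor_fields M A 0 (Suc s)"
    using l \<omega> by (simp add: tensor_derivation_def)
  have mem: "?P \<omega> X \<in> tensor_fields M A 1 (Suc s)"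
    by (rule tensor_prod_vec_mem[OF \<omega> X open_timage])
  have "l (tensor_insert X \<omega>) = l (contract 0 0 (?P \<omega> X))"
    by (simp only: contract_tensor_prod_vec[OF \<omega>])
  also have "\<dots> = contract 0 0 (l (?P \<omega> X))"
  proof -
    have "\<forall>r s. \<forall>T\<in>tensor_fields M A r s. \<forall>i<r. \<forall>j<s. l (contract i j T) = contract i j (l T)"
      using l unfolding tensor_derivation_def by (elim conjE)
    from this[rule_format, OF mem, of 0 0] show ?thesis by simp
  qed
  also have "l (?P \<omega> X) = (\<lambda>v \<alpha>s vs. ?P (l \<omega>) X v \<alpha>s vs + ?P \<omega> Y v \<alpha>s vs)"
  proof -
    have "\<forall>r s r' s'. \<forall>S\<in>tensor_fields M A r s. \<forall>T\<in>tensor_fields M A r' s'. l (tensor_prod r s S T)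
        = (\<lambda>v \<alpha>s vs. tensor_prod r s (l S) T v \<alpha>s vs + tensor_prod r s S (l T) v \<alpha>s vs)"
      using l unfolding tensor_derivation_def by (elim conjE)
    from this[rule_format, OF \<omega> X] show ?thesis by (simp only: Y)
  qed
  also have "contract 0 0 (\<lambda>v \<alpha>s vs. ?P (l \<omega>) X v \<alpha>s vs + ?P \<omega> Y v \<alpha>s vs)
      = (\<lambda>v \<alpha>s vs. contract 0 0 (?P (l \<omega>) X) v \<alpha>s vs + contract 0 0 (?P \<omega> Y) v \<alpha>s vs)"
    by (simp add: contract_def sum.distrib)
  finally show ?thesis
    unfolding contract_tensor_prod_vec[OF \<omega>] contract_tensor_prod_vec[OF l\<omega>]
    by (simp add: tensor_insert_def)
qed

text \<open>The vectors are absorbed into the form one at a time by \<open>tensor_insert\<close>,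
  each contributing its bracket term, until only a function remains.\<close>

lemma lie_bracket_on_fields:
  assumes l: "is_aniso_lie_bracket M A L Z l"
    and "\<omega> \<in> tensor_fields M A 0 (length Xs)" "\<forall>X\<in>set Xs. vector_field M A X" "v \<in> A"
  shows "hor_deriv M L Z (\<lambda>v. \<omega> v [] (map (\<lambda>X. X v) Xs)) v = l \<omega> v [] (map (\<lambda>X. X v) Xs)
    + (\<Sum>i<length Xs. \<omega> v [] ((map (\<lambda>X. X v) Xs)[i := hor_bracket M L Z (Xs ! i) v]))"
  using assms(2,3)
proof (induction Xs arbitrary: \<omega>)
  case Nil
  \<comment> \<open>The value of the derivation is prescribed on \<open>fun_tensor\<close>, and a
    field of type (0, 0) has this shape because of its default values.\<close>
  have \<omega>: "fun_tensor A (\<lambda>v. \<omega> v [] []) = \<omega>"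
  proof (intro ext)
    fix v \<alpha>s vs
    show "fun_tensor A (\<lambda>v. \<omega> v [] []) v \<alpha>s vs = \<omega> v \<alpha>s vs"
      using tensor_fields_eq_0[OF Nil(1), of \<alpha>s vs v] tensor_fields_outside[OF Nil(1), of v]
      by (auto simp: fun_tensor_def)
  qed
  have "smooth_fun M A f \<Longrightarrow> l (fun_tensor A f) = fun_tensor A (hor_deriv M L Z f)" for f
    using l by (simp add: is_aniso_lie_bracket_def)
  from this[of "\<lambda>v. \<omega> v [] []", unfolded \<omega>] Nil(1)
  have "l \<omega> = fun_tensor A (hor_deriv M L Z (\<lambda>v. \<omega> v [] []))" by simp
  then have "l \<omega> v [] [] = hor_deriv M L Z (\<lambda>v. \<omega> v [] []) v"
    using \<open>v \<in> A\<close> by (simp add: fun_tensor_def)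
  then show ?case by simp
next
  case (Cons X Xs)
  have X: "vector_field M A X" and \<omega>: "\<omega> \<in> tensor_fields M A 0 (Suc (length Xs))"
    using Cons.prems by auto
  have der: "tensor_derivation M A l" "l (vec_tensor A X) = vec_tensor A (hor_bracket M L Z X)"
    using l X by (auto simp: is_aniso_lie_bracket_def)
  have "hor_deriv M L Z (\<lambda>v. \<omega> v [] (map (\<lambda>X. X v) (X # Xs))) v
    = hor_deriv M L Z (\<lambda>v. tensor_insert X \<omega> v [] (map (\<lambda>X. X v) Xs)) v"
    by (simp add: tensor_insert_def)
  also have "\<dots> = l (tensor_insert X \<omega>) v [] (map (\<lambda>X. X v) Xs)
    + (\<Sum>i<length Xs. tensor_insert X \<omega> v [] ((map (\<lambda>X. X v) Xs)[i := hor_bracket M L Z (Xs ! i) v]))"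
    by (rule Cons.IH[OF tensor_insert_mem[OF \<omega> X]]) (use Cons.prems in auto)
  also have "\<dots> = l \<omega> v [] (map (\<lambda>X. X v) (X # Xs))
    + (\<Sum>i<length (X # Xs). \<omega> v [] ((map (\<lambda>X. X v) (X # Xs))[i := hor_bracket M L Z ((X # Xs) ! i) v]))"
    unfolding tensor_derivation_insert[OF der(1) \<omega> X der(2)]
    by (simp add: tensor_insert_def sum.lessThan_Suc_shift del: sum.lessThan_Suc)
  finally show ?case .
qed

lemma vol_form_eq':
  assumes "c \<in> M" "fst v \<in> fst c" "v \<in> A"
  shows "vol_form M A L v [] vs = density c (tchart M c v) * det_list (map (to_coords M c (fst v)) vs)"
  using vol_form_eq[of c "fst v" "snd v" vs] assms by (cases v) simp

lemma vol_form_chart_at: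
  assumes "v \<in> A"
  shows "vol_form M A L v [] vs = density (chart_at M (fst v)) (tchart M (chart_at M (fst v)) v) * det_list vs"
  using vol_form_eq[of "chart_at M (fst v)" "fst v" "snd v" vs] assms by (simp add: chart_at_props)

text \<open>On coordinate vectors of any chart the form is the smooth density times a constant
  determinant, thanks to \<open>vol_form_eq'\<close>.\<close>

lemma vol_form_mem: "vol_form M A L \<in> tensor_fields M A 0 CARD('n)"
  unfolding tensor_fields_def mem_Collect_eq
proof (intro conjI ballI allI impI)
  fix v assume v: "v \<in> A"
  have "linear (\<lambda>u. det_list (vs @ u # ws))" for vs ws :: "(real^'n) list"
    by (rule alt_form_linear[OF alt_form_det_list])
  then have "linear (\<lambda>u. vol_form M A L v [] (vs @ u # ws))" for vs ws
    unfolding vol_form_chart_at[OF v] by (simp add: linear_iff algebra_simps)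
  moreover have "vol_form M A L v \<alpha>s vs = 0" if "\<alpha>s \<noteq> []" for \<alpha>s vs
    using that by (simp add: vol_form_def)
  moreover have "vol_form M A L v \<alpha>s vs = 0" if "length vs \<noteq> CARD('n)" for \<alpha>s vs
    using that by (simp add: vol_form_def)
  moreover have "linear (\<lambda>u. vol_form M A L v \<alpha>s (vs @ u # ws))" for \<alpha>s vs ws
    using calculation(1)[of vs ws] calculation(2)[of \<alpha>s] by (cases "\<alpha>s = []") (auto simp: linear_iff)
  moreover have "linear (\<lambda>\<alpha>. vol_form M A L v (\<alpha>s @ \<alpha> # \<beta>s) vs)" for \<alpha>s \<beta>s vs
    using calculation(2) by (simp add: linear_iff)
  ultimately show "is_tensor 0 CARD('n) (vol_form M A L v)"
    unfolding is_tensor_def by (intro conjI allI impI) auto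
next
  fix v assume "v \<notin> A"
  then show "vol_form M A L v = (\<lambda>_ _. 0)" by (simp add: vol_form_def fun_eq_iff)
next
  fix c and ks js :: "'n list"
  assume c: "c \<in> M" and len: "length ks = 0 \<and> length js = CARD('n)"
  have "smooth_on (timage M c A) (\<lambda>z. density c z * det_list (map (\<lambda>j. axis j 1) js))"
    by (intro smooth_intros open_timage c smooth_on_density)
  then show "smooth_on (timage M c A) (\<lambda>z. vol_form M A L (tchart_inv M c z)
      (map (coord_covec M c (chart_inv c (fst z))) ks) (map (coord_vec M c (chart_inv c (fst z))) js))"
  proof (rule smooth_on_cong[OF open_timage[OF c]])
    fix z assume "z \<in> timage M c A"
    then have z: "tchart_inv M c z \<in> A" "chart_inv c (fst z) \<in> fst c" "fst z \<in> snd c ` fst c"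
      using c by (auto simp: mem_timage_iff)
    have "vol_form M A L (tchart_inv M c z) [] (map (coord_vec M c (chart_inv c (fst z))) js)
      = density c (tchart M c (tchart_inv M c z))
        * det_list (map (to_coords M c (chart_inv c (fst z))) (map (coord_vec M c (chart_inv c (fst z))) js))"
      using vol_form_eq'[OF c, of "tchart_inv M c z"] z by simp
    then show "density c z * det_list (map (\<lambda>j. axis j 1) js) = vol_form M A L (tchart_inv M c z)
      (map (coord_covec M c (chart_inv c (fst z))) ks) (map (coord_vec M c (chart_inv c (fst z))) js)"
      using len c z by (simp add: o_def to_coords_coord_vec)
  qed
qed

text \<open>A tensor derivation only accepts globally defined vector fields, so the coordinate fields
  have to be cut off.\<close>

lemma cut_off_coord_fields:
  assumes c: "c \<in> M" and p: "p \<in> fst c"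
  obtains b X where "smooth_on UNIV b" "b (snd c p) = (1::real)" "(b has_derivative (\<lambda>_. 0)) (at (snd c p))"
    "\<And>i. vector_field M A (X i)"
    "\<And>i z. z \<in> timage M c A \<Longrightarrow>
      to_coords M c (chart_inv c (fst z)) (X i (tchart_inv M c z)) = b (fst z) *\<^sub>R axis i 1"
proof -
  have "open (snd c ` fst c)" "snd c p \<in> snd c ` fst c" using open_chart_range c p by auto
  then obtain r where r: "r > 0" "cball (snd c p) r \<subseteq> snd c ` fst c"
    using open_contains_cball by metis
  obtain b where b: "smooth_on UNIV b" "b (snd c p) = (1::real)" "(b has_derivative (\<lambda>_. 0)) (at (snd c p))"
    "\<And>x. x \<notin> ball (snd c p) r \<Longrightarrow> b x = 0"
    using bump_exists[OF r(1)] by metis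
  define X where "X i v = (if fst v \<in> fst c then b (snd c (fst v)) *\<^sub>R coord_vec M c (fst v) i else 0)"
    for i and v :: "('m, 'n) tvec"
  \<comment> \<open>A compact, hence closed, set off which all the fields \<open>X i\<close> vanish;
    its complement is open and covers the points outside the domain of \<open>c\<close>.\<close>
  define K where "K = chart_inv c ` cball (snd c p) r"
  have "compact K" unfolding K_def
    using r chart_homeomorphism[OF c] continuous_on_subset[OF _ r(2)]
    by (intro compact_continuous_image) (auto simp: homeomorphism_def)
  then have "open (- K)" by (simp add: compact_imp_closed open_Compl)
  have vec: "is_tensor 1 0 (vec_tensor A (X i) v)" if "v \<in> A" for i v
    unfolding is_tensor_def
  proof (intro conjI allI impI)
    show "linear (\<lambda>\<alpha>. vec_tensor A (X i) v (\<alpha>s @ \<alpha> # \<beta>s) vs)" for \<alpha>s \<beta>s vs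
      by (cases \<alpha>s; cases \<beta>s) (auto simp: vec_tensor_def linear_iff blinfun.add_left blinfun.scaleR_left)
  qed (auto simp: vec_tensor_def linear_iff)
  have sm: "smooth_on (timage M c' A) (coord_comp M c' (X i) k)" if c': "c' \<in> M" for c' i k
  proof (rule smooth_on_local)
    fix z assume z: "z \<in> timage M c' A"
    then have z1: "fst z \<in> snd c' ` fst c'" using c' by (simp add: mem_timage_iff)
    show "\<exists>T. open T \<and> z \<in> T \<and> smooth_on (timage M c' A \<inter> T) (coord_comp M c' (X i) k)"
    \<comment> \<open>On the overlap with \<open>c\<close> the components are \<open>b\<close> times
      a column of the Jacobian matrix; elsewhere the point avoids \<open>K\<close> and the field is
      zero nearby.\<close>
    proof (cases "chart_inv c' (fst z) \<in> fst c")
      case True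
      define W where "W = snd c' ` (fst c' \<inter> fst c)"
      define T where "T = W \<times> (UNIV :: (real^'n) set)"
      define \<psi> where "\<psi> = snd c \<circ> chart_inv c'"
      have oW: "open W" unfolding W_def by (intro open_chart_image c' open_chart_domain c)
      then have oT: "open T" unfolding T_def by (intro open_Times) auto
      have zT: "z \<in> T"
        using True z1 c' by (cases z) (auto simp: T_def W_def chart_preimage_iff)
      have \<psi>: "smooth_on W \<psi>" unfolding W_def \<psi>_def by (intro smooth_on_transition c c')
      have \<psi>W: "\<psi> ` W \<subseteq> snd c ` (fst c \<inter> fst c')"
        using c c' by (auto simp: \<psi>_def W_def)
      have "smooth_on W (\<lambda>x. transition c c' (chart_inv c (\<psi> x)) (axis i 1))"
        by (rule smooth_on_compose[OF smooth_on_transition_vec[OF c c'] oW _ \<psi>W \<psi>])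
          (intro open_chart_image c open_chart_domain c')
      then have "smooth_on W (\<lambda>x. b (\<psi> x) * transition c c' (chart_inv c (\<psi> x)) (axis i 1) $ k)"
        by (intro smooth_intros oW smooth_on_compose[OF b(1) _ _ _ \<psi>]) auto
      then have "smooth_on T (\<lambda>z. b (\<psi> (fst z)) * transition c c' (chart_inv c (\<psi> (fst z))) (axis i 1) $ k)"
        by (rule smooth_on_compose[OF _ oT oW]) (auto simp: T_def oT[unfolded T_def] intro!: smooth_intros)
      then have "smooth_on T (coord_comp M c' (X i) k)"
      proof (rule smooth_on_cong[OF oT])
        fix z assume "z \<in> T"
        then obtain q where q: "fst z = snd c' q" "q \<in> fst c" "q \<in> fst c'"
          by (auto simp: T_def W_def)
        then have q': "\<psi> (fst z) = snd c q" "chart_inv c' (fst z) = q" "fst (tchart_inv M c' z) = q"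
          using c' by (simp_all add: \<psi>_def)
        show "b (\<psi> (fst z)) * transition c c' (chart_inv c (\<psi> (fst z))) (axis i 1) $ k
            = coord_comp M c' (X i) k z"
          unfolding coord_comp_eq X_def q' using c c' q
          by (simp add: coord_vec_def linear_cmul[OF linear_to_coords] to_coords_of_coords_other)
      qed
      then show ?thesis using oT zT
        by (intro exI[of _ T] conjI smooth_on_subset[OF _ Int_lower2])
    next
      case False
      define T where "T = (snd c' ` (fst c' \<inter> - K)) \<times> (UNIV :: (real^'n) set)"
      have oT: "open T" unfolding T_def
        by (intro open_Times open_chart_image c' \<open>open (- K)\<close>) auto
      have "K \<subseteq> fst c" using r c by (auto simp: K_def)
      then have zT: "z \<in> T"
        using False z1 c' by (cases z) (auto simp: T_def chart_preimage_iff)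
      have X0: "X i (q, w) = 0" if "q \<notin> K" for q w
      proof (cases "q \<in> fst c")
        case True
        then have "snd c q \<notin> cball (snd c p) r"
          using that c unfolding K_def by (metis chart_inv_chart imageI)
        then show ?thesis using b(4) by (simp add: X_def)
      qed (simp add: X_def)
      have "smooth_on T (\<lambda>z. 0)" by (rule smooth_on_const)
      then have "smooth_on T (coord_comp M c' (X i) k)"
        by (rule smooth_on_cong[OF oT])
          (use c' X0 in \<open>auto simp: T_def coord_comp_eq tchart_inv_def linear_0[OF linear_to_coords]\<close>)
      then show ?thesis using oT zT
        by (intro exI[of _ T] conjI smooth_on_subset[OF _ Int_lower2])
    qed
  qed
  have "vector_field M A (X i)" for i
    unfolding tensor_fields_def mem_Collect_eq
  proof (intro conjI ballI allI impI)
    show "vec_tensor A (X i) v = (\<lambda>_ _. 0)" if "v \<notin> A" for v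
      using that by (simp add: vec_tensor_def fun_eq_iff)
  next
    fix c' and ks js :: "'n list"
    assume c': "c' \<in> M" and "length ks = 1 \<and> length js = 0"
    then obtain k where k: "ks = [k]" "js = []" by (auto simp: length_Suc_conv)
    show "smooth_on (timage M c' A) (\<lambda>z. vec_tensor A (X i) (tchart_inv M c' z)
        (map (coord_covec M c' (chart_inv c' (fst z))) ks) (map (coord_vec M c' (chart_inv c' (fst z))) js))"
      by (rule smooth_on_cong[OF open_timage[OF c'] sm[OF c', of i k]])
        (use c' k in \<open>auto simp: vec_tensor_def mem_timage_iff coord_comp_eq coord_covec_apply\<close>)
  qed (rule vec)
  moreover have "to_coords M c (chart_inv c (fst z)) (X i (tchart_inv M c z)) = b (fst z) *\<^sub>R axis i 1"
    if "z \<in> timage M c A" for i z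
    using that c by (auto simp: mem_timage_iff X_def linear_cmul[OF linear_to_coords] to_coords_coord_vec)
  ultimately show thesis using that b(1-3) by blast
qed

end

section \<open>The divergence in coordinates\<close>

lemma hor_cong:
  "frechet_derivative G (at z) = frechet_derivative H (at z) \<Longrightarrow> hor F i G z = hor F i H z"
  by (simp add: hor_def pdx_def pdy_def)

lemma mean_cartan_axis:
  "mean_cartan F z (axis m 1) = (\<Sum>i\<in>UNIV. \<Sum>k\<in>UNIV. fund_inv F z $ i $ k * cartan F i m k z)"
  unfolding mean_cartan_def
  by (rule sum.cong[OF refl], subst sum.swap) (simp add: axis_def if_distrib[of "(*) _"] cong: if_cong)

lemma pdx_mult:
  assumes "G differentiable (at z)" "H differentiable (at z)"
  shows "pdx i (\<lambda>z. G z * H z) z = G z * pdx i H z + H z * pdx i G z"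
  using fun_cong[OF frechet_derivative_at[OF has_derivative_mult[OF assms[unfolded frechet_derivative_works]]],
      of "(axis i 1, 0)"]
  by (simp add: pdx_def mult.commute[of "frechet_derivative G (at z) (axis i 1, 0)"])

lemma pdy_mult:
  assumes "G differentiable (at z)" "H differentiable (at z)"
  shows "pdy i (\<lambda>z. G z * H z) z = G z * pdy i H z + H z * pdy i G z"
  using fun_cong[OF frechet_derivative_at[OF has_derivative_mult[OF assms[unfolded frechet_derivative_works]]],
      of "(0, axis i 1)"]
  by (simp add: pdy_def mult.commute[of "frechet_derivative G (at z) (0, axis i 1)"])

lemma hor_mult:
  assumes "G differentiable (at z)" "H differentiable (at z)"
  shows "hor F i (\<lambda>z. G z * H z) z = G z * hor F i H z + H z * hor F i G z"
  by (simp add: hor_def pdx_mult[OF assms] pdy_mult[OF assms] algebra_simps sum.distrib sum_distrib_left)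

lemma pdy_commute:
  assumes "open S" "smooth_on S G" "z \<in> S"
  shows "pdy i (pdy j G) z = pdy j (pdy i G) z"
  using frechet_derivative_symmetric[OF assms, of "(0, axis j 1)" "(0, axis i 1)"]
  by (simp add: pdy_def[abs_def])

lemma cartan_eq:
  assumes "open S" "smooth_on S F" "z \<in> S"
  shows "cartan F i j k z = (1/4) * pdy k (pdy i (pdy j F)) z"
proof -
  have "((\<lambda>z. (1/2) * pdy i (pdy j F) z) has_derivative
      (\<lambda>v. (1/2) * frechet_derivative (pdy i (pdy j F)) (at z) v)) (at z)"
    by (intro has_derivative_mult_right smooth_on_has_derivative[OF _ assms(3)] smooth_on_pdy assms)
  from frechet_derivative_at[OF this] show ?thesis
    by (simp add: cartan_def fund_tensor_def pdy_def[of k] fun_eq_iff)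
qed

text \<open>Up to a constant the components are third vertical derivatives of \<open>F\<close>,
  which commute. Only this rotation is needed to match Jacobi's formula with the index pattern of
  \<open>mean_cartan\<close>.\<close>

lemma cartan_rotate:
  assumes "open S" "smooth_on S F" "z \<in> S"
  shows "cartan F k i m z = cartan F i m k z"
proof -
  have "pdy m (pdy k (pdy i F)) z = pdy k (pdy m (pdy i F)) z"
    by (rule pdy_commute[OF assms(1) smooth_on_pdy[OF assms(2)] assms(3)])
  also have "\<dots> = pdy k (pdy i (pdy m F)) z"
    unfolding pdy_def[of k]
    by (rule fun_cong[OF frechet_derivative_cong_open[OF assms(1,3)]]) (rule pdy_commute[OF assms(1,2)])
  finally show ?thesis by (simp add: cartan_eq[OF assms])
qed

lemma mean_cartan_axis_sum:
  "mean_cartan F z X = (\<Sum>m\<in>UNIV. X $ m * mean_cartan F z (axis m 1))"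
proof -
  have "(\<Sum>m\<in>UNIV. X $ m * mean_cartan F z (axis m 1))
      = (\<Sum>m\<in>UNIV. \<Sum>i\<in>UNIV. \<Sum>k\<in>UNIV. fund_inv F z $ i $ k * cartan F i m k z * X $ m)"
    by (simp add: mean_cartan_axis sum_distrib_left mult_ac)
  also have "\<dots> = mean_cartan F z X"
    unfolding mean_cartan_def by (rule sum.swap)
  finally show ?thesis by simp
qed

lemma det_list_axis: "det_list (map (\<lambda>k. axis (coord_ix k) 1) [0..<CARD('n)] :: (real^'n::finite) list) = 1"
proof -
  have "(\<chi> i j. map (\<lambda>k. axis (coord_ix k :: 'n) (1::real)) [0..<CARD('n)] ! coord_num (j :: 'n) $ i) = mat 1"
    by (auto simp: vec_eq_iff mat_def axis_def)
  then show ?thesis by (simp add: det_list_def)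
qed

context finsler_manifold
begin

text \<open>The logarithmic derivative of the density is half the trace of
  \<open>g\<^sup>-\<^sup>1\<close> times the derivative of \<open>g\<close>; the Cartan tensor
  already contains the factor 1/2.\<close>

lemma pdy_density:
  assumes c: "c \<in> M" and z: "z \<in> timage M c A"
  shows "pdy m (density c) z = density c z * mean_cartan (lag c) z (axis m 1)"
proof -
  have d: "((\<lambda>z. fund_tensor (lag c) z $ i $ j) has_derivative
      frechet_derivative (\<lambda>z. fund_tensor (lag c) z $ i $ j) (at z)) (at z)" for i j
    by (intro smooth_on_has_derivative[OF _ z] smooth_intros open_timage smooth_on_lag c)
  have "pdy m (density c) z = density c z * (1/2) *
      (\<Sum>i\<in>UNIV. \<Sum>j\<in>UNIV. fund_inv (lag c) z $ j $ i * pdy m (\<lambda>z. fund_tensor (lag c) z $ i $ j) z)"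
    using fun_cong[OF frechet_derivative_at[OF has_derivative_sqrt_abs_det[OF d
            invertible_fund_tensor[OF c z]]], of "(0, axis m 1)"]
    unfolding pdy_def density_def[abs_def] fund_inv_def by (rule sym)
  also have "\<dots> = density c z * (\<Sum>k\<in>UNIV. \<Sum>i\<in>UNIV. fund_inv (lag c) z $ i $ k * cartan (lag c) k i m z)"
    by (simp add: cartan_def sum_distrib_left)
  also have "\<dots> = density c z * (\<Sum>i\<in>UNIV. \<Sum>k\<in>UNIV. fund_inv (lag c) z $ i $ k * cartan (lag c) i m k z)"
    by (subst sum.swap) (simp add: cartan_rotate[OF open_timage[OF c] smooth_on_lag[OF c] z])
  also have "(\<Sum>i\<in>UNIV. \<Sum>k\<in>UNIV. fund_inv (lag c) z $ i $ k * cartan (lag c) i m k z)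
      = mean_cartan (lag c) z (axis m 1)"
    by (rule mean_cartan_axis[symmetric])
  finally show ?thesis .
qed

text \<open>\<open>lie_bracket_on_fields\<close> is evaluated at \<open>v\<close> on a cut-off
  coordinate frame. To first order the frame has constant components there, so its brackets with
  \<open>Z\<close> are the negatives of the horizontal derivatives of \<open>Z\<close>, and together
  they contribute minus their trace.\<close>

lemma divergence_formula:
  fixes v :: "('m, 'n) tvec"
  defines "c \<equiv> chart_at M (fst v)"
  defines "z \<equiv> tchart M c v"
  assumes div: "is_divergence M A L Z d" and v: "v \<in> A"
  shows "d v * density c z = (\<Sum>k\<in>UNIV. coord_comp M c Z k z * hor (lag c) k (density c) z)
    + density c z * (\<Sum>i\<in>UNIV. hor (lag c) i (coord_comp M c Z i) z)"
proof -
  have c: "c \<in> M" "fst v \<in> fst c" unfolding c_def by (rule chart_at_props)+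
  have z: "z \<in> timage M c A" unfolding z_def using c v by (intro tchart_mem_timage)
  have op: "open (timage M c A)" by (rule open_timage[OF c(1)])
  have zv [simp]: "tchart_inv M c z = v" "fst z = snd c (fst v)" unfolding z_def using c by simp_all
  obtain l where l: "is_aniso_lie_bracket M A L Z l"
    "l (vol_form M A L) = (\<lambda>v \<alpha>s vs. d v * vol_form M A L v \<alpha>s vs)"
    using div by (auto simp: is_divergence_def)
  obtain b X where b: "smooth_on UNIV b" "b (fst z) = (1::real)" "(b has_derivative (\<lambda>_. 0)) (at (fst z))"
    and X: "\<And>i. vector_field M A (X i)"
    and Xc: "\<And>i z. z \<in> timage M c A \<Longrightarrow>
      to_coords M c (chart_inv c (fst z)) (X i (tchart_inv M c z)) = b (fst z) *\<^sub>R axis i 1"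
    using cut_off_coord_fields[OF c] unfolding zv by blast
  define Xs where "Xs = map (\<lambda>k. X (coord_ix k)) [0..<CARD('n)]"
  define es :: "(real^'n) list" where "es = map (\<lambda>k. axis (coord_ix k) 1) [0..<CARD('n)]"
  have tc: "to_coords M c (fst v) = id" by (simp add: c_def)
  have Xv: "X i v = axis i 1" for i
    using Xc[OF z, of i] b(2) c by (simp add: tc)
  have es: "map (\<lambda>X. X v) Xs = es" by (simp add: Xs_def es_def Xv)
  have len: "length Xs = CARD('n)" "length es = CARD('n)" by (simp_all add: Xs_def es_def)
  have bfst: "((\<lambda>z. b (fst z)) has_derivative (\<lambda>_. 0)) (at z)"
    using has_derivative_compose[OF bounded_linear_imp_has_derivative[OF bounded_linear_fst] b(3)] by simp
  \<comment> \<open>The components are constant multiples of \<open>b\<close>, whose derivative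
    vanishes at the base point.\<close>
  have horX: "hor (lag c) j (coord_comp M c (X i) k) z = 0" for i j k
  proof -
    have "frechet_derivative (coord_comp M c (X i) k) (at z)
        = frechet_derivative (\<lambda>z. b (fst z) * axis i 1 $ k) (at z)"
      by (rule frechet_derivative_cong_open[OF op z]) (simp add: coord_comp_eq Xc)
    also have "\<dots> = (\<lambda>_. 0)"
      by (intro frechet_derivative_at[symmetric] has_derivative_eq_rhs[OF has_derivative_mult_left[OF bfst]]) simp
    finally show ?thesis by (simp add: hor_def pdx_def pdy_def)
  qed
  define D where "D i = (\<chi> k. hor (lag c) i (coord_comp M c Z k) z)" for i
  have XZ: "hor_bracket M L Z (X i) v = - D i" for i
  proof -
    have "hor_bracket M L Z (X i) v $ k = - D i $ k" for k
    proof -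
      have "hor_bracket M L Z (X i) v $ k
          = (\<Sum>j\<in>UNIV. coord_comp M c Z j z * hor (lag c) j (coord_comp M c (X i) k) z
            - coord_comp M c (X i) j z * hor (lag c) j (coord_comp M c Z k) z)"
        unfolding hor_bracket_def Let_def by (fold c_def, fold z_def) (simp add: c_def)
      also have "\<dots> = (\<Sum>j\<in>UNIV. if j = i then - D i $ k else 0)"
        by (intro sum.cong refl) (use Xc[OF z, of i] b(2) in \<open>auto simp: horX coord_comp_eq D_def axis_def\<close>)
      finally show ?thesis by simp
    qed
    then show ?thesis by (simp add: vec_eq_iff)
  qed
  \<comment> \<open>The linear map sending the axis vector number \<open>i\<close> to the bracket
    \<open>- D i\<close>; the sum of bracket terms is then its trace.\<close>
  define f where "f u = - (\<Sum>i\<in>UNIV. u $ i *\<^sub>R D i)" for u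
  have f: "linear f"
    by (rule linearI) (simp_all add: f_def scaleR_add_left sum.distrib scaleR_sum_right)
  have f_axis: "f (axis i 1) = - D i" for i
    by (simp add: f_def axis_def if_distrib[of "\<lambda>x. x *\<^sub>R _"] cong: if_cong)
  \<comment> \<open>Scaling the frame by \<open>b\<close> multiplies the determinant by its power
    \<open>b ^ CARD('n)\<close>, which is 1 and stationary at the point, so only the density is
    differentiated.\<close>
  have G: "frechet_derivative ((\<lambda>v. vol_form M A L v [] (map (\<lambda>X. X v) Xs)) \<circ> tchart_inv M c) (at z)
    = frechet_derivative (density c) (at z)"
  proof -
    have "frechet_derivative ((\<lambda>v. vol_form M A L v [] (map (\<lambda>X. X v) Xs)) \<circ> tchart_inv M c) (at z)
      = frechet_derivative (\<lambda>z. density c z * b (fst z) ^ CARD('n)) (at z)"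
    proof (rule frechet_derivative_cong_open[OF op z])
      fix z assume z: "z \<in> timage M c A"
      then have z': "tchart_inv M c z \<in> A" "fst z \<in> snd c ` fst c" "chart_inv c (fst z) \<in> fst c"
        using c by (auto simp: mem_timage_iff)
      have "map (to_coords M c (chart_inv c (fst z))) (map (\<lambda>X. X (tchart_inv M c z)) Xs)
          = map ((*\<^sub>R) (b (fst z))) es"
        by (simp add: Xs_def es_def Xc[OF z])
      moreover have "det_list (map ((*\<^sub>R) (b (fst z))) es) = b (fst z) ^ CARD('n)"
        unfolding det_list_map_linear[OF linear_scaleR] by (simp add: es_def det_list_axis)
      ultimately show "((\<lambda>v. vol_form M A L v [] (map (\<lambda>X. X v) Xs)) \<circ> tchart_inv M c) z
          = density c z * b (fst z) ^ CARD('n)"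
        using vol_form_eq'[OF c(1), of "tchart_inv M c z"] z' c by simp
    qed
    also have "\<dots> = frechet_derivative (density c) (at z)"
    proof -
      have "((\<lambda>z. b (fst z) ^ CARD('n)) has_derivative (\<lambda>_. 0)) (at z)"
        by (rule has_derivative_eq_rhs[OF has_derivative_power[OF bfst]]) simp
      from has_derivative_mult[OF smooth_on_has_derivative[OF smooth_on_density[OF c(1)] z] this]
      have "((\<lambda>z. density c z * b (fst z) ^ CARD('n)) has_derivative frechet_derivative (density c) (at z)) (at z)"
        using b(2) by simp
      then show ?thesis by (rule frechet_derivative_at[symmetric])
    qed
    finally show ?thesis .
  qed
  have "hor_deriv M L Z (\<lambda>v. vol_form M A L v [] (map (\<lambda>X. X v) Xs)) v
    = (\<Sum>k\<in>UNIV. coord_comp M c Z k z * hor (lag c) k (density c) z)"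
    unfolding hor_deriv_def Let_def by (fold c_def, fold z_def) (simp add: hor_cong[OF G])
  also have "hor_deriv M L Z (\<lambda>v. vol_form M A L v [] (map (\<lambda>X. X v) Xs)) v
    = l (vol_form M A L) v [] es
      + (\<Sum>i<CARD('n). vol_form M A L v [] (es[i := hor_bracket M L Z (Xs ! i) v]))"
    using lie_bracket_on_fields[OF l(1), of "vol_form M A L" Xs v] vol_form_mem v X
    by (simp add: len es) (auto simp: Xs_def)
  also have "l (vol_form M A L) v [] es = d v * density c z"
    using vol_form_chart_at[OF v, of es] by (simp add: l(2) c_def z_def es_def det_list_axis)
  also have "(\<Sum>i<CARD('n). vol_form M A L v [] (es[i := hor_bracket M L Z (Xs ! i) v]))
    = (\<Sum>i<CARD('n). density c z * det_list (es[i := f (es ! i)]))"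
    using vol_form_chart_at[OF v]
    by (intro sum.cong refl) (simp add: c_def z_def Xs_def es_def XZ f_axis)
  also have "\<dots> = density c z * trace (matrix f)"
    using sum_det_list_update_linear[OF len(2) f]
    by (simp add: es_def det_list_axis flip: sum_distrib_left)
  also have "trace (matrix f) = - (\<Sum>i\<in>UNIV. hor (lag c) i (coord_comp M c Z i) z)"
    by (simp add: trace_matrix_eq_sum f_axis D_def sum_negf)
  finally show ?thesis unfolding mult_minus_right by linarith
qed

end

section \<open>The exterior derivative of the contracted volume form\<close>

locale admissible_section = finsler_manifold M A L
  for M :: "('m::t2_space, 'n::finite) chart set" and A :: "('m, 'n) tvec set"
    and L :: "('m, 'n) tvec \<Rightarrow> real" +
  fixes U :: "'m set" and V :: "'m \<Rightarrow> real^'n" and Z :: "('m, 'n) tvec \<Rightarrow> real^'n"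
  assumes open_U: "open U" and adm: "admissible_field M A U V" and Z: "vector_field M A Z"
begin

definition local_V :: "('m, 'n) chart \<Rightarrow> real^'n \<Rightarrow> real^'n" where
  "local_V c x = to_coords M c (chart_inv c x) (V (chart_inv c x))"

lemma V_in_A: "p \<in> U \<Longrightarrow> (p, V p) \<in> A"
  using adm by (simp add: admissible_field_def)

lemma open_dom: "c \<in> M \<Longrightarrow> open (snd c ` (fst c \<inter> U))"
  by (intro open_chart_image open_U)

lemma smooth_on_local_V: "c \<in> M \<Longrightarrow> smooth_on (snd c ` (fst c \<inter> U)) (local_V c)"
  using adm by (simp add: admissible_field_def local_V_def[abs_def])

lemma tchart_V: "c \<in> M \<Longrightarrow> q \<in> fst c \<Longrightarrow> tchart M c (q, V q) = (snd c q, local_V c (snd c q))"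
  by (simp add: tchart_def local_V_def)

lemma local_V_mem: "c \<in> M \<Longrightarrow> q \<in> fst c \<Longrightarrow> q \<in> U \<Longrightarrow> (snd c q, local_V c (snd c q)) \<in> timage M c A"
  using tchart_mem_timage[of c "(q, V q)" A] V_in_A[of q] by (simp add: tchart_V)

lemma smooth_on_along_V:
  assumes c: "c \<in> M" and G: "smooth_on (timage M c A) G"
  shows "smooth_on (snd c ` (fst c \<inter> U)) (\<lambda>x. G (x, local_V c x))"
  by (rule smooth_on_compose[OF G open_dom[OF c] open_timage[OF c]])
    (use c in \<open>auto intro!: local_V_mem smooth_intros open_dom smooth_on_local_V\<close>)

lemma cov_deriv_component:
  fixes p :: 'm
  defines "c \<equiv> chart_at M p"
  shows "cov_deriv M L Y V p $ k = (\<Sum>j\<in>UNIV. Y $ j *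
    (frechet_derivative (\<lambda>x. local_V c x $ k) (at (snd c p)) (axis j 1)
      + nonlin (lag c) k j (tchart M c (p, V p))))"
  by (simp add: cov_deriv_def Let_def local_V_def c_def)

lemma cov_deriv_axis_sum:
  "cov_deriv M L Y V p $ k = (\<Sum>j\<in>UNIV. Y $ j * cov_deriv M L (axis j 1) V p $ k)"
  by (simp add: cov_deriv_component axis_def if_distrib[of "\<lambda>x. x * _"] cong: if_cong)

text \<open>The coordinate derivative of \<open>V\<close> is its covariant derivative minus the
  coefficients of the nonlinear connection; the latter combine with \<open>pdx\<close> to form
  \<open>hor\<close>.\<close>

lemma derivative_along_V:
  fixes p :: 'm
  defines "c \<equiv> chart_at M p"
  defines "z \<equiv> tchart M c (p, V p)"
  assumes p: "p \<in> U" and G: "smooth_on (timage M c A) G"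
  shows "frechet_derivative (\<lambda>x. G (x, local_V c x)) (at (snd c p)) (axis j 1)
    = hor (lag c) j G z + (\<Sum>k\<in>UNIV. cov_deriv M L (axis j 1) V p $ k * pdy k G z)"
proof -
  have c: "c \<in> M" "p \<in> fst c" unfolding c_def by (rule chart_at_props)+
  have z_eq: "z = (snd c p, local_V c (snd c p))" unfolding z_def by (rule tchart_V[OF c])
  have z: "z \<in> timage M c A" unfolding z_eq by (rule local_V_mem[OF c p])
  let ?D = "frechet_derivative G (at z)"
  let ?DV = "frechet_derivative (local_V c) (at (snd c p))"
  have DV: "(local_V c has_derivative ?DV) (at (snd c p))"
    by (rule smooth_on_has_derivative[OF smooth_on_local_V[OF c(1)]]) (use c p in auto)
  have l: "linear ?D"
    by (rule linear_frechet_derivative[OF smooth_on_differentiable[OF G z]])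
  have "((\<lambda>x. (x, local_V c x)) has_derivative (\<lambda>h. (h, ?DV h))) (at (snd c p))"
    by (intro has_derivative_Pair has_derivative_ident DV)
  from has_derivative_compose[OF this, of G ?D] smooth_on_has_derivative[OF G z]
  have "((\<lambda>x. G (x, local_V c x)) has_derivative (\<lambda>h. ?D (h, ?DV h))) (at (snd c p))"
    by (simp add: z_eq)
  then have "frechet_derivative (\<lambda>x. G (x, local_V c x)) (at (snd c p)) (axis j 1) = ?D (axis j 1, ?DV (axis j 1))"
    by (simp flip: frechet_derivative_at)
  also have "\<dots> = pdx j G z + (\<Sum>k\<in>UNIV. ?DV (axis j 1) $ k * pdy k G z)"
    using linear_on_Pair_axis_sum(1)[OF l, of "axis j 1" "?DV (axis j 1)"] by (simp add: pdx_def pdy_def)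
  also have "?DV (axis j 1) = (\<chi> k. cov_deriv M L (axis j 1) V p $ k - nonlin (lag c) k j z)"
    unfolding vec_eq_iff
  proof
    fix k
    have "frechet_derivative (\<lambda>x. local_V c x $ k) (at (snd c p)) = (\<lambda>h. ?DV h $ k)"
      using frechet_derivative_at[OF bounded_linear.has_derivative[OF bounded_linear_vec_nth DV]] by simp
    then show "?DV (axis j 1) $ k = (\<chi> k. cov_deriv M L (axis j 1) V p $ k - nonlin (lag c) k j z) $ k"
      by (simp add: cov_deriv_component axis_def[of j] if_distrib[of "\<lambda>x. x * _"] c_def z_def cong: if_cong)
  qed
  finally show ?thesis
    by (simp add: hor_def algebra_simps sum_subtractf)
qed

text \<open>In the preferred chart the fibre coordinates are the given ones, so the defining limit
  is a fibre derivative in each component.\<close>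

lemma vert_deriv_component:
  fixes p :: 'm
  defines "c \<equiv> chart_at M p"
  assumes p: "p \<in> U"
  shows "vert_deriv w Z (p, V p) $ i = (\<Sum>k\<in>UNIV. w $ k * pdy k (coord_comp M c Z i) (tchart M c (p, V p)))"
proof -
  have c: "c \<in> M" "p \<in> fst c" unfolding c_def by (rule chart_at_props)+
  let ?z = "tchart M c (p, V p)"
  have z: "?z \<in> timage M c A" using c V_in_A[OF p] by (intro tchart_mem_timage) auto
  define D where "D i = frechet_derivative (coord_comp M c Z i) (at ?z) (0, w)" for i
  have comp: "coord_comp M c Z i (tchart M c (p, u)) = Z (p, u) $ i" for i u
    using c by (simp add: coord_comp_eq) (simp add: c_def)
  have "((\<lambda>t. coord_comp M c Z i (tchart M c (p, V p + t *\<^sub>R of_coords M c p w))) has_real_derivative D i) (at 0)" for i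
    unfolding D_def by (rule fibre_DERIV[OF c V_in_A[OF p] smooth_on_coord_comp[OF Z c(1)]])
  then have "((\<lambda>t. (Z (p, V p + t *\<^sub>R w) $ i - Z (p, V p) $ i) / t) \<longlongrightarrow> D i) (at 0)" for i
    unfolding comp by (simp add: has_field_derivative_iff c_def)
  then have "((\<lambda>t. (1 / t) *\<^sub>R (Z (p, V p + t *\<^sub>R w) - Z (p, V p))) \<longlongrightarrow> (\<chi> i. D i)) (at 0)"
    by (intro vec_tendstoI) simp
  then have "vert_deriv w Z (p, V p) = (\<chi> i. D i)"
    unfolding vert_deriv_def by (simp add: tendsto_Lim)
  moreover have "D i = (\<Sum>k\<in>UNIV. w $ k * pdy k (coord_comp M c Z i) ?z)"
  proof -
    have l: "linear (frechet_derivative (coord_comp M c Z i) (at ?z))"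
      by (rule linear_frechet_derivative[OF smooth_on_differentiable[OF smooth_on_coord_comp[OF Z c(1)] z]])
    show ?thesis
      using linear_on_Pair_axis_sum(1)[OF l, of 0 w] linear_0[OF l] by (simp add: D_def pdy_def zero_prod_def)
  qed
  ultimately show ?thesis by simp
qed

text \<open>The vector density whose ordinary coordinate divergence represents the exterior
  derivative of \<open>flux_form\<close>.\<close>

definition flux :: "('m, 'n) chart \<Rightarrow> real^'n \<Rightarrow> real^'n" where
  "flux c x = (\<chi> i. density c (x, local_V c x) * coord_comp M c Z i (x, local_V c x))"

lemma smooth_on_flux: "c \<in> M \<Longrightarrow> smooth_on (snd c ` (fst c \<inter> U)) (flux c)"
  unfolding flux_def
  by (intro smooth_on_vec_lambda smooth_on_mult open_dom smooth_on_along_V smooth_on_density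
      smooth_on_coord_comp Z)

definition flux_form :: "('m, 'n) form" where
  "flux_form = interior_product (\<lambda>p. Z (p, V p)) (\<lambda>p. vol_form M A L (p, V p) [])"

text \<open>By linearity in the first slot the density is moved onto the vector, leaving a constant
  volume form.\<close>

lemma flux_form_eq:
  assumes c: "c \<in> M" "q \<in> fst c" and q: "q \<in> U"
  shows "flux_form q vs = det_list (flux c (snd c q) # map (to_coords M c q) vs)"
proof -
  let ?z = "tchart M c (q, V q)"
  have "flux c (snd c q) = density c ?z *\<^sub>R to_coords M c q (Z (q, V q))"
    using c by (simp add: flux_def tchart_V[symmetric] vec_eq_iff coord_comp_eq)
  moreover have l: "linear (\<lambda>u. det_list (u # map (to_coords M c q) vs))"
    using alt_form_linear[OF alt_form_det_list, of "[]"] by simp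
  ultimately show ?thesis
    using vol_form_eq[OF c V_in_A[OF q]]
    by (simp add: flux_form_def interior_product_def linear_cmul[OF l])
qed

lemma smooth_form_flux: "smooth_form M (CARD('n) - 1) U flux_form"
  unfolding smooth_form_def
proof (intro conjI ballI allI impI)
  fix p assume p: "p \<in> U"
  let ?c = "chart_at M p"
  note eq = flux_form_eq[OF chart_at_props[of p] p, unfolded to_coords_chart_at list.map_id]
  show "alt_form (CARD('n) - 1) (flux_form p)"
    unfolding alt_form_def
  proof (intro conjI allI impI)
    show "flux_form p vs = 0" if "length vs \<noteq> CARD('n) - 1" for vs
      using that by (simp add: eq det_list_def)
    show "linear (\<lambda>v. flux_form p (vs @ v # ws))" for vs ws
      using alt_form_linear[OF alt_form_det_list, of "flux ?c (snd ?c p) # vs" ws] by (simp add: eq)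
    show "flux_form p vs = 0" if "\<not> distinct vs" for vs
      using alt_form_det_list[where 'n = 'n] that by (auto simp: eq alt_form_def)
  qed
next
  fix c and js :: "'n list"
  assume c: "c \<in> M"
  let ?S = "snd c ` (fst c \<inter> U)"
  have l: "linear (\<lambda>u. det_list (u # map (\<lambda>j. axis j 1) js))"
    using alt_form_linear[OF alt_form_det_list, of "[]"] by simp
  have "smooth_on ?S (\<lambda>x. det_list (flux c x # map (\<lambda>j. axis j 1) js))"
    by (rule smooth_on_bounded_linear[OF _ open_dom[OF c] smooth_on_flux[OF c]])
      (use l in \<open>simp add: linear_conv_bounded_linear\<close>)
  then show "smooth_on ?S (\<lambda>x. flux_form (chart_inv c x) (map (coord_vec M c (chart_inv c x)) js))"
    by (rule smooth_on_cong[OF open_dom[OF c]])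
      (use c in \<open>auto simp: flux_form_eq o_def to_coords_coord_vec\<close>)
qed

text \<open>The product rule yields four sums: the two horizontal ones are
  \<open>divergence_formula\<close>, the vertical derivative of \<open>Z\<close> is the trace term,
  and that of the density is the mean Cartan term.\<close>

lemma trace_flux_derivative:
  fixes p :: 'm
  defines "c \<equiv> chart_at M p"
  assumes p: "p \<in> U" and div: "is_divergence M A L Z d"
  shows "trace (matrix (frechet_derivative (flux c) (at (snd c p))))
    = (d (p, V p) + (mean_cartan_at M L (p, V p) (cov_deriv M L (Z (p, V p)) V p)
        + trace (matrix (\<lambda>Y. vert_deriv (cov_deriv M L Y V p) Z (p, V p)))))
      * density c (tchart M c (p, V p))"
proof -
  have c: "c \<in> M" "p \<in> fst c" unfolding c_def by (rule chart_at_props)+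
  define z where "z = tchart M c (p, V p)"
  have z: "z \<in> timage M c A" unfolding z_def using c V_in_A[OF p] by (intro tchart_mem_timage) auto
  define s where "s = density c"
  define Zc where "Zc = coord_comp M c Z"
  define Dv where "Dv j k = cov_deriv M L (axis j 1) V p $ k" for j k
  have sm: "smooth_on (timage M c A) s" "smooth_on (timage M c A) (Zc i)" for i
    unfolding s_def Zc_def by (intro smooth_on_density smooth_on_coord_comp Z c)+
  note diff = smooth_on_differentiable[OF sm(1) z] smooth_on_differentiable[OF sm(2) z]
  have Zz: "Zc j z = Z (p, V p) $ j" for j
    using c by (simp add: Zc_def coord_comp_eq z_def) (simp add: c_def)
  have "frechet_derivative (flux c) (at (snd c p)) (axis i 1) $ i
    = frechet_derivative (\<lambda>x. s (x, local_V c x) * Zc i (x, local_V c x)) (at (snd c p)) (axis i 1)" for i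
  proof -
    have "(flux c has_derivative frechet_derivative (flux c) (at (snd c p))) (at (snd c p))"
      by (rule smooth_on_has_derivative[OF smooth_on_flux[OF c(1)]]) (use c p in auto)
    from frechet_derivative_at[OF bounded_linear.has_derivative[OF bounded_linear_vec_nth this, of i]]
    show ?thesis by (simp add: flux_def s_def Zc_def fun_eq_iff)
  qed
  also have "frechet_derivative (\<lambda>x. s (x, local_V c x) * Zc i (x, local_V c x)) (at (snd c p)) (axis i 1)
    = hor (lag c) i (\<lambda>z. s z * Zc i z) z + (\<Sum>k\<in>UNIV. Dv i k * pdy k (\<lambda>z. s z * Zc i z) z)" for i
    using derivative_along_V[OF p, of "\<lambda>z. s z * Zc i z" i] smooth_on_mult[OF open_timage[OF c(1)] sm]
    by (simp add: c_def z_def Dv_def)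
  also have "hor (lag c) i (\<lambda>z. s z * Zc i z) z + (\<Sum>k\<in>UNIV. Dv i k * pdy k (\<lambda>z. s z * Zc i z) z)
    = s z * hor (lag c) i (Zc i) z + Zc i z * hor (lag c) i s z
      + s z * (\<Sum>k\<in>UNIV. Dv i k * pdy k (Zc i) z) + Zc i z * (\<Sum>k\<in>UNIV. Dv i k * pdy k s z)" for i
    by (simp add: hor_mult[OF diff] pdy_mult[OF diff] algebra_simps sum.distrib sum_distrib_left)
  finally have "trace (matrix (frechet_derivative (flux c) (at (snd c p))))
    = s z * (\<Sum>i\<in>UNIV. hor (lag c) i (Zc i) z) + (\<Sum>i\<in>UNIV. Zc i z * hor (lag c) i s z)
      + s z * (\<Sum>i\<in>UNIV. \<Sum>k\<in>UNIV. Dv i k * pdy k (Zc i) z)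
      + (\<Sum>i\<in>UNIV. Zc i z * (\<Sum>k\<in>UNIV. Dv i k * pdy k s z))"
    by (simp add: trace_matrix_eq_sum sum.distrib sum_distrib_left)
  also have "(\<Sum>i\<in>UNIV. \<Sum>k\<in>UNIV. Dv i k * pdy k (Zc i) z)
    = trace (matrix (\<lambda>Y. vert_deriv (cov_deriv M L Y V p) Z (p, V p)))"
    by (simp add: trace_matrix_eq_sum vert_deriv_component[OF p] Dv_def Zc_def c_def z_def)
  \<comment> \<open>Both the covariant derivative and the mean Cartan tensor are linear, so each is
    expanded on coordinate vectors before the sums are exchanged.\<close>
  also have "(\<Sum>i\<in>UNIV. Zc i z * (\<Sum>k\<in>UNIV. Dv i k * pdy k s z))
    = s z * mean_cartan_at M L (p, V p) (cov_deriv M L (Z (p, V p)) V p)"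
  proof -
    have "mean_cartan_at M L (p, V p) (cov_deriv M L (Z (p, V p)) V p)
      = mean_cartan (lag c) z (cov_deriv M L (Z (p, V p)) V p)"
      by (simp add: mean_cartan_at_def Let_def c_def z_def)
    also have "\<dots> = (\<Sum>k\<in>UNIV. (\<Sum>i\<in>UNIV. Zc i z * Dv i k) * mean_cartan (lag c) z (axis k 1))"
      by (subst mean_cartan_axis_sum) (simp add: cov_deriv_axis_sum[of "Z (p, V p)"] Zz Dv_def)
    finally have "s z * mean_cartan_at M L (p, V p) (cov_deriv M L (Z (p, V p)) V p)
      = (\<Sum>k\<in>UNIV. (\<Sum>i\<in>UNIV. Zc i z * Dv i k) * pdy k s z)"
      by (simp add: s_def pdy_density[OF c(1) z] sum_distrib_left sum_distrib_right mult_ac)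
    also have "\<dots> = (\<Sum>i\<in>UNIV. Zc i z * (\<Sum>k\<in>UNIV. Dv i k * pdy k s z))"
      by (simp add: sum_distrib_left sum_distrib_right mult.assoc) (rule sum.swap)
    finally show ?thesis by simp
  qed
  also have "s z * (\<Sum>i\<in>UNIV. hor (lag c) i (Zc i) z) + (\<Sum>i\<in>UNIV. Zc i z * hor (lag c) i s z)
    = d (p, V p) * s z"
    using divergence_formula[OF div V_in_A[OF p]] by (simp add: c_def z_def s_def Zc_def)
  finally show ?thesis by (simp add: s_def z_def algebra_simps)
qed

lemma ext_deriv_flux:
  assumes p: "p \<in> U" and div: "is_divergence M A L Z d" and len: "length vs = CARD('n)"
    and nz: "det_list vs \<noteq> 0"
  shows "ext_deriv M flux_form p vs
    = (d (p, V p) + (mean_cartan_at M L (p, V p) (cov_deriv M L (Z (p, V p)) V p)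
        + trace (matrix (\<lambda>Y. vert_deriv (cov_deriv M L Y V p) Z (p, V p)))))
      * vol_form M A L (p, V p) [] vs"
proof -
  define c where "c = chart_at M p"
  have c: "c \<in> M" "p \<in> fst c" unfolding c_def by (rule chart_at_props)+
  let ?x = "snd c p" and ?S = "snd c ` (fst c \<inter> U)"
  let ?D = "frechet_derivative (flux c) (at ?x)"
  have x: "?x \<in> ?S" using c p by auto
  have D: "(flux c has_derivative ?D) (at ?x)"
    by (rule smooth_on_has_derivative[OF smooth_on_flux[OF c(1)] x])
  \<comment> \<open>The remaining arguments are coordinate-constant fields, so
    \<open>to_coords\<close> undoes \<open>of_coords\<close> and only the flux depends on
    \<open>x\<close>.\<close>
  have "frechet_derivative (\<lambda>x. flux_form (chart_inv c x) (map (of_coords M c (chart_inv c x)) us)) (at ?x) u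
    = det_list (?D u # us)" for us u
  proof -
    have "bounded_linear (\<lambda>u. det_list (u # us))"
      using alt_form_linear[OF alt_form_det_list, of "[]" us] by (simp add: linear_conv_bounded_linear)
    from frechet_derivative_at[OF bounded_linear.has_derivative[OF this D]]
    have "frechet_derivative (\<lambda>x. det_list (flux c x # us)) (at ?x) u = det_list (?D u # us)"
      by (simp add: fun_eq_iff)
    moreover have "frechet_derivative (\<lambda>x. flux_form (chart_inv c x) (map (of_coords M c (chart_inv c x)) us)) (at ?x)
      = frechet_derivative (\<lambda>x. det_list (flux c x # us)) (at ?x)"
      by (rule frechet_derivative_cong_open[OF open_dom[OF c(1)] x])
        (use c in \<open>auto simp: flux_form_eq o_def\<close>)
    ultimately show ?thesis by simp
  qed
  then have "ext_deriv M flux_form p vs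
    = (\<Sum>i<CARD('n). (- 1) ^ i * det_list (?D (vs ! i) # take i vs @ drop (Suc i) vs))"
    using len by (simp add: ext_deriv_def Let_def c_def del: map_append)
  also have "\<dots> = trace (matrix ?D) * det_list vs"
    by (rule alternating_sum_det_list[OF len has_derivative_linear[OF D] nz])
  finally show ?thesis
    using trace_flux_derivative[OF p div] vol_form_chart_at[OF V_in_A[OF p], of vs]
    by (simp add: c_def)
qed

end

section \<open>Linearity of the integral\<close>

text \<open>Second countability provides a countable subcover by the Lindelof property, so the
  choice in \<open>cover_seq\<close> is a genuine one.\<close>

lemma cover_seq_props:
  fixes M :: "('m::second_countable_topology, 'n::finite) chart set"
  assumes "\<forall>c\<in>M. open (fst c)" "(\<Union>c\<in>M. fst c) = UNIV"
  shows "range (cover_seq M S) \<subseteq> M"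
proof -
  obtain F where F: "F \<subseteq> fst ` M" "countable F" "\<Union>F = \<Union>(fst ` M)"
    using Lindelof[of "fst ` M"] assms(1) by auto
  \<comment> \<open>The enumeration \<open>from_nat_into\<close> needs a nonempty set; the union is
    the universe of a type, hence nonempty.\<close>
  then have "F \<noteq> {}" using assms(2) by auto
  have "from_nat_into F k \<in> fst ` M" for k
    using from_nat_into[OF \<open>F \<noteq> {}\<close>, of k] F(1) by (rule subsetD[rotated])
  then have "\<forall>k. \<exists>c. c \<in> M \<and> fst c = from_nat_into F k"
    unfolding image_iff by metis
  from choice[OF this] obtain c where c: "\<And>k. c k \<in> M" "\<And>k. fst (c k) = from_nat_into F k"
    by auto
  have "(\<Union>k. fst (c k)) = UNIV"
    by (simp only: c(2) range_from_nat_into[OF \<open>F \<noteq> {}\<close> F(2)] F(3) assms(2))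
  then have "range c \<subseteq> M \<and> S \<subseteq> (\<Union>k. fst (c k))"
    using image_subsetI[of UNIV c M] c(1) by simp
  then have "\<exists>c. range c \<subseteq> M \<and> S \<subseteq> (\<Union>k::nat. fst (c k))" by (intro exI[of _ c])
  from someI_ex[OF this] show ?thesis by (simp add: cover_seq_def)
qed

context atlas
begin

text \<open>Reduces the comparison of integrands to linearly independent lists, where the formula
  for the exterior derivative is available.\<close>

lemma det_list_coord_vec:
  assumes "c \<in> M" "p \<in> fst c"
  shows "det_list (map (\<lambda>i. coord_vec M c p (coord_ix i)) [0..<CARD('n)]) > 0"
proof -
  have "map (\<lambda>i. coord_vec M c p (coord_ix i)) [0..<CARD('n)]
      = map (of_coords M c p) (map (\<lambda>k. axis (coord_ix k) 1) [0..<CARD('n)])"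
    by (simp add: coord_vec_def)
  then show ?thesis
    using det_transition_pos[OF assms(1) chart_at_props(1) assms(2) chart_at_props(2)]
    by (simp only: det_list_map_linear[OF linear_of_coords[OF assms], unfolded of_coords_transition]
        det_list_axis of_coords_transition mult_1_right)
qed

text \<open>Where the indicator is 1 the coordinates come from a point of \<open>S\<close> in the
  chart, and the form is evaluated on the coordinate frame there; elsewhere all terms
  vanish.\<close>

lemma local_integrand_add:
  assumes cover: "range (cover_seq M S) \<subseteq> M"
    and eq: "\<And>p vs. p \<in> S \<Longrightarrow> length vs = CARD('n) \<Longrightarrow> det_list vs \<noteq> 0 \<Longrightarrow> \<omega> p vs = \<omega>1 p vs + \<omega>2 p vs"
  shows "local_integrand M CARD('n) M S \<omega> k f
    = local_integrand M CARD('n) M S \<omega>1 k f + local_integrand M CARD('n) M S \<omega>2 k f"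
proof -
  let ?c = "cover_seq M S k"
  let ?x = "slice_point CARD('n) f :: real^'n"
  let ?I = "snd ?c ` (S \<inter> disjointed (\<lambda>i. fst (cover_seq M S i)) k)"
  have c: "?c \<in> M" using cover by auto
  show ?thesis
  proof (cases "?x \<in> ?I")
    case True
    then obtain q where q: "?x = snd ?c q" "q \<in> S" "q \<in> fst ?c"
      using disjointed_subset[of "\<lambda>i. fst (cover_seq M S i)" k] by auto
    then have q': "chart_inv ?c ?x = q" using c by simp
    have "\<omega> q (map (\<lambda>i. coord_vec M ?c q (coord_ix i)) [0..<CARD('n)])
      = \<omega>1 q (map (\<lambda>i. coord_vec M ?c q (coord_ix i)) [0..<CARD('n)])
        + \<omega>2 q (map (\<lambda>i. coord_vec M ?c q (coord_ix i)) [0..<CARD('n)])"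
      using det_list_coord_vec[OF c q(3)] by (intro eq q(2)) auto
    then show ?thesis
      by (simp add: local_integrand_def Let_def q' algebra_simps)
  qed (simp add: local_integrand_def Let_def)
qed

end

text \<open>The second summand is integrated as the difference of two integrable forms, piece by
  piece and then in the series over the pieces.\<close>

lemma form_integral_add:
  fixes M :: "('m::topological_space, 'n::finite) chart set"
  assumes add: "\<And>k f. local_integrand M m C S \<omega> k f = local_integrand M m C S \<omega>1 k f + local_integrand M m C S \<omega>2 k f"
    and int: "form_integrable M m C S \<omega>" "form_integrable M m C S \<omega>1"
  shows "form_integral M m C S \<omega> = form_integral M m C S \<omega>1 + form_integral M m C S \<omega>2"
proof -
  let ?\<mu> = "slice_measure TYPE('n) m"
  let ?I = "\<lambda>\<omega> k. \<integral>f. local_integrand M m C S \<omega> k f \<partial>?\<mu>"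
  have i: "integrable ?\<mu> (local_integrand M m C S \<omega> k)" "integrable ?\<mu> (local_integrand M m C S \<omega>1 k)" for k
    using int by (auto simp: form_integrable_def)
  have s: "summable (?I \<omega>)" "summable (?I \<omega>1)"
    using int by (auto simp: form_integrable_def intro: summable_comparison_test'[where N = 0])
  have "local_integrand M m C S \<omega>2 k = (\<lambda>f. local_integrand M m C S \<omega> k f - local_integrand M m C S \<omega>1 k f)" for k
    by (simp add: add)
  then have "?I \<omega>2 = (\<lambda>k. ?I \<omega> k - ?I \<omega>1 k)"
    by (simp add: Bochner_Integration.integral_diff[OF i] del: add)
  then have "(\<Sum>k. ?I \<omega>2 k) = (\<Sum>k. ?I \<omega> k) - (\<Sum>k. ?I \<omega>1 k)"
    using suminf_diff[OF s] by simp
  then show ?thesis by (simp add: form_integral_def)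
qed

theorem theorem4p13:
  fixes M :: "('m::{t2_space, second_countable_topology}, 'n::finite) chart set"
    and A :: "('m, 'n) tvec set"
    and L :: "('m, 'n) tvec \<Rightarrow> real"
    and Z :: "('m, 'n) tvec \<Rightarrow> real^'n"
    and divZ :: "('m, 'n) tvec \<Rightarrow> real"
    and U Dbar :: "'m set"
    and V :: "'m \<Rightarrow> real^'n"
  assumes "CARD('n) \<ge> 2"
    and "connected (UNIV :: 'm set)"
    and "oriented_manifold M"
    and "admissible_cone M A"
    and "pseudo_finsler M A L"
    and "vector_field M A Z"
    and "open U"
    and "admissible_field M A U V"
    and "is_domain Dbar" and "Dbar \<subseteq> U"
    and "almost_smooth_boundary M Dbar"
    and "stokes_applicable M U Dbar"
    and "compact (closure {p\<in>U. Z (p, V p) \<noteq> 0} \<inter> Dbar)"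
    and "is_divergence M A L Z divZ"
    and "domain_integrable M Dbar (\<lambda>p vs. divZ (p, V p) * vol_form M A L (p, V p) [] vs)"
  shows "domain_integral M Dbar (\<lambda>p vs. divZ (p, V p) * vol_form M A L (p, V p) [] vs)
       + domain_integral M Dbar (\<lambda>p vs.
           (mean_cartan_at M L (p, V p) (cov_deriv M L (Z (p, V p)) V p)
            + trace (matrix (\<lambda>Y. vert_deriv (cov_deriv M L Y V p) Z (p, V p))))
           * vol_form M A L (p, V p) [] vs)
       = boundary_integral M Dbar
           (interior_product (\<lambda>p. Z (p, V p)) (\<lambda>p. vol_form M A L (p, V p) []))"
proof -
  interpret admissible_section M A L U V Z
    by unfold_locales (fact assms)+
  let ?\<omega>1 = "\<lambda>p vs. divZ (p, V p) * vol_form M A L (p, V p) [] vs"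
  let ?\<omega>2 = "\<lambda>p vs. (mean_cartan_at M L (p, V p) (cov_deriv M L (Z (p, V p)) V p)
      + trace (matrix (\<lambda>Y. vert_deriv (cov_deriv M L Y V p) Z (p, V p)))) * vol_form M A L (p, V p) [] vs"
  have "{p\<in>U. \<exists>vs. flux_form p vs \<noteq> 0} \<subseteq> {p\<in>U. Z (p, V p) \<noteq> 0}"
  proof clarify
    fix p vs assume p: "p \<in> U" and "flux_form p vs \<noteq> 0" and "Z (p, V p) = 0"
    moreover have "linear (\<lambda>u. det_list (u # vs))"
      using alt_form_linear[OF alt_form_det_list, of "[]"] by simp
    ultimately show False
      using vol_form_chart_at[OF V_in_A[OF p]] linear_0
      by (fastforce simp: flux_form_def interior_product_def)
  qed
  \<comment> \<open>The smaller support meets the domain in a closed part of the compact set given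
    for \<open>Z\<close>.\<close>
  then have "closure {p\<in>U. \<exists>vs. flux_form p vs \<noteq> 0} \<inter> Dbar
    = closure {p\<in>U. \<exists>vs. flux_form p vs \<noteq> 0} \<inter> (closure {p\<in>U. Z (p, V p) \<noteq> 0} \<inter> Dbar)"
    using closure_mono by blast
  then have "compact (closure {p\<in>U. \<exists>vs. flux_form p vs \<noteq> 0} \<inter> Dbar)"
    using closed_Int_compact[OF closed_closure assms(13)] by simp
  then have stokes: "domain_integrable M Dbar (ext_deriv M flux_form)"
    "domain_integral M Dbar (ext_deriv M flux_form) = boundary_integral M Dbar flux_form"
    using assms(12) smooth_form_flux unfolding stokes_applicable_def by blast+
  have cover: "range (cover_seq M (interior Dbar)) \<subseteq> M"
  proof (rule cover_seq_props)
    show "(\<Union>c\<in>M. fst c) = UNIV" using assms(3) by (simp only: oriented_manifold_def)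
  qed (simp add: open_chart_domain)
  have "ext_deriv M flux_form p vs = ?\<omega>1 p vs + ?\<omega>2 p vs"
    if "p \<in> interior Dbar" "length vs = CARD('n)" "det_list vs \<noteq> 0" for p vs
    using ext_deriv_flux[OF _ assms(14) that(2,3), of p] that(1) interior_subset assms(10)
    by (auto simp: algebra_simps)
  from form_integral_add[OF local_integrand_add[OF cover this] stokes(1) assms(15)]
  show ?thesis
    unfolding stokes(2) by (simp add: flux_form_def)
qed

end
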